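(* Let $n\ge2$, let $X \subset \mathbb{R}^n$, and let $\mathcal{L}_X$ be a lamination of $X$. Let $M$ be the set of triples $(Y,\mathcal{L}_Y,f)$ defined in the context, equipped with the distance $\mathbf{d}$, and let $\mathcal{C}_b(X,\mathbb{R}^n)$ be the set of bounded continuous functions $X\to\mathbb{R}^n$ with the metric $d_{\mathrm{sup}}(F_1,F_2)=\sup_{x\in X}|F_1(x)-F_2(x)|$. Then the operator $\Theta: M \to \mathcal{C}_b(X,\mathbb{R}^n)$ which sends $(Y,\mathcal{L}_Y,f)$ to the canonical extension $F:X\to Y\subset\mathbb{R}^n$ of $f$ is continuous. Moreover, if $X$ is bounded (so that $(X,\mathcal{L}_X,\mathrm{id}_{\mathcal{E}(\mathcal{L}_X)})\in M$), then $\Theta(X, \mathcal{L}_X, \mathrm{id}_{\mathcal{E}(\mathcal{L}_X)}) = \mathrm{id}_X$.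
   Context: An arc is a space homeomorphic to $[0,1]$; a parameterization of an arc $A$ is a homeomorphism $\gamma:[0,1]\to A$. A collection of arcs $\mathcal{L}_X$ is a lamination of a space $X\subset\mathbb{R}^n$ if: (1) $X=\bigcup\mathcal{L}_X$; (2) any two distinct arcs in $\mathcal{L}_X$ meet at most in one common endpoint; (3) given a sequence $\langle A_i\rangle_{i=1}^\infty$ of arcs in $\mathcal{L}_X$: (a) if $\mathrm{diam}\,A_i\to0$, then any accumulation point of the arcs $A_i$ (a point each of whose neighborhoods meets $A_i$ for infinitely many $i$) is either an endpoint of some arc in $\mathcal{L}_X$, or not in $X$; (b) otherwise, there is an arc $A_\infty\in\mathcal{L}_X$, a subsequence $\langle A_{i_j}\rangle_{j=1}^\infty$ and homeomorphisms $h_j:A_\infty\to A_{i_j}$ such that $\sup_{p\in A_\infty}|h_j(p)-p|\to0$ as $j\to\infty$. $\mathcal{E}(\mathcal{L}_X)$ denotes the set of all endpoints of the arcs in $\mathcal{L}_X$. Reparameterization: for paths (continuous maps) $\gamma_1,\gamma_2:[0,1]\to\mathbb{R}^n$, $\gamma_1\approx\gamma_2$ if there are non-decreasing onto maps $m_1,m_2:[0,1]\to[0,1]$ such that $\gamma_i$ is constant on each fiber $m_i^{-1}(s)$ for $i=1,2$, and $\gamma_1\circ m_1^{-1}=\gamma_2\circ m_2^{-1}$. $[\gamma]$ is the equivalence class of $\gamma$, and $\rho([\gamma_1],[\gamma_2])=\inf\{\sup_{t\in[0,1]}|\lambda_1(t)-\lambda_2(t)|:\lambda_1\in[\gamma_1],\lambda_2\in[\gamma_2]\}$.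 For the fixed $X$ and $\mathcal{L}_X$, $M$ is the set of all triples $(Y,\mathcal{L}_Y,f)$ such that $Y\subset\mathbb{R}^n$ is bounded, $\mathcal{L}_Y$ is a lamination of $Y$, and $f:\mathcal{E}(\mathcal{L}_X)\to\mathcal{E}(\mathcal{L}_Y)$ is a continuous function which maps the endpoints of any arc in $\mathcal{L}_X$ onto the set of endpoints of some arc in $\mathcal{L}_Y$ (by (2) this arc is unique; call it the corresponding arc in $\mathcal{L}_Y$). The distance on $M$ is $$\mathbf{d}\big((Y_1,\mathcal{L}_{Y_1},f_1),(Y_2,\mathcal{L}_{Y_2},f_2)\big)=\sup\rho([\lambda_1],[\lambda_2]),$$ the supremum over all $\gamma,\lambda_1,\lambda_2$ such that $\gamma$ parameterizes an arc $A\in\mathcal{L}_X$ and, for $i=1,2$, $\lambda_i$ parameterizes the corresponding arc in $\mathcal{L}_{Y_i}$ with $\lambda_i(0)=f_i(\gamma(0))$ and $\lambda_i(1)=f_i(\gamma(1))$. Definition of $\mathsf{len}=\mathsf{len}_n$ for a path $\gamma:[a,b]\to\mathbb{R}^n$ ($a\le b$). For a unit vector $u\in \mathbb{S}^{n-1}$, $x\in[0,1]$, $\mu\in(0,1]$ and $j\in\mathbb{Z}$ put $S_j^{x,u,\mu}=\{z\in\mathbb{R}^n: \mu(j+x)\le\langle z,u\rangle\le\mu(j+1+x)\}$, and for $A\subset\mathbb{R}^n$ put $\|A\|_u=\mathrm{diam}\{\langle z,u\rangle: z\in A\}$. Let $C_0,C_1,C_2,\ldots$ (a finite or infinite list) enumerate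 all connected components $C$ of the sets $\gamma^{-1}(S_j^{x,u,\mu})$, $j\in\mathbb{Z}$, for which $\|\gamma(C)\|_u>0$, ordered so that $\|\gamma(C_k)\|_u\ge\|\gamma(C_{k+1})\|_u$ for all $k$ (this is possible, since for each $\varepsilon>0$ only finitely many such components have $\|\gamma(C)\|_u\ge\varepsilon$). Put $L^{x,u,\mu}(\gamma)=\sum_{k\ge0}2^{-k}\|\gamma(C_k)\|_u$ (missing terms count as $0$), and $$\mathsf{len}(\gamma)=\int_0^1\int_{\mathbb{S}^{n-1}}\int_0^1 L^{x,u,\mu}(\gamma)\,dx\,d\sigma(u)\,d\mu,$$ where $\sigma$ is the rotation-invariant probability measure on $\mathbb{S}^{n-1}$. (Replacing $u$ by $-u$ does not change the integral over $x$, so equivalently one integrates over $(n-1)$-dimensional real projective space; for $n=2$, identifying $\mathbb{R}^2$ with $\mathbb{C}$, one may take $u=ie^{t\pi i}$ and integrate $dt$ over $t\in[0,1]$.) Standard parameterization: if $\gamma:[0,1]\to\mathbb{R}^n$ is constant, $\widetilde\gamma=\gamma$; otherwise, for $s\in[0,1]$, $\widetilde\gamma(s)=\gamma(t)$ where $t\in[0,1]$ is such that $\mathsf{len}(\gamma|_{[0,t]})=s\cdot\mathsf{len}(\gamma)$ (such $t$ exists, and $\gamma(t)$ does not depend on its choice). Midpoint parameterization: let $m\in(0,1)$ be such that $\mathsf{len}(\gamma|_{[0,m]})=\mathsf{len}(\gamma|_{[m,1]})$; define $\gamma_1(t)=\gamma(m-mt)$ and $\gamma_2(t)=\gamma(m+(1-m)t)$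 on $[0,1]$; then $\gamma^\ast(t)=\widetilde\gamma_1(1-2t)$ for $0\le t\le\frac12$ and $\gamma^\ast(t)=\widetilde\gamma_2(2t-1)$ for $\frac12<t\le1$. With $r(t)=1-t$ one has $\gamma^\ast\circ r=(\gamma\circ r)^\ast$. Canonical extension (operator $\Theta$): given $(Y,\mathcal{L}_Y,f)\in M$, $F=\Theta(Y,\mathcal{L}_Y,f):X\to Y$ is defined as follows. For $A\in\mathcal{L}_X$ choose a parameterization $\gamma$ of $A$, and let $\lambda$ parameterize the corresponding arc in $\mathcal{L}_Y$ with $\lambda(0)=f(\gamma(0))$, $\lambda(1)=f(\gamma(1))$. For $x\in A$ put $F(x)=\lambda^\ast((\gamma^\ast)^{-1}(x))$. This is independent of the choices, and $F$ is a well-defined continuous map $X\to Y$ extending $f$. *)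

theory Defs
  imports "HOL-Analysis.Analysis"
begin

definition parameterizes :: "(real \<Rightarrow> 'a::topological_space) \<Rightarrow> 'a set \<Rightarrow> bool" where
  "parameterizes \<gamma> A \<longleftrightarrow> (\<exists>\<gamma>'. homeomorphism {0..1} A \<gamma> \<gamma>')"

definition arc_ends :: "'a::topological_space set \<Rightarrow> 'a set" where
  "arc_ends A = {p. \<exists>\<gamma>. parameterizes \<gamma> A \<and> (p = \<gamma> 0 \<or> p = \<gamma> 1)}"

definition lam_ends :: "'a::topological_space set set \<Rightarrow> 'a set" where
  "lam_ends L = (\<Union>A\<in>L. arc_ends A)"

definition lamination :: "'a::metric_space set \<Rightarrow> 'a set set \<Rightarrow> bool" where
  "lamination X L \<longleftrightarrow>
     (\<forall>A\<in>L. A homeomorphic {0..1::real}) \<and>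
     X = \<Union>L \<and>
     (\<forall>A\<in>L. \<forall>B\<in>L. A \<noteq> B \<longrightarrow>
        A \<inter> B = {} \<or> (\<exists>p. A \<inter> B = {p} \<and> p \<in> arc_ends A \<and> p \<in> arc_ends B)) \<and>
     (\<forall>A :: nat \<Rightarrow> 'a set. range A \<subseteq> L \<longrightarrow>
        (if (\<lambda>i. diameter (A i)) \<longlonglongrightarrow> 0
         then \<forall>p. (\<forall>U. open U \<and> p \<in> U \<longrightarrow> infinite {i. A i \<inter> U \<noteq> {}}) \<longrightarrow> p \<in> lam_ends L \<or> p \<notin> X
         else \<exists>B\<in>L. \<exists>r :: nat \<Rightarrow> nat. \<exists>h h'. strict_mono r \<and>
                (\<forall>j. homeomorphism B (A (r j)) (h j) (h' j)) \<and>
                (\<lambda>j. SUP p\<in>B. dist (h j p) p) \<longlonglongrightarrow> 0))"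

definition reparam_equiv :: "(real \<Rightarrow> 'a::metric_space) \<Rightarrow> (real \<Rightarrow> 'a) \<Rightarrow> bool" where
  "reparam_equiv \<gamma>1 \<gamma>2 \<longleftrightarrow> path \<gamma>1 \<and> path \<gamma>2 \<and>
     (\<exists>m1 m2 :: real \<Rightarrow> real.
        mono_on {0..1} m1 \<and> m1 ` {0..1} = {0..1} \<and>
        mono_on {0..1} m2 \<and> m2 ` {0..1} = {0..1} \<and>
        (\<forall>s\<in>{0..1}. \<gamma>1 constant_on {t\<in>{0..1}. m1 t = s}) \<and>
        (\<forall>s\<in>{0..1}. \<gamma>2 constant_on {t\<in>{0..1}. m2 t = s}) \<and>
        (\<forall>s\<in>{0..1}. \<gamma>1 ` {t\<in>{0..1}. m1 t = s} = \<gamma>2 ` {t\<in>{0..1}. m2 t = s}))"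

definition reparam_class :: "(real \<Rightarrow> 'a::metric_space) \<Rightarrow> (real \<Rightarrow> 'a) set" where
  "reparam_class \<gamma> = {\<eta>. reparam_equiv \<gamma> \<eta>}"

definition rho :: "(real \<Rightarrow> 'a::metric_space) set \<Rightarrow> (real \<Rightarrow> 'a) set \<Rightarrow> real" where
  "rho P Q = (INF (\<eta>1, \<eta>2) \<in> P \<times> Q. SUP t\<in>{0..1}. dist (\<eta>1 t) (\<eta>2 t))"

definition lam_maps ::
  "'a::metric_space set set \<Rightarrow> ('a set \<times> 'a set set \<times> ('a \<Rightarrow> 'a)) set" where
  "lam_maps LX = {(Y, LY, f). bounded Y \<and> lamination Y LY \<and>
     f \<in> lam_ends LX \<rightarrow> lam_ends LY \<and> continuous_on (lam_ends LX) f \<and>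
     (\<forall>A\<in>LX. \<exists>B\<in>LY. f ` arc_ends A = arc_ends B)}"

definition corresponding_arc :: "'a::topological_space set set \<Rightarrow> ('a \<Rightarrow> 'a) \<Rightarrow> 'a set \<Rightarrow> 'a set" where
  "corresponding_arc LY f A = (THE B. B \<in> LY \<and> f ` arc_ends A = arc_ends B)"

definition corresponding_param ::
  "'a::topological_space set set \<Rightarrow> ('a \<Rightarrow> 'a) \<Rightarrow> 'a set \<Rightarrow> (real \<Rightarrow> 'a) \<Rightarrow> (real \<Rightarrow> 'a) \<Rightarrow> bool" where
  "corresponding_param LY f A \<gamma> \<eta> \<longleftrightarrow>
     parameterizes \<eta> (corresponding_arc LY f A) \<and> \<eta> 0 = f (\<gamma> 0) \<and> \<eta> 1 = f (\<gamma> 1)"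

text \<open>The supremum is taken in the extended nonnegative reals, where the empty supremum
  (for an empty lamination) is 0.  Note that \<open>lam_dist\<close> is only a pseudometric on
  \<open>lam_maps LX\<close>: it ignores the arcs of \<open>LY\<close> that correspond to no arc of \<open>LX\<close>.\<close>

definition lam_dist ::
  "'a::metric_space set set \<Rightarrow> 'a set \<times> 'a set set \<times> ('a \<Rightarrow> 'a) \<Rightarrow>
     'a set \<times> 'a set set \<times> ('a \<Rightarrow> 'a) \<Rightarrow> ennreal" where
  "lam_dist LX = (\<lambda>(Y1, L1, f1) (Y2, L2, f2).
     Sup {ennreal (rho (reparam_class \<eta>1) (reparam_class \<eta>2)) | \<eta>1 \<eta>2.
        \<exists>A\<in>LX. \<exists>\<gamma>. parameterizes \<gamma> A \<and>
          corresponding_param L1 f1 A \<gamma> \<eta>1 \<and> corresponding_param L2 f2 A \<gamma> \<eta>2})"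

text \<open>The normalized cone measure, as a Borel measure on the whole space.  It is the
  rotation-invariant probability measure on the unit sphere, see the lemmas below.\<close>

definition sphere_prob :: "'a::euclidean_space measure" where
  "sphere_prob = distr (uniform_measure lborel (ball 0 1)) borel sgn"

lemma space_sphere_prob [simp]: "space sphere_prob = UNIV"
  and sets_sphere_prob [simp, measurable_cong]: "sets sphere_prob = sets borel"
  by (simp_all add: sphere_prob_def)

lemma emeasure_unit_ball_bounds:
  "0 < emeasure lborel (ball (0::'a::euclidean_space) 1)"
  "emeasure lborel (ball (0::'a::euclidean_space) 1) < \<infinity>"
proof -
  have "emeasure lborel (ball (0::'a) 1) \<noteq> 0"
    using open_not_negligible[of "ball (0::'a) 1"]
    by (auto simp: negligible_iff_null_sets null_sets_def)
  then show "0 < emeasure lborel (ball (0::'a) 1)"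
    using not_gr_zero by blast
  show "emeasure lborel (ball (0::'a) 1) < \<infinity>"
    using emeasure_lborel_ball_finite[of "0::'a" 1] by simp
qed

lemma emeasure_sphere_prob_sphere: "emeasure sphere_prob (sphere (0::'a::euclidean_space) 1) = 1"
proof -
  let ?b = "ball (0::'a) 1"
  have v: "sgn -` sphere 0 1 = - {0::'a}"
    by (auto simp: norm_sgn split: if_splits)
  have "emeasure sphere_prob (sphere (0::'a) 1) =
      emeasure (uniform_measure lborel ?b) (- {0})"
    unfolding sphere_prob_def by (subst emeasure_distr) (auto simp: v)
  also have "\<dots> = emeasure lborel (?b - {0}) / emeasure lborel ?b"
    by (subst emeasure_uniform_measure) (auto simp: Diff_eq)
  also have "emeasure lborel (?b - {0}) = emeasure lborel ?b"
    by (rule emeasure_Diff_null_set) auto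
  finally show ?thesis
    using emeasure_unit_ball_bounds[where 'a='a] by (simp add: ennreal_divide_self)
qed

lemma emeasure_sphere_prob_UNIV: "emeasure sphere_prob (UNIV :: 'a::euclidean_space set) = 1"
proof -
  have "emeasure sphere_prob (UNIV :: 'a set) = emeasure (uniform_measure lborel (ball (0::'a) 1)) UNIV"
    unfolding sphere_prob_def by (subst emeasure_distr) auto
  also have "\<dots> = 1"
    using emeasure_unit_ball_bounds[where 'a='a]
    by (subst emeasure_uniform_measure) (auto simp: ennreal_divide_self)
  finally show ?thesis .
qed

lemma nn_integral_lborel_translate:
  fixes c :: "'a::euclidean_space"
  assumes [measurable]: "g \<in> borel_measurable borel"
  shows "(\<integral>\<^sup>+x. g (c + x) \<partial>lborel) = (\<integral>\<^sup>+x. g x \<partial>lborel)"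
proof -
  have "(\<integral>\<^sup>+x. g x \<partial>lborel) = (\<integral>\<^sup>+x. g x \<partial>distr lborel borel ((+) c))"
    by (simp add: lborel_distr_plus)
  also have "\<dots> = (\<integral>\<^sup>+x. g (c + x) \<partial>lborel)"
    by (subst nn_integral_distr) auto
  finally show ?thesis ..
qed

lemma nn_integral_lborel_reflect:
  fixes c :: "'a::euclidean_space"
  assumes [measurable]: "g \<in> borel_measurable borel"
  shows "(\<integral>\<^sup>+x. g (c - x) \<partial>lborel) = (\<integral>\<^sup>+x. g x \<partial>lborel)"
proof -
  have eq: "distr lborel borel uminus = (lborel :: 'a measure)"
    using lborel_affine_euclidean[of "\<lambda>_. - 1" "0::'a"]
    by (simp add: euclidean_representation sum_negf density_1)
  have "(\<integral>\<^sup>+x. g (c - x) \<partial>lborel) = (\<integral>\<^sup>+x. g (c + x) \<partial>distr lborel borel uminus)"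
    by (subst nn_integral_distr) auto
  also have "\<dots> = (\<integral>\<^sup>+x. g x \<partial>lborel)"
    by (simp add: eq nn_integral_lborel_translate)
  finally show ?thesis .
qed

lemma emeasure_lborel_orthogonal_vimage:
  fixes T :: "'a::euclidean_space \<Rightarrow> 'a"
  assumes T: "orthogonal_transformation T" and A[measurable]: "A \<in> sets borel"
  shows "emeasure lborel (T -` A) = emeasure lborel A"
proof -
  define B where "B = ball (0::'a) 1"
  have [measurable]: "B \<in> sets borel" by (simp add: B_def)
  have lin: "linear T" using T by (simp add: orthogonal_transformation_linear)
  have [measurable]: "T \<in> borel_measurable borel"
    using lin by (intro borel_measurable_continuous_onI linear_continuous_on linear_conv_bounded_linear[THEN iffD1])
  let ?I = "\<lambda>S x. indicator S x :: ennreal"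
  have vB: "T -` B = B"
    using T by (auto simp: B_def orthogonal_transformation_norm)
  have vi: "emeasure lborel (T -` S) = (\<integral>\<^sup>+x. ?I S (T x) \<partial>lborel)" if [measurable]: "S \<in> sets borel" for S
  proof -
    have [measurable]: "T -` S \<in> sets borel"
      using measurable_sets_borel[of T borel S] by simp
    have "?I S (T x) = ?I (T -` S) x" for x by (simp add: indicator_def)
    then show ?thesis by simp
  qed
  have "emeasure lborel (T -` A) * emeasure lborel B
      = (\<integral>\<^sup>+x. ?I A (T x) * emeasure lborel B \<partial>lborel)"
    by (simp add: vi nn_integral_multc)
  also have "\<dots> = (\<integral>\<^sup>+x. (\<integral>\<^sup>+y. ?I A (T x) * ?I B (T x + y) \<partial>lborel) \<partial>lborel)"
    by (rule nn_integral_cong, subst nn_integral_cmult, measurable)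
      (subst nn_integral_lborel_translate[where g="?I B"], simp_all)
  also have "\<dots> = (\<integral>\<^sup>+y. (\<integral>\<^sup>+x. ?I A (T x) * ?I B (T x + y) \<partial>lborel) \<partial>lborel)"
    by (rule lborel_pair.Fubini') measurable
  also have "\<dots> = (\<integral>\<^sup>+y. (\<integral>\<^sup>+x. ?I A (T x - y) * ?I B (T x) \<partial>lborel) \<partial>lborel)"
  proof (rule nn_integral_cong)
    fix y :: 'a
    obtain z where z: "T z = y" using orthogonal_transformation_surj[OF T] by (metis surjD)
    have "(\<integral>\<^sup>+x. ?I A (T x) * ?I B (T x + y) \<partial>lborel)
        = (\<integral>\<^sup>+x. ?I A (T (- z + x)) * ?I B (T (- z + x) + y) \<partial>lborel)"
      by (rule nn_integral_lborel_translate[symmetric,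
            where g="\<lambda>x. ?I A (T x) * ?I B (T x + y)" and c="- z"]) measurable
    also have "\<dots> = (\<integral>\<^sup>+x. ?I A (T x - y) * ?I B (T x) \<partial>lborel)"
      using lin z by (simp add: linear_diff)
    finally show "(\<integral>\<^sup>+x. ?I A (T x) * ?I B (T x + y) \<partial>lborel)
        = (\<integral>\<^sup>+x. ?I A (T x - y) * ?I B (T x) \<partial>lborel)" .
  qed
  also have "\<dots> = (\<integral>\<^sup>+x. (\<integral>\<^sup>+y. ?I A (T x - y) * ?I B (T x) \<partial>lborel) \<partial>lborel)"
    by (rule lborel_pair.Fubini'[symmetric]) measurable
  also have "\<dots> = (\<integral>\<^sup>+x. emeasure lborel A * ?I B (T x) \<partial>lborel)"
    by (rule nn_integral_cong, subst nn_integral_multc, measurable)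
      (subst nn_integral_lborel_reflect[where g="?I A"], simp_all)
  also have "\<dots> = emeasure lborel A * emeasure lborel B"
    using vi[of B] by (subst nn_integral_cmult) (simp_all add: vB)
  finally have "emeasure lborel (T -` A) * emeasure lborel B = emeasure lborel A * emeasure lborel B" .
  then show ?thesis
    using emeasure_unit_ball_bounds[where 'a='a] unfolding B_def[symmetric]
    by (metis ennreal_mult_divide_eq infinity_ennreal_def less_numeral_extra(3) top.not_eq_extremum)
qed

lemma sphere_prob_rotation_invariant:
  fixes T :: "'a::euclidean_space \<Rightarrow> 'a"
  assumes T: "orthogonal_transformation T"
  shows "distr sphere_prob borel T = sphere_prob"
proof (rule measure_eqI)
  show "sets (distr sphere_prob borel T) = sets sphere_prob" by simp
next
  fix A assume "A \<in> sets (distr sphere_prob borel T)"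
  then have A[measurable]: "A \<in> sets borel" by simp
  let ?b = "ball (0::'a) 1"
  have lin: "linear T" using T by (simp add: orthogonal_transformation_linear)
  have Tm[measurable]: "T \<in> borel_measurable borel"
    using lin by (intro borel_measurable_continuous_onI linear_continuous_on linear_conv_bounded_linear[THEN iffD1])
  have TA[measurable]: "T -` A \<in> sets borel"
    using measurable_sets_borel[OF Tm A] by simp
  have sg: "sgn -` S \<in> sets borel" if "S \<in> sets borel" for S :: "'a set"
    using measurable_sets_borel[OF borel_measurable_sgn that] by simp
  have sT: "sgn (T x) = T (sgn x)" for x
    using T lin by (simp add: sgn_div_norm orthogonal_transformation_norm linear_cmul)
  have e: "emeasure sphere_prob S = emeasure lborel (?b \<inter> sgn -` S) / emeasure lborel ?b"
    if S: "S \<in> sets borel" for S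
    unfolding sphere_prob_def using S sg[OF S] by (subst emeasure_distr) auto
  have "emeasure (distr sphere_prob borel T) A = emeasure sphere_prob (T -` A)"
    by (subst emeasure_distr) auto
  also have "\<dots> = emeasure lborel (?b \<inter> sgn -` (T -` A)) / emeasure lborel ?b"
    by (rule e[OF TA])
  also have "?b \<inter> sgn -` (T -` A) = T -` (?b \<inter> sgn -` A)"
    using T by (auto simp: sT orthogonal_transformation_norm)
  also have "emeasure lborel \<dots> = emeasure lborel (?b \<inter> sgn -` A)"
    using sg[OF A] by (intro emeasure_lborel_orthogonal_vimage T) auto
  also have "\<dots> / emeasure lborel ?b = emeasure sphere_prob A"
    by (rule e[OF A, symmetric])
  finally show "emeasure (distr sphere_prob borel T) A = emeasure sphere_prob A" .
qed

definition slab :: "real \<Rightarrow> 'a::euclidean_space \<Rightarrow> real \<Rightarrow> int \<Rightarrow> 'a set" where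
  "slab x u \<mu> j = {z. \<mu> * (of_int j + x) \<le> z \<bullet> u \<and> z \<bullet> u \<le> \<mu> * (of_int j + 1 + x)}"

definition width :: "'a::euclidean_space \<Rightarrow> 'a set \<Rightarrow> real" where
  "width u A = diameter ((\<lambda>z. z \<bullet> u) ` A)"

text \<open>A component of positive width belongs to exactly one slab (distinct slabs meet in at most a
  hyperplane orthogonal to \<open>u\<close>), so collecting the components into a set loses no multiplicity.\<close>

definition slab_components ::
  "real \<Rightarrow> real \<Rightarrow> (real \<Rightarrow> 'a::euclidean_space) \<Rightarrow> real \<Rightarrow> 'a \<Rightarrow> real \<Rightarrow> real set set" where
  "slab_components a b \<gamma> x u \<mu> =
     {C. (\<exists>j. C \<in> components {t\<in>{a..b}. \<gamma> t \<in> slab x u \<mu> j}) \<and> 0 < width u (\<gamma> ` C)}"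

definition decreasing_enum :: "('b \<Rightarrow> real) \<Rightarrow> 'b set \<Rightarrow> enat \<Rightarrow> (nat \<Rightarrow> 'b) \<Rightarrow> bool" where
  "decreasing_enum w D N c \<longleftrightarrow> bij_betw c {k. enat k < N} D \<and>
     (\<forall>k. enat (Suc k) < N \<longrightarrow> w (c (Suc k)) \<le> w (c k))"

text \<open>The value of the sum does not depend on how ties in the enumeration are broken.\<close>

definition slab_sum ::
  "real \<Rightarrow> real \<Rightarrow> (real \<Rightarrow> 'a::euclidean_space) \<Rightarrow> real \<Rightarrow> 'a \<Rightarrow> real \<Rightarrow> real" where
  "slab_sum a b \<gamma> x u \<mu> = (THE l. \<exists>N c.
     decreasing_enum (\<lambda>C. width u (\<gamma> ` C)) (slab_components a b \<gamma> x u \<mu>) N c \<and>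
     l = (\<Sum>k. if enat k < N then (1/2) ^ k * width u (\<gamma> ` c k) else 0))"

text \<open>\<open>len a b \<gamma>\<close> is the value of len at the restriction of \<open>\<gamma>\<close> to \<open>{a..b}\<close>.\<close>

definition len :: "real \<Rightarrow> real \<Rightarrow> (real \<Rightarrow> 'a::euclidean_space) \<Rightarrow> real" where
  "len a b \<gamma> = (LBINT \<mu>:{0<..1}. LINT u:sphere 0 1|sphere_prob. LBINT x:{0..1}.
     slab_sum a b \<gamma> x u \<mu>)"

definition std_param :: "(real \<Rightarrow> 'a::euclidean_space) \<Rightarrow> real \<Rightarrow> 'a" where
  "std_param \<gamma> = (if \<gamma> constant_on {0..1} then \<gamma>
     else (\<lambda>s. \<gamma> (SOME t. t \<in> {0..1} \<and> len 0 t \<gamma> = s * len 0 1 \<gamma>)))"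

definition len_midpoint :: "(real \<Rightarrow> 'a::euclidean_space) \<Rightarrow> real" where
  "len_midpoint \<gamma> = (SOME m. m \<in> {0<..<1} \<and> len 0 m \<gamma> = len m 1 \<gamma>)"

definition mid_param :: "(real \<Rightarrow> 'a::euclidean_space) \<Rightarrow> real \<Rightarrow> 'a" where
  "mid_param \<gamma> = (let m = len_midpoint \<gamma>;
       \<gamma>1 = (\<lambda>t. \<gamma> (m - m * t));
       \<gamma>2 = (\<lambda>t. \<gamma> (m + (1 - m) * t))
     in (\<lambda>t. if t \<le> 1/2 then std_param \<gamma>1 (1 - 2 * t) else std_param \<gamma>2 (2 * t - 1)))"

text \<open>The value at \<open>x\<close> does not depend on the choice of the arc through \<open>x\<close> and of the
  parameterizations.\<close>

definition canonical_extension ::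
  "'a::euclidean_space set \<Rightarrow> 'a set set \<Rightarrow> 'a set \<times> 'a set set \<times> ('a \<Rightarrow> 'a) \<Rightarrow> 'a \<Rightarrow> 'a" where
  "canonical_extension X LX = (\<lambda>(Y, LY, f). \<lambda>x\<in>X.
     SOME y. \<exists>A\<in>LX. \<exists>\<gamma> \<eta>. x \<in> A \<and> parameterizes \<gamma> A \<and> corresponding_param LY f A \<gamma> \<eta> \<and>
       y = mid_param \<eta> (inv_into {0..1} (mid_param \<gamma>) x))"

end

theory Submission
  imports Defs
begin

text \<open>
  The proof needs that \<open>len\<close> is continuous, strictly monotone along an arc and invariant under
  reparameterization.  Rescaling a slab of width \<open>\<mu>\<close> to the unit interval
  \<open>[j, j + 1]\<close> turns the weighted sum of component widths into \<open>\<mu>\<close> times a functional of the real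
  function \<open>h t = (\<gamma> t \<bullet> u) / \<mu> - x\<close>.  By the rearrangement inequality this functional is a supremum over
  finite families of separated intervals.  With open slabs it is lower semicontinuous under uniform
  convergence, with closed slabs it is upper semicontinuous, and the two versions agree when no integer is
  a local extreme value of \<open>h\<close>, which excludes only countably many \<open>x\<close>.  Dominated convergence then
  makes \<open>len\<close> continuous in the path and in the end points of its domain, and a crossing of a whole slab
  makes it strictly monotone.

  Hence the midpoint parameter is characterized by a closed equation with a unique solution, and
  compactness gives: if arcs \<open>\<gamma>\<^sub>n\<close> converge uniformly to an arc \<open>\<gamma>\<close> and \<open>s\<^sub>n \<longlonglongrightarrow> s\<close>, then
  the midpoint parameterizations satisfy \<open>\<gamma>\<^sub>n\<^sup>* s\<^sub>n \<longlonglongrightarrow> \<gamma>\<^sup>* s\<close>.  Continuity of the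
  extension and of the operator follow by passing to subsequences: in a lamination a sequence of arcs either has
  diameters tending to 0, and everything is controlled by the end points, or it subconverges to an arc of the lamination.
\<close>

text \<open>Components of closed slabs are unstable: where a path touches a bounding hyperplane
  without crossing it, an arbitrarily small perturbation can split a component in two and shift all
  later weights. A supremum over all placements removes the ordering, and the remaining instability
  sits at integer local extrema, which the integral over \<open>x\<close> ignores.

  The weights (1/2)^k have sum 2 and every rescaled width is at most 1. If a path of value L goes on
  to cross a new full slab, its value becomes at least 1 + L/2, and 1 + L/2 > L means L < 2, which
  uniform continuity gives. Strictness makes the midpoint and the parameter \<open>v\<close> unique,
  so that limits of subsequences can be identified.

  Continuity of the operator is uniform over a set \<open>X\<close> that need not be compact, so
  points witnessing a failure need not converge. Compactness comes instead from the lamination of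
  \<open>Y\<close> in the fixed triple, whose arcs also control those of nearby triples. As
  \<open>rho\<close> compares paths only up to monotone maps, closeness must first become uniform
  closeness after a homeomorphism of {0..1}.\<close>

section \<open>Weighted sums over separated intervals\<close>

text \<open>The index set \<open>K\<close> may have gaps, so that intervals can be discarded without renumbering; a gap only
  decreases the weighted sum.  Strict inclusion in the open slab and separation by a point outside the closed
  slab are stable under small uniform perturbations of \<open>h\<close>; the weak version below is closed under limits.\<close>

definition separated_system ::
  "real \<Rightarrow> real \<Rightarrow> (real \<Rightarrow> real) \<Rightarrow> nat set \<Rightarrow> (nat \<Rightarrow> real) \<Rightarrow> (nat \<Rightarrow> real) \<Rightarrow> (nat \<Rightarrow> int) \<Rightarrow> bool" where
  "separated_system a b h K s t j \<longleftrightarrow> finite K \<and>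
     (\<forall>k\<in>K. a \<le> s k \<and> s k \<le> t k \<and> t k \<le> b \<and> (\<forall>r\<in>{s k..t k}. of_int (j k) < h r \<and> h r < of_int (j k) + 1)) \<and>
     (\<forall>k\<in>K. \<forall>l\<in>K. k \<noteq> l \<longrightarrow> j k = j l \<longrightarrow>
        (\<exists>r. h r \<notin> {of_int (j k)..of_int (j k) + 1} \<and> (t k \<le> r \<and> r \<le> s l \<or> t l \<le> r \<and> r \<le> s k)))"

definition weakly_separated_system ::
  "real \<Rightarrow> real \<Rightarrow> (real \<Rightarrow> real) \<Rightarrow> nat set \<Rightarrow> (nat \<Rightarrow> real) \<Rightarrow> (nat \<Rightarrow> real) \<Rightarrow> (nat \<Rightarrow> int) \<Rightarrow> bool" where
  "weakly_separated_system a b h K s t j \<longleftrightarrow> finite K \<and>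
     (\<forall>k\<in>K. a \<le> s k \<and> s k \<le> t k \<and> t k \<le> b \<and> (\<forall>r\<in>{s k..t k}. of_int (j k) \<le> h r \<and> h r \<le> of_int (j k) + 1)) \<and>
     (\<forall>k\<in>K. \<forall>l\<in>K. k \<noteq> l \<longrightarrow> j k = j l \<longrightarrow>
        (\<exists>r. h r \<notin> {of_int (j k)<..<of_int (j k) + 1} \<and> (t k \<le> r \<and> r \<le> s l \<or> t l \<le> r \<and> r \<le> s k)))"

definition system_sum :: "(real \<Rightarrow> real) \<Rightarrow> nat set \<Rightarrow> (nat \<Rightarrow> real) \<Rightarrow> (nat \<Rightarrow> real) \<Rightarrow> real" where
  "system_sum h K s t = (\<Sum>k\<in>K. (1/2)^k * \<bar>h (t k) - h (s k)\<bar>)"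

definition unit_len :: "real \<Rightarrow> real \<Rightarrow> (real \<Rightarrow> real) \<Rightarrow> real" where
  "unit_len a b h = Sup {system_sum h K s t | K s t. \<exists>j. separated_system a b h K s t j}"

lemma sum_half_power_le:
  assumes "finite K" shows "(\<Sum>k\<in>K. (1/2::real)^k) \<le> 2"
proof -
  have "(\<Sum>k\<in>K. (1/2::real)^k) \<le> (\<Sum>k. (1/2)^k)"
    using assms by (intro sum_le_suminf summable_geometric) auto
  also have "\<dots> = 2" by (simp add: suminf_geometric)
  finally show ?thesis .
qed

lemma separated_imp_weakly_separated:
  assumes "separated_system a b h K s t j" shows "weakly_separated_system a b h K s t j"
  unfolding weakly_separated_system_def
proof (intro conjI ballI impI)
  show "finite K" using assms by (simp add: separated_system_def)
  fix k assume k: "k \<in> K"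
  show "a \<le> s k" "s k \<le> t k" "t k \<le> b" using assms k by (auto simp: separated_system_def)
  show "of_int (j k) \<le> h r" "h r \<le> of_int (j k) + 1" if "r \<in> {s k..t k}" for r
    using assms k that unfolding separated_system_def by (metis less_imp_le)+
  show "\<exists>r. h r \<notin> {of_int (j k)<..<of_int (j k) + 1} \<and> (t k \<le> r \<and> r \<le> s l \<or> t l \<le> r \<and> r \<le> s k)"
    if l: "l \<in> K" "k \<noteq> l" "j k = j l" for l
  proof -
    obtain r where "h r \<notin> {of_int (j k)..of_int (j k) + 1}" "t k \<le> r \<and> r \<le> s l \<or> t l \<le> r \<and> r \<le> s k"
      using assms k l unfolding separated_system_def by blast
    then show ?thesis by (intro exI[of _ r]) auto
  qed
qed

lemma weakly_separated_width:
  assumes "weakly_separated_system a b h K s t j" "k \<in> K"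
  shows "\<bar>h (t k) - h (s k)\<bar> \<le> 1"
proof -
  have s: "s k \<le> t k" and h: "\<forall>r\<in>{s k..t k}. of_int (j k) \<le> h r \<and> h r \<le> of_int (j k) + 1"
    using assms by (auto simp: weakly_separated_system_def)
  have "of_int (j k) \<le> h (s k) \<and> h (s k) \<le> of_int (j k) + 1" "of_int (j k) \<le> h (t k) \<and> h (t k) \<le> of_int (j k) + 1"
    using h s by auto
  then show ?thesis by linarith
qed

lemma weakly_separated_sum_le:
  assumes "weakly_separated_system a b h K s t j"
  shows "system_sum h K s t \<le> 2"
proof -
  have "system_sum h K s t \<le> (\<Sum>k\<in>K. (1/2::real)^k)"
    unfolding system_sum_def
    using weakly_separated_width[OF assms] by (intro sum_mono mult_left_le) auto
  also have "\<dots> \<le> 2"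
    using assms by (intro sum_half_power_le) (auto simp: weakly_separated_system_def)
  finally show ?thesis .
qed

lemma unit_len_bdd: "bdd_above {system_sum h K s t | K s t. \<exists>j. separated_system a b h K s t j}"
  by (rule bdd_aboveI[of _ 2]) (use separated_imp_weakly_separated weakly_separated_sum_le in blast)

lemma separated_system_empty: "separated_system a b h {} s t j"
  by (simp add: separated_system_def)

lemma unit_len_ne: "{system_sum h K s t | K s t. \<exists>j. separated_system a b h K s t j} \<noteq> {}"
  using separated_system_empty by blast

lemma unit_len_upper:
  assumes "separated_system a b h K s t j" shows "system_sum h K s t \<le> unit_len a b h"
  unfolding unit_len_def by (rule cSup_upper[OF _ unit_len_bdd]) (use assms in blast)

lemma unit_len_least:
  assumes "\<And>K s t j. separated_system a b h K s t j \<Longrightarrow> system_sum h K s t \<le> c"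
  shows "unit_len a b h \<le> c"
  unfolding unit_len_def by (rule cSup_least[OF unit_len_ne]) (use assms in blast)

lemma unit_len_nonneg: "0 \<le> unit_len a b h"
  using unit_len_upper[OF separated_system_empty] by (auto simp: system_sum_def)

lemma unit_len_le_2: "unit_len a b h \<le> 2"
  using unit_len_least separated_imp_weakly_separated weakly_separated_sum_le by blast

lemma less_unit_len_ex:
  assumes "c < unit_len a b h"
  obtains K s t j where "separated_system a b h K s t j" "c < system_sum h K s t"
  using unit_len_least[of a b h c] assms by (meson not_le)

lemma separated_system_subset:
  assumes "separated_system a b h K s t j" "K' \<subseteq> K"
  shows "separated_system a b h K' s t j"
  using assms unfolding separated_system_def
  by (meson finite_subset subsetD)

text \<open>All conditions of a system are strict and concern finitely many compact intervals and
  single points, so they leave a common margin. Stating this with \<open>at_right 0\<close> lets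
  finitely many margins be intersected.\<close>

lemma separated_system_stable:
  assumes S: "separated_system a b h K s t j" and h: "continuous_on {a..b} h"
  shows "\<forall>\<^sub>F \<delta> in at_right 0. \<forall>h'. (\<forall>r\<in>{a..b}. \<bar>h' r - h r\<bar> < \<delta>) \<longrightarrow> separated_system a b h' K s t j"
proof -
  have fin: "finite K" using S by (simp add: separated_system_def)
  have 1: "\<forall>\<^sub>F \<delta> in at_right 0. \<forall>r\<in>{s k..t k}. of_int (j k) + \<delta> \<le> h r \<and> h r \<le> of_int (j k) + 1 - \<delta>"
    if k: "k \<in> K" for k
  proof -
    have st: "a \<le> s k" "s k \<le> t k" "t k \<le> b"
      and hr: "\<And>r. r \<in> {s k..t k} \<Longrightarrow> of_int (j k) < h r \<and> h r < of_int (j k) + 1"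
      using S k by (auto simp: separated_system_def)
    have c: "continuous_on {s k..t k} h" by (rule continuous_on_subset[OF h]) (use st in auto)
    obtain p where p: "p \<in> {s k..t k}" "\<And>r. r \<in> {s k..t k} \<Longrightarrow> h p \<le> h r"
      using continuous_attains_inf[OF compact_Icc _ c] st by auto
    obtain q where q: "q \<in> {s k..t k}" "\<And>r. r \<in> {s k..t k} \<Longrightarrow> h r \<le> h q"
      using continuous_attains_sup[OF compact_Icc _ c] st by auto
    define e where "e = min (h p - of_int (j k)) (of_int (j k) + 1 - h q)"
    have "e > 0" using hr[OF p(1)] hr[OF q(1)] by (auto simp: e_def)
    then have "\<forall>\<^sub>F \<delta> in at_right 0. \<delta> < e" by (rule order_tendstoD(2)[OF tendsto_ident_at])
    then show ?thesis
    proof eventually_elim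
      case (elim \<delta>)
      show ?case
      proof
        fix r assume "r \<in> {s k..t k}"
        then show "of_int (j k) + \<delta> \<le> h r \<and> h r \<le> of_int (j k) + 1 - \<delta>"
          using p(2)[of r] q(2)[of r] elim unfolding e_def min_def by (auto split: if_splits)
      qed
    qed
  qed
  have 2: "\<forall>\<^sub>F \<delta> in at_right 0. k \<noteq> l \<longrightarrow> j k = j l \<longrightarrow>
        (\<exists>r. (h r < of_int (j k) - \<delta> \<or> h r > of_int (j k) + 1 + \<delta>) \<and> (t k \<le> r \<and> r \<le> s l \<or> t l \<le> r \<and> r \<le> s k))"
    if k: "k \<in> K" and l: "l \<in> K" for k l
  proof (cases "k \<noteq> l \<and> j k = j l")
    case True
    then obtain r where r: "h r \<notin> {of_int (j k)..of_int (j k) + 1}" "t k \<le> r \<and> r \<le> s l \<or> t l \<le> r \<and> r \<le> s k"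
      using S k l unfolding separated_system_def by blast
    define e where "e = max (of_int (j k) - h r) (h r - of_int (j k) - 1)"
    have "e > 0" using r by (auto simp: e_def)
    then have "\<forall>\<^sub>F \<delta> in at_right 0. \<delta> < e"
      by (rule order_tendstoD(2)[OF tendsto_ident_at])
    then show ?thesis
    proof eventually_elim
      case (elim \<delta>)
      then have "h r < of_int (j k) - \<delta> \<or> h r > of_int (j k) + 1 + \<delta>"
        unfolding e_def by (auto simp: max_def split: if_splits)
      then show ?case using r(2) by blast
    qed
  qed auto
  have ev1: "\<forall>\<^sub>F \<delta> in at_right 0. \<forall>k\<in>K. \<forall>r\<in>{s k..t k}. of_int (j k) + \<delta> \<le> h r \<and> h r \<le> of_int (j k) + 1 - \<delta>"
    using 1 fin by (simp add: eventually_ball_finite)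
  have ev2: "\<forall>\<^sub>F \<delta> in at_right 0. \<forall>k\<in>K. \<forall>l\<in>K. k \<noteq> l \<longrightarrow> j k = j l \<longrightarrow>
        (\<exists>r. (h r < of_int (j k) - \<delta> \<or> h r > of_int (j k) + 1 + \<delta>) \<and> (t k \<le> r \<and> r \<le> s l \<or> t l \<le> r \<and> r \<le> s k))"
    using 2 fin by (intro eventually_ball_finite ballI) auto
  from ev1 ev2 show ?thesis
  proof eventually_elim
    case (elim \<delta>)
    show ?case
    proof (intro allI impI)
      fix h' :: "real \<Rightarrow> real" assume h': "\<forall>r\<in>{a..b}. \<bar>h' r - h r\<bar> < \<delta>"
      show "separated_system a b h' K s t j"
        unfolding separated_system_def
      proof (intro conjI ballI impI)
        show "finite K" by fact
        fix k assume k: "k \<in> K"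
        show st: "a \<le> s k" "s k \<le> t k" "t k \<le> b" using S k by (auto simp: separated_system_def)
        show "of_int (j k) < h' r" "h' r < of_int (j k) + 1" if r: "r \<in> {s k..t k}" for r
        proof -
          have "r \<in> {a..b}" using r st by auto
          then have "\<bar>h' r - h r\<bar> < \<delta>" using h' by auto
          moreover have "of_int (j k) + \<delta> \<le> h r \<and> h r \<le> of_int (j k) + 1 - \<delta>" using elim(1) k r by blast
          ultimately show "of_int (j k) < h' r" "h' r < of_int (j k) + 1" by linarith+
        qed
        show "\<exists>r. h' r \<notin> {of_int (j k)..of_int (j k) + 1} \<and> (t k \<le> r \<and> r \<le> s l \<or> t l \<le> r \<and> r \<le> s k)"
          if l: "l \<in> K" "k \<noteq> l" "j k = j l" for l
        proof -
          obtain r where r: "h r < of_int (j k) - \<delta> \<or> h r > of_int (j k) + 1 + \<delta>"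
            "t k \<le> r \<and> r \<le> s l \<or> t l \<le> r \<and> r \<le> s k"
            using elim(2) k l by blast
          have stl: "a \<le> s l" "s l \<le> t l" "t l \<le> b" using S l by (auto simp: separated_system_def)
          \<comment> \<open>The separating point lies between interval ends, hence in {a..b}, the
            only place where \<open>h'\<close> is known to be near \<open>h\<close>.\<close>
          have "r \<in> {a..b}" using r(2) st stl by auto
          then have "\<bar>h' r - h r\<bar> < \<delta>" using h' by auto
          then have "h' r \<notin> {of_int (j k)..of_int (j k) + 1}" using r(1) by auto
          then show ?thesis using r(2) by blast
        qed
      qed
    qed
  qed
qed

text \<open>The constant 4 is the total weight 2 times the change of at most 2\<delta> in a single
  width.\<close>

lemma system_sum_perturb:
  assumes "\<And>k. k \<in> K \<Longrightarrow> \<bar>h' (s' k) - h (s k)\<bar> \<le> \<delta>" "\<And>k. k \<in> K \<Longrightarrow> \<bar>h' (t' k) - h (t k)\<bar> \<le> \<delta>"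
    "finite K" "0 \<le> \<delta>"
  shows "\<bar>system_sum h' K s' t' - system_sum h K s t\<bar> \<le> 4 * \<delta>"
proof -
  have "\<bar>system_sum h' K s' t' - system_sum h K s t\<bar>
      = \<bar>\<Sum>k\<in>K. (1/2)^k * (\<bar>h' (t' k) - h' (s' k)\<bar> - \<bar>h (t k) - h (s k)\<bar>)\<bar>"
    by (simp add: system_sum_def sum_subtractf[symmetric] right_diff_distrib)
  also have "\<dots> \<le> (\<Sum>k\<in>K. (1/2)^k * (2 * \<delta>))"
  proof (intro order_trans[OF sum_abs] sum_mono)
    fix k assume "k \<in> K"
    then have "\<bar>\<bar>h' (t' k) - h' (s' k)\<bar> - \<bar>h (t k) - h (s k)\<bar>\<bar> \<le> 2 * \<delta>"
      using assms(1)[of k] assms(2)[of k] by linarith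
    then show "\<bar>(1/2)^k * (\<bar>h' (t' k) - h' (s' k)\<bar> - \<bar>h (t k) - h (s k)\<bar>)\<bar> \<le> (1/2)^k * (2 * \<delta>)"
      by (simp add: abs_mult mult_left_mono)
  qed
  also have "\<dots> = (\<Sum>k\<in>K. (1/2::real)^k) * (2 * \<delta>)" by (simp only: sum_distrib_right)
  also have "\<dots> \<le> 2 * (2 * \<delta>)"
    using sum_half_power_le[OF assms(3)] assms(4) by (intro mult_right_mono) auto
  finally show ?thesis by simp
qed

lemma unit_len_lower_semicontinuous:
  assumes c: "c < unit_len a b h" and h: "continuous_on {a..b} h"
  obtains \<delta> where "\<delta> > 0" "\<And>h'. (\<And>r. r \<in> {a..b} \<Longrightarrow> \<bar>h' r - h r\<bar> < \<delta>) \<Longrightarrow> c < unit_len a b h'"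
proof -
  obtain K s t j where S: "separated_system a b h K s t j" "c < system_sum h K s t"
    using less_unit_len_ex[OF c] .
  have fin: "finite K" and st: "\<And>k. k \<in> K \<Longrightarrow> s k \<in> {a..b} \<and> t k \<in> {a..b}"
    using S by (auto simp: separated_system_def)
  \<comment> \<open>The factor 1/4 pays for the constant in
    \<open>system_sum_perturb\<close>.\<close>
  have e: "\<forall>\<^sub>F \<delta> in at_right 0. \<delta> < (system_sum h K s t - c) / 4"
    using S(2) by (intro order_tendstoD(2)[OF tendsto_ident_at]) simp
  have "\<forall>\<^sub>F \<delta> in at_right 0. (0::real) < \<delta>" by (rule eventually_at_right_less)
  with e have "\<forall>\<^sub>F \<delta> in at_right 0. 0 < \<delta> \<and> (\<forall>h'. (\<forall>r\<in>{a..b}. \<bar>h' r - h r\<bar> < \<delta>) \<longrightarrow> c < unit_len a b h')"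
    using separated_system_stable[OF S(1) h]
  proof eventually_elim
    case (elim \<delta>)
    show ?case
    proof (intro conjI allI impI)
      fix h' :: "real \<Rightarrow> real" assume h': "\<forall>r\<in>{a..b}. \<bar>h' r - h r\<bar> < \<delta>"
      then have S': "separated_system a b h' K s t j" using elim by blast
      have "\<bar>system_sum h' K s t - system_sum h K s t\<bar> \<le> 4 * \<delta>"
        using h' st fin elim by (intro system_sum_perturb) (auto simp: less_imp_le)
      moreover have "4 * \<delta> < system_sum h K s t - c" using elim(1) by simp
      ultimately have "c < system_sum h' K s t" by linarith
      then show "c < unit_len a b h'" using unit_len_upper[OF S'] by linarith
    qed (use elim in auto)
  qed
  then obtain \<delta> where "0 < \<delta>" "\<forall>h'. (\<forall>r\<in>{a..b}. \<bar>h' r - h r\<bar> < \<delta>) \<longrightarrow> c < unit_len a b h'"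
    using eventually_happens'[OF trivial_limit_at_right_real] by blast
  then show ?thesis using that by blast
qed

lemma unit_len_cong:
  assumes "\<And>r. r \<in> {a..b} \<Longrightarrow> h r = h' r" shows "unit_len a b h = unit_len a b h'"
proof -
  have le: "unit_len a b h \<le> unit_len a b h'" if eq: "\<And>r. r \<in> {a..b} \<Longrightarrow> h r = h' r" for h h'
  proof (rule unit_len_least)
    fix K s t j assume S: "separated_system a b h K s t j"
    have st: "\<And>k. k \<in> K \<Longrightarrow> a \<le> s k \<and> s k \<le> t k \<and> t k \<le> b" using S by (auto simp: separated_system_def)
    have "separated_system a b h' K s t j"
      unfolding separated_system_def
    proof (intro conjI ballI impI)
      show "finite K" using S by (simp add: separated_system_def)
      fix k assume k: "k \<in> K"
      show st': "a \<le> s k" "s k \<le> t k" "t k \<le> b" using st[OF k] by auto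
      show "of_int (j k) < h' r" "h' r < of_int (j k) + 1" if r: "r \<in> {s k..t k}" for r
      proof -
        have "h r = h' r" using r st' by (intro eq) auto
        moreover have "of_int (j k) < h r" "h r < of_int (j k) + 1"
          using S k r by (auto simp: separated_system_def)
        ultimately show "of_int (j k) < h' r" "h' r < of_int (j k) + 1" by simp_all
      qed
      fix l assume l: "l \<in> K" "k \<noteq> l" "j k = j l"
      obtain r where r: "h r \<notin> {of_int (j k)..of_int (j k) + 1}" "t k \<le> r \<and> r \<le> s l \<or> t l \<le> r \<and> r \<le> s k"
        using S k l unfolding separated_system_def by blast
      have "h r = h' r" using r(2) st[OF k] st[OF l(1)] by (intro eq) auto
      then show "\<exists>r. h' r \<notin> {of_int (j k)..of_int (j k) + 1} \<and> (t k \<le> r \<and> r \<le> s l \<or> t l \<le> r \<and> r \<le> s k)"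
        using r by auto
    qed
    moreover have "system_sum h K s t = system_sum h' K s t"
      unfolding system_sum_def using st by (intro sum.cong refl) (metis atLeastAtMost_iff eq order_trans)
    ultimately show "system_sum h K s t \<le> unit_len a b h'" using unit_len_upper by metis
  qed
  show ?thesis by (rule antisym; rule le) (use assms in auto)
qed

text \<open>A system for \<open>h \<circ> \<phi>\<close> is pushed forward by \<phi>. By the
  intermediate value theorem \<phi> covers each image interval, so the slab condition transfers, and
  monotonicity keeps separating points between the intervals.\<close>

lemma unit_len_compose_mono:
  assumes \<phi>: "continuous_on {a..b} \<phi>" "mono_on {a..b} \<phi>" "\<phi> ` {a..b} \<subseteq> {c..d}"
  shows "unit_len a b (h \<circ> \<phi>) \<le> unit_len c d h"
proof (rule unit_len_least)
  fix K s t j assume S: "separated_system a b (h \<circ> \<phi>) K s t j"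
  have st: "\<And>k. k \<in> K \<Longrightarrow> a \<le> s k \<and> s k \<le> t k \<and> t k \<le> b" using S by (auto simp: separated_system_def)
  have m: "\<And>p q. a \<le> p \<Longrightarrow> p \<le> q \<Longrightarrow> q \<le> b \<Longrightarrow> \<phi> p \<le> \<phi> q"
    using \<phi>(2) by (auto simp: mono_on_def)
  have "separated_system c d h K (\<phi> \<circ> s) (\<phi> \<circ> t) j"
    unfolding separated_system_def
  proof (intro conjI ballI impI)
    show "finite K" using S by (simp add: separated_system_def)
    fix k assume k: "k \<in> K"
    show "c \<le> (\<phi> \<circ> s) k" "(\<phi> \<circ> s) k \<le> (\<phi> \<circ> t) k" "(\<phi> \<circ> t) k \<le> d"
      using st[OF k] \<phi>(3) m[of "s k" "t k"] by (auto simp: image_subset_iff)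
    show "of_int (j k) < h r" "h r < of_int (j k) + 1" if r: "r \<in> {(\<phi> \<circ> s) k..(\<phi> \<circ> t) k}" for r
    proof -
      have "continuous_on {s k..t k} \<phi>" by (rule continuous_on_subset[OF \<phi>(1)]) (use st[OF k] in auto)
      then obtain q where q: "s k \<le> q" "q \<le> t k" "\<phi> q = r" using IVT'[of \<phi> "s k" r "t k"] r st[OF k] by auto
      then show "of_int (j k) < h r" "h r < of_int (j k) + 1"
        using S k by (auto simp: separated_system_def)
    qed
    fix l assume l: "l \<in> K" "k \<noteq> l" "j k = j l"
    obtain r where r: "(h \<circ> \<phi>) r \<notin> {of_int (j k)..of_int (j k) + 1}" "t k \<le> r \<and> r \<le> s l \<or> t l \<le> r \<and> r \<le> s k"
      using S k l unfolding separated_system_def by blast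
    have "(\<phi> \<circ> t) k \<le> \<phi> r \<and> \<phi> r \<le> (\<phi> \<circ> s) l \<or> (\<phi> \<circ> t) l \<le> \<phi> r \<and> \<phi> r \<le> (\<phi> \<circ> s) k"
      using r(2) st[OF k] st[OF l(1)] m by auto
    then show "\<exists>r. h r \<notin> {of_int (j k)..of_int (j k) + 1} \<and>
        ((\<phi> \<circ> t) k \<le> r \<and> r \<le> (\<phi> \<circ> s) l \<or> (\<phi> \<circ> t) l \<le> r \<and> r \<le> (\<phi> \<circ> s) k)"
      using r(1) by (intro exI[of _ "\<phi> r"]) simp
  qed
  from unit_len_upper[OF this] show "system_sum (h \<circ> \<phi>) K s t \<le> unit_len c d h"
    by (simp add: system_sum_def)
qed

text \<open>Reversal exchanges the two ends of each interval, which the absolute value in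
  \<open>system_sum\<close> and the two alternatives of the separation condition do not see.\<close>

lemma unit_len_compose_antimono:
  assumes \<phi>: "continuous_on {a..b} \<phi>" "antimono_on {a..b} \<phi>" "\<phi> ` {a..b} \<subseteq> {c..d}"
  shows "unit_len a b (h \<circ> \<phi>) \<le> unit_len c d h"
proof (rule unit_len_least)
  fix K s t j assume S: "separated_system a b (h \<circ> \<phi>) K s t j"
  have st: "\<And>k. k \<in> K \<Longrightarrow> a \<le> s k \<and> s k \<le> t k \<and> t k \<le> b" using S by (auto simp: separated_system_def)
  have m: "\<And>p q. a \<le> p \<Longrightarrow> p \<le> q \<Longrightarrow> q \<le> b \<Longrightarrow> \<phi> q \<le> \<phi> p"
    using \<phi>(2) by (auto simp: monotone_on_def)
  have "separated_system c d h K (\<phi> \<circ> t) (\<phi> \<circ> s) j"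
    unfolding separated_system_def
  proof (intro conjI ballI impI)
    show "finite K" using S by (simp add: separated_system_def)
    fix k assume k: "k \<in> K"
    show "c \<le> (\<phi> \<circ> t) k" "(\<phi> \<circ> t) k \<le> (\<phi> \<circ> s) k" "(\<phi> \<circ> s) k \<le> d"
      using st[OF k] \<phi>(3) m[of "s k" "t k"] by (auto simp: image_subset_iff)
    show "of_int (j k) < h r" "h r < of_int (j k) + 1" if r: "r \<in> {(\<phi> \<circ> t) k..(\<phi> \<circ> s) k}" for r
    proof -
      have "continuous_on {s k..t k} \<phi>" by (rule continuous_on_subset[OF \<phi>(1)]) (use st[OF k] in auto)
      then obtain q where q: "s k \<le> q" "q \<le> t k" "\<phi> q = r" using IVT2'[of \<phi> "t k" r "s k"] r st[OF k] by auto
      then show "of_int (j k) < h r" "h r < of_int (j k) + 1"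
        using S k by (auto simp: separated_system_def)
    qed
    fix l assume l: "l \<in> K" "k \<noteq> l" "j k = j l"
    obtain r where r: "(h \<circ> \<phi>) r \<notin> {of_int (j k)..of_int (j k) + 1}" "t k \<le> r \<and> r \<le> s l \<or> t l \<le> r \<and> r \<le> s k"
      using S k l unfolding separated_system_def by blast
    have "(\<phi> \<circ> s) k \<le> \<phi> r \<and> \<phi> r \<le> (\<phi> \<circ> t) l \<or> (\<phi> \<circ> s) l \<le> \<phi> r \<and> \<phi> r \<le> (\<phi> \<circ> t) k"
      using r(2) st[OF k] st[OF l(1)] m by auto
    then show "\<exists>r. h r \<notin> {of_int (j k)..of_int (j k) + 1} \<and>
        ((\<phi> \<circ> s) k \<le> r \<and> r \<le> (\<phi> \<circ> t) l \<or> (\<phi> \<circ> s) l \<le> r \<and> r \<le> (\<phi> \<circ> t) k)"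
      using r(1) by (intro exI[of _ "\<phi> r"]) simp
  qed
  from unit_len_upper[OF this] show "system_sum (h \<circ> \<phi>) K s t \<le> unit_len c d h"
    by (simp add: system_sum_def abs_minus_commute)
qed

text \<open>This excludes a graph that touches the edge of a slab without crossing it, the situation
  in which open and closed slabs can give different sums. Extrema at \<open>a\<close> and
  \<open>b\<close> are left out because the passage to open slabs moves interval ends
  inward.\<close>

definition no_integer_extremum :: "real \<Rightarrow> real \<Rightarrow> (real \<Rightarrow> real) \<Rightarrow> bool" where
  "no_integer_extremum a b h \<longleftrightarrow> (\<forall>r e. a < r \<longrightarrow> r < b \<longrightarrow> 0 < e \<longrightarrow> h r \<in> \<int> \<longrightarrow>
     \<not> (\<forall>q. \<bar>q - r\<bar> < e \<longrightarrow> h q \<le> h r) \<and> \<not> (\<forall>q. \<bar>q - r\<bar> < e \<longrightarrow> h r \<le> h q))"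

text \<open>Where \<open>h\<close> stays in a closed slab around \<open>r\<close>, reaching an edge
  at \<open>r\<close> would be a local extremum with integer value.\<close>

lemma no_integer_extremum_interior:
  assumes g: "no_integer_extremum a b h" and p: "a \<le> p" "p < r" "r < q" "q \<le> b"
    and h: "\<And>z. p \<le> z \<Longrightarrow> z \<le> q \<Longrightarrow> of_int i \<le> h z \<and> h z \<le> of_int i + 1"
  shows "of_int i < h r" "h r < of_int i + 1"
proof -
  define e where "e = min (r - p) (q - r)"
  have e: "e > 0" using p by (auto simp: e_def)
  have z: "of_int i \<le> h z \<and> h z \<le> of_int i + 1" if "\<bar>z - r\<bar> < e" for z
    using that by (intro h) (auto simp: e_def min_def split: if_splits)
  have "h r \<noteq> of_int i"
  proof
    assume eq: "h r = of_int i"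
    then have "\<forall>z. \<bar>z - r\<bar> < e \<longrightarrow> h r \<le> h z" using z by auto
    moreover have "h r \<in> \<int>" using eq by simp
    ultimately show False using g e p unfolding no_integer_extremum_def by (meson le_less_trans less_le_trans)
  qed
  moreover have "h r \<noteq> of_int i + 1"
  proof
    assume eq: "h r = of_int i + 1"
    then have "\<forall>z. \<bar>z - r\<bar> < e \<longrightarrow> h z \<le> h r" using z by auto
    moreover have "h r \<in> \<int>" using eq by simp
    ultimately show False using g e p unfolding no_integer_extremum_def by (meson le_less_trans less_le_trans)
  qed
  moreover have "of_int i \<le> h r \<and> h r \<le> of_int i + 1" using z[of r] e by simp
  ultimately show "of_int i < h r" "h r < of_int i + 1" by auto
qed

text \<open>Moving the ends strictly inward helps both conditions. The shorter interval is interior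
  to the old one, so \<open>h\<close> is strictly inside the slab there. The wider gap has the old
  separating point in its interior: if \<open>h\<close> stayed in the closed slab on the whole gap,
  that point would be an integer extremum.\<close>

lemma weakly_separated_shrink:
  assumes g: "no_integer_extremum a b h"
    and W: "weakly_separated_system a b h K s t j"
    and ne: "\<And>k. k \<in> K \<Longrightarrow> s k < t k"
    and st': "\<And>k. k \<in> K \<Longrightarrow> s k < s' k \<and> s' k \<le> t' k \<and> t' k < t k"
  shows "separated_system a b h K s' t' j"
  unfolding separated_system_def
proof (intro conjI ballI impI)
  show "finite K" using W by (simp add: weakly_separated_system_def)
  have st: "a \<le> s k" "s k \<le> t k" "t k \<le> b" if "k \<in> K" for k
    using W that by (auto simp: weakly_separated_system_def)
  have hw: "of_int (j k) \<le> h r \<and> h r \<le> of_int (j k) + 1" if "k \<in> K" "s k \<le> r" "r \<le> t k" for k r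
    using W that by (auto simp: weakly_separated_system_def)
  fix k assume k: "k \<in> K"
  show "a \<le> s' k" "s' k \<le> t' k" "t' k \<le> b" using st[OF k] st'[OF k] by auto
  show "of_int (j k) < h r" "h r < of_int (j k) + 1" if r: "r \<in> {s' k..t' k}" for r
    using no_integer_extremum_interior[OF g, of "s k" r "t k" "j k"] st[OF k] st'[OF k] r hw[OF k] by auto
  fix l assume l: "l \<in> K" "k \<noteq> l" "j k = j l"
  have key: "\<exists>r. h r \<notin> {of_int (j m)..of_int (j m) + 1} \<and> t' m \<le> r \<and> r \<le> s' n"
    if m: "m \<in> K" and n: "n \<in> K" and mn: "j m = j n" and r0: "h r0 \<notin> {of_int (j m)<..<of_int (j m) + 1}" "t m \<le> r0" "r0 \<le> s n"
    for m n r0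
  proof (rule ccontr)
    assume "\<nexists>r. h r \<notin> {of_int (j m)..of_int (j m) + 1} \<and> t' m \<le> r \<and> r \<le> s' n"
    then have c: "of_int (j m) \<le> h z \<and> h z \<le> of_int (j m) + 1" if "t' m \<le> z" "z \<le> s' n" for z
      using that by (meson atLeastAtMost_iff)
    have "t' m < r0" "r0 < s' n" using r0 st'[OF m] st'[OF n] by auto
    moreover have "a \<le> t' m" "s' n \<le> b" using st[OF m] st'[OF m] st[OF n] st'[OF n] by auto
    ultimately show False
      using no_integer_extremum_interior[OF g, of "t' m" r0 "s' n" "j m"] c r0(1) by auto
  qed
  obtain r where r: "h r \<notin> {of_int (j k)<..<of_int (j k) + 1}" "t k \<le> r \<and> r \<le> s l \<or> t l \<le> r \<and> r \<le> s k"
    using W k l unfolding weakly_separated_system_def by blast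
  show "\<exists>r. h r \<notin> {of_int (j k)..of_int (j k) + 1} \<and> (t' k \<le> r \<and> r \<le> s' l \<or> t' l \<le> r \<and> r \<le> s' k)"
    using r(2)
  proof
    assume "t k \<le> r \<and> r \<le> s l"
    then show ?thesis using key[OF k l(1) l(3) r(1)] by blast
  next
    assume "t l \<le> r \<and> r \<le> s k"
    then show ?thesis using key[OF l(1) k l(3)[symmetric], of r] r(1) l(3) by force
  qed
qed

text \<open>In the absence of integer extrema, a weak system is a limit, as \<eta> tends to 0, of
  shrunken systems, and these are strict.\<close>

lemma weakly_separated_sum_le_unit_len:
  assumes g: "no_integer_extremum a b h" and h: "continuous_on {a..b} h"
    and W: "weakly_separated_system a b h K s t j"
  shows "system_sum h K s t \<le> unit_len a b h"
proof -
  \<comment> \<open>Intervals of width 0 add nothing; removing them ensures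
    \<open>s k < t k\<close>, so that there is room to shrink.\<close>
  define K' where "K' = {k\<in>K. h (s k) \<noteq> h (t k)}"
  have fin: "finite K" "finite K'" using W by (auto simp: weakly_separated_system_def K'_def)
  have W': "weakly_separated_system a b h K' s t j"
    using W unfolding weakly_separated_system_def K'_def by auto
  have st: "a \<le> s k" "s k < t k" "t k \<le> b" if "k \<in> K'" for k
  proof -
    have "s k \<noteq> t k" using that by (auto simp: K'_def)
    then show "a \<le> s k" "s k < t k" "t k \<le> b" using W' that by (force simp: weakly_separated_system_def)+
  qed
  define s' t' where "s' = (\<lambda>\<eta> k. s k + \<eta> * (t k - s k))" and "t' = (\<lambda>\<eta> k. t k - \<eta> * (t k - s k))"
  have "\<forall>\<^sub>F \<eta> in at_right 0. (0::real) < \<eta>" by (rule eventually_at_right_less)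
  moreover have "\<forall>\<^sub>F \<eta> in at_right 0. \<eta> < (1/2::real)" by (rule order_tendstoD(2)[OF tendsto_ident_at]) simp
  ultimately have ev: "\<forall>\<^sub>F \<eta> in at_right 0. 0 < \<eta> \<and> \<eta> < (1/2::real)" by (rule eventually_conj)
  have ins: "s k < s' \<eta> k \<and> s' \<eta> k \<le> t' \<eta> k \<and> t' \<eta> k < t k" if k: "k \<in> K'" and "0 < \<eta> \<and> \<eta> < 1/2" for k \<eta>
  proof -
    have "0 < \<eta> * (t k - s k)" "\<eta> * (t k - s k) \<le> 1/2 * (t k - s k)"
      using st[OF k] that by (auto intro: mult_right_mono)
    then show ?thesis using st[OF k] by (auto simp: s'_def t'_def algebra_simps)
  qed
  have le: "\<forall>\<^sub>F \<eta> in at_right 0. system_sum h K' (s' \<eta>) (t' \<eta>) \<le> unit_len a b h"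
    using ev
  proof eventually_elim
    case (elim \<eta>)
    show ?case
      by (rule unit_len_upper, rule weakly_separated_shrink[OF g W']) (use st ins elim in auto)
  qed
  have lim: "((\<lambda>\<eta>. h (x \<eta>)) \<longlongrightarrow> h y) (at_right 0)"
    if "(x \<longlongrightarrow> y) (at_right 0)" "\<forall>\<^sub>F \<eta> in at_right 0. x \<eta> \<in> {a..b}" "y \<in> {a..b}" for x :: "real \<Rightarrow> real" and y
    by (rule continuous_on_tendsto_compose[OF h that(1) that(3) that(2)])
  have "((\<lambda>\<eta>. system_sum h K' (s' \<eta>) (t' \<eta>)) \<longlongrightarrow> system_sum h K' s t) (at_right 0)"
    unfolding system_sum_def
  proof (intro tendsto_sum tendsto_mult tendsto_const tendsto_rabs tendsto_diff)
    fix k assume k: "k \<in> K'"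
    have "((\<lambda>\<eta>. s' \<eta> k) \<longlongrightarrow> s k + 0 * (t k - s k)) (at_right 0)"
      unfolding s'_def by (intro tendsto_intros)
    moreover have "((\<lambda>\<eta>. t' \<eta> k) \<longlongrightarrow> t k - 0 * (t k - s k)) (at_right 0)"
      unfolding t'_def by (intro tendsto_intros)
    moreover have "\<forall>\<^sub>F \<eta> in at_right 0. s' \<eta> k \<in> {a..b} \<and> t' \<eta> k \<in> {a..b}"
      using ev by eventually_elim (use ins[OF k] st[OF k] in force)
    ultimately show "((\<lambda>\<eta>. h (s' \<eta> k)) \<longlongrightarrow> h (s k)) (at_right 0)" "((\<lambda>\<eta>. h (t' \<eta> k)) \<longlongrightarrow> h (t k)) (at_right 0)"
      using st[OF k] by (auto intro!: lim elim: eventually_mono)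
  qed
  then have "system_sum h K' s t \<le> unit_len a b h"
    by (rule tendsto_upperbound[OF _ le]) simp
  moreover have "system_sum h K' s t = system_sum h K s t"
    unfolding system_sum_def by (rule sum.mono_neutral_left) (use fin in \<open>auto simp: K'_def\<close>)
  ultimately show ?thesis by simp
qed

text \<open>The left ends are at least \<delta> apart, so rounding
  \<open>(s k - a) / \<delta>\<close> down is injective.\<close>

lemma card_disjoint_long_intervals:
  fixes s t :: "'i \<Rightarrow> real"
  assumes fin: "finite S" and \<delta>: "0 < \<delta>"
    and st: "\<And>k. k \<in> S \<Longrightarrow> a \<le> s k \<and> s k + \<delta> \<le> t k \<and> t k \<le> b"
    and dis: "\<And>k l. k \<in> S \<Longrightarrow> l \<in> S \<Longrightarrow> k \<noteq> l \<Longrightarrow> t k \<le> s l \<or> t l \<le> s k"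
  shows "card S \<le> nat (\<lfloor>(b - a) / \<delta>\<rfloor> + 1)"
proof -
  let ?f = "\<lambda>k. \<lfloor>(s k - a) / \<delta>\<rfloor>"
  have "inj_on ?f S"
  proof (rule inj_onI, rule ccontr)
    fix k l assume kl: "k \<in> S" "l \<in> S" "?f k = ?f l" "k \<noteq> l"
    have "\<bar>s k - s l\<bar> \<ge> \<delta>" using dis[OF kl(1,2,4)] st[OF kl(1)] st[OF kl(2)] by auto
    moreover have "\<bar>(s k - a) / \<delta> - (s l - a) / \<delta>\<bar> < 1" using kl(3) by linarith
    then have "\<bar>s k - s l\<bar> < \<delta>" using \<delta>
      by (auto simp: diff_divide_distrib[symmetric] abs_divide)
    ultimately show False by simp
  qed
  then have "card S = card (?f ` S)" by (simp add: card_image)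
  also have "?f ` S \<subseteq> {0..\<lfloor>(b - a) / \<delta>\<rfloor>}"
  proof
    fix y assume "y \<in> ?f ` S"
    then obtain k where k: "k \<in> S" "y = ?f k" by auto
    have "0 \<le> s k - a" "s k - a \<le> b - a" using st[OF k(1)] \<delta> by auto
    then have "0 \<le> (s k - a) / \<delta>" "(s k - a) / \<delta> \<le> (b - a) / \<delta>" using \<delta> by (auto intro: divide_right_mono)
    then show "y \<in> {0..\<lfloor>(b - a) / \<delta>\<rfloor>}" unfolding k(2) by (auto intro: floor_mono)
  qed
  then have "card (?f ` S) \<le> card {0..\<lfloor>(b - a) / \<delta>\<rfloor>}" by (intro card_mono) auto
  also have "\<dots> = nat (\<lfloor>(b - a) / \<delta>\<rfloor> + 1)" by simp
  finally show ?thesis .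
qed

lemma oscillation_length:
  fixes h :: "real \<Rightarrow> real"
  assumes h: "continuous_on {a..b} h" and "0 < e"
  obtains \<delta> where "0 < \<delta>" "\<And>p q. a \<le> p \<Longrightarrow> p \<le> q \<Longrightarrow> q \<le> b \<Longrightarrow> e \<le> \<bar>h q - h p\<bar> \<Longrightarrow> p + \<delta> \<le> q"
proof -
  have "uniformly_continuous_on {a..b} h"
    by (rule compact_uniformly_continuous[OF h compact_Icc])
  then obtain \<delta> where \<delta>: "\<delta> > 0" "\<And>p q. p \<in> {a..b} \<Longrightarrow> q \<in> {a..b} \<Longrightarrow> dist q p < \<delta> \<Longrightarrow> dist (h q) (h p) < e"
    using \<open>0 < e\<close> unfolding uniformly_continuous_on_def by metis
  show ?thesis
  proof (rule that[OF \<delta>(1)])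
    fix p q assume "a \<le> p" "p \<le> q" "q \<le> b" "e \<le> \<bar>h q - h p\<bar>"
    then show "p + \<delta> \<le> q" using \<delta>(2)[of p q] by (force simp: dist_real_def)
  qed
qed

text \<open>At most \<open>n\<close> intervals can have width 1/2 or more, with \<open>n\<close>
  independent of the system. Hence one of the n + 1 indices 0..n carries at most half of its weight,
  and the deficit below 2 survives the supremum.\<close>

lemma unit_len_less_2:
  assumes h: "continuous_on {a..b} h"
  shows "unit_len a b h < 2"
proof -
  obtain \<delta> where \<delta>: "0 < \<delta>" "\<And>p q. a \<le> p \<Longrightarrow> p \<le> q \<Longrightarrow> q \<le> b \<Longrightarrow> 1/2 \<le> \<bar>h q - h p\<bar> \<Longrightarrow> p + \<delta> \<le> q"
    using oscillation_length[OF h, of "1/2"] by auto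
  define n where "n = nat (\<lfloor>(b - a) / \<delta>\<rfloor> + 1)"
  have "unit_len a b h \<le> 2 - (1/2)^n / 2"
  proof (rule unit_len_least)
    fix K s t j assume S: "separated_system a b h K s t j"
    note W = separated_imp_weakly_separated[OF S]
    define L where "L = {k\<in>K. 1/2 \<le> \<bar>h (t k) - h (s k)\<bar>}"
    have fin: "finite K" "finite L" using S by (auto simp: separated_system_def L_def)
    have st: "a \<le> s k" "s k \<le> t k" "t k \<le> b" if "k \<in> K" for k
      using S that by (auto simp: separated_system_def)
    have op: "of_int (j k) < h r" "h r < of_int (j k) + 1" if "k \<in> K" "s k \<le> r" "r \<le> t k" for k r
      using S that by (auto simp: separated_system_def)
    have dis: "t k \<le> s l \<or> t l \<le> s k" if k: "k \<in> K" and l: "l \<in> K" and kl: "k \<noteq> l" for k l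
    proof (cases "j k = j l")
      case True
      then show ?thesis using S k l kl unfolding separated_system_def by (meson order_trans)
    next
      case False
      \<comment> \<open>Open slabs of different index are disjoint, so the two intervals cannot have
        a common point.\<close>
      show ?thesis
      proof (rule ccontr)
        assume "\<not> ?thesis"
        then have "s k \<le> max (s k) (s l)" "max (s k) (s l) \<le> t k" "s l \<le> max (s k) (s l)" "max (s k) (s l) \<le> t l"
          using st[OF k] st[OF l] by auto
        then have "of_int (j k) < of_int (j l) + (1::real)" "of_int (j l) < of_int (j k) + (1::real)"
          using op[OF k, of "max (s k) (s l)"] op[OF l, of "max (s k) (s l)"] by auto
        then show False using False by linarith
      qed
    qed
    have "card L \<le> n" unfolding n_def
      by (rule card_disjoint_long_intervals[where s = s and t = t, OF fin(2) \<delta>(1)])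
        (use st \<delta>(2) dis in \<open>auto simp: L_def\<close>)
    then have "\<not> {..n} \<subseteq> L" using card_mono[OF fin(2), of "{..n}"] by auto
    then obtain m where m: "m \<le> n" "m \<notin> L" by auto
    have "system_sum h K s t \<le> (\<Sum>k\<in>K. (1/2)^k * (if k = m then 1/2 else 1))"
      unfolding system_sum_def
      using m(2) weakly_separated_width[OF W] by (intro sum_mono mult_left_mono) (auto simp: L_def not_le less_imp_le)
    \<comment> \<open>The index \<open>m\<close> may be a gap of \<open>K\<close>; inserting it lets
      both cases be compared with the full weight sum.\<close>
    also have "\<dots> \<le> (\<Sum>k\<in>insert m K. (1/2)^k * (if k = m then 1/2 else 1))"
      using fin by (intro sum_mono2) auto
    also have "\<dots> = (\<Sum>k\<in>insert m K. (1/2)^k - (if k = m then (1/2)^m / 2 else 0))"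
      by (intro sum.cong) auto
    also have "\<dots> = (\<Sum>k\<in>insert m K. (1/2)^k) - (1/2)^m / 2"
      using fin by (subst sum_subtractf, subst sum.delta) auto
    also have "\<dots> \<le> 2 - (1/2)^m / 2"
      using fin sum_half_power_le[of "insert m K"] by auto
    also have "\<dots> \<le> 2 - (1/2)^n / 2"
      using power_decreasing[of m n "1/2::real"] m(1) by simp
    finally show "system_sum h K s t \<le> 2 - (1/2)^n / 2" .
  qed
  also have "\<dots> < (2::real)" by simp
  finally show ?thesis .
qed

section \<open>Semicontinuity and strict monotonicity\<close>

lemma finite_family_convergent_subseq:
  fixes f :: "'i \<Rightarrow> nat \<Rightarrow> 'b::metric_space"
  assumes "finite S" "compact C" "\<And>i n. i \<in> S \<Longrightarrow> f i n \<in> C"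
  shows "\<exists>r l. strict_mono (r :: nat \<Rightarrow> nat) \<and> (\<forall>i\<in>S. l i \<in> C \<and> (\<lambda>n. f i (r n)) \<longlonglongrightarrow> l i)"
  using assms(1,3)
proof (induction S)
  case empty
  show ?case by (rule exI[of _ id]) (simp add: strict_mono_def)
next
  case (insert i S)
  have "\<And>i n. i \<in> S \<Longrightarrow> f i n \<in> C" using insert.prems by blast
  from insert.IH[OF this] obtain r l
    where r: "strict_mono (r :: nat \<Rightarrow> nat)" "\<forall>i\<in>S. l i \<in> C \<and> (\<lambda>n. f i (r n)) \<longlonglongrightarrow> l i"
    by blast
  have "\<forall>n. f i (r n) \<in> C" using insert.prems by blast
  then obtain x r' where r': "x \<in> C" "strict_mono (r' :: nat \<Rightarrow> nat)" "((\<lambda>n. f i (r n)) \<circ> r') \<longlonglongrightarrow> x"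
    using assms(2)[unfolded compact_def, rule_format, of "\<lambda>n. f i (r n)"] by auto
  have "strict_mono (r \<circ> r')" using r(1) r'(2) by (simp add: strict_mono_o)
  moreover have "(l(i := x)) k \<in> C \<and> (\<lambda>n. f k ((r \<circ> r') n)) \<longlonglongrightarrow> (l(i := x)) k" if k: "k \<in> insert i S" for k
  proof (cases "k = i")
    case True
    then show ?thesis using r'(1,3) by (simp add: o_def)
  next
    case False
    then have "l k \<in> C" "(\<lambda>n. f k (r n)) \<longlonglongrightarrow> l k" using r(2) k by auto
    then show ?thesis using LIMSEQ_subseq_LIMSEQ[OF _ r'(2), of "\<lambda>n. f k (r n)"] False by (simp add: o_def)
  qed
  ultimately show ?case by blast
qed

lemma tendsto_dist_zero_trans:
  assumes "((\<lambda>n. dist (f n) (g n)) \<longlongrightarrow> 0) F" "(g \<longlongrightarrow> l) F"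
  shows "(f \<longlongrightarrow> l) F"
proof -
  have "((\<lambda>n. dist (f n) (g n) + dist (g n) l) \<longlongrightarrow> 0 + 0) F"
    by (intro tendsto_add assms(1) tendsto_dist_iff[THEN iffD1] assms(2))
  then have "((\<lambda>n. dist (f n) (g n) + dist (g n) l) \<longlongrightarrow> 0) F" by simp
  then have "((\<lambda>n. dist (f n) l) \<longlongrightarrow> 0) F"
    by (rule Lim_null_comparison[rotated]) (simp add: dist_triangle)
  then show ?thesis by (rule tendsto_dist_iff[THEN iffD2])
qed

lemma uniform_limit_tendsto_compose:
  fixes H :: "nat \<Rightarrow> 'a::metric_space \<Rightarrow> 'b::metric_space"
  assumes u: "uniform_limit S H h sequentially" and h: "continuous_on S h"
    and x: "x \<longlonglongrightarrow> l" "\<And>n. x n \<in> S" "l \<in> S"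
  shows "(\<lambda>n. H n (x n)) \<longlonglongrightarrow> h l"
proof -
  have "(\<lambda>n. h (x n)) \<longlonglongrightarrow> h l"
    by (rule continuous_on_tendsto_compose[OF h x(1) x(3)]) (use x(2) in auto)
  moreover have "(\<lambda>n. dist (H n (x n)) (h (x n))) \<longlonglongrightarrow> 0"
    unfolding tendsto_iff
  proof (intro allI impI)
    fix e :: real assume "e > 0"
    then have "\<forall>\<^sub>F n in sequentially. \<forall>x\<in>S. dist (H n x) (h x) < e" using u by (simp add: uniform_limit_iff)
    then show "\<forall>\<^sub>F n in sequentially. dist (dist (H n (x n)) (h (x n))) 0 < e"
      by eventually_elim (use x(2) in auto)
  qed
  ultimately show ?thesis by (rule tendsto_dist_zero_trans[rotated])
qed

lemma uniform_limit_subseq: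
  assumes "uniform_limit S H h sequentially" "strict_mono r"
  shows "uniform_limit S (\<lambda>n. H (r n)) h sequentially"
  using filterlim_compose[OF assms(1) filterlim_subseq[OF assms(2)]] .

text \<open>With \<open>K\<close> and \<open>j\<close> fixed, a system consists of finitely many
  points of {a..b}: the interval ends and one separating point per pair. They converge along a
  common subsequence, and strict conditions become weak in the limit.\<close>

lemma separated_system_limit:
  assumes h: "continuous_on {a..b} h" and u: "uniform_limit {a..b} H h sequentially"
    and S: "\<And>n. separated_system a b (H n) K (s n) (t n) j"
  obtains r s' t' where "strict_mono (r :: nat \<Rightarrow> nat)" "weakly_separated_system a b h K s' t' j"
    "(\<lambda>n. system_sum (H (r n)) K (s (r n)) (t (r n))) \<longlonglongrightarrow> system_sum h K s' t'"
proof -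
  have fin: "finite K" using S by (auto simp: separated_system_def)
  have st: "a \<le> s n k" "s n k \<le> t n k" "t n k \<le> b" if "k \<in> K" for n k
    using S[of n] that by (auto simp: separated_system_def)
  have op: "of_int (j k) < H n r" "H n r < of_int (j k) + 1" if "k \<in> K" "s n k \<le> r" "r \<le> t n k" for k r n
    using S[of n] that by (auto simp: separated_system_def)
  define P where "P = {(k, l). k \<in> K \<and> l \<in> K \<and> k \<noteq> l \<and> j k = j l}"
  have finP: "finite P" by (rule finite_subset[of _ "K \<times> K"]) (use fin in \<open>auto simp: P_def\<close>)
  have "\<exists>y. \<forall>kl\<in>P. H n (y kl) \<notin> {of_int (j (fst kl))..of_int (j (fst kl)) + 1} \<and>
     (t n (fst kl) \<le> y kl \<and> y kl \<le> s n (snd kl) \<or> t n (snd kl) \<le> y kl \<and> y kl \<le> s n (fst kl))" for n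
  proof (rule bchoice, safe)
    fix k l assume "(k, l) \<in> P"
    then show "\<exists>y. H n y \<notin> {of_int (j (fst (k,l)))..of_int (j (fst (k,l))) + 1} \<and>
     (t n (fst (k,l)) \<le> y \<and> y \<le> s n (snd (k,l)) \<or> t n (snd (k,l)) \<le> y \<and> y \<le> s n (fst (k,l)))"
      using S[of n] unfolding P_def separated_system_def by auto
  qed
  then obtain y where y: "\<And>n kl. kl \<in> P \<Longrightarrow> H n (y n kl) \<notin> {of_int (j (fst kl))..of_int (j (fst kl)) + 1}"
    "\<And>n kl. kl \<in> P \<Longrightarrow> t n (fst kl) \<le> y n kl \<and> y n kl \<le> s n (snd kl) \<or> t n (snd kl) \<le> y n kl \<and> y n kl \<le> s n (fst kl)"
    by metis
  have yab: "y n kl \<in> {a..b}" if "kl \<in> P" for n kl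
  proof -
    have "fst kl \<in> K" "snd kl \<in> K" using that by (auto simp: P_def)
    then show ?thesis using y(2)[OF that, of n] st[of "fst kl" n] st[of "snd kl" n] by auto
  qed
  have sab: "s n k \<in> {a..b}" and tab: "t n k \<in> {a..b}" if "k \<in> K" for n k
    using st[OF that, of n] by auto
  obtain r1 s' where r1: "strict_mono (r1 :: nat \<Rightarrow> nat)" "\<And>k. k \<in> K \<Longrightarrow> s' k \<in> {a..b}"
    "\<And>k. k \<in> K \<Longrightarrow> (\<lambda>n. s (r1 n) k) \<longlonglongrightarrow> s' k"
    using finite_family_convergent_subseq[OF fin compact_Icc, of "\<lambda>k n. s n k" a b] sab by blast
  obtain r2 t' where r2: "strict_mono (r2 :: nat \<Rightarrow> nat)" "\<And>k. k \<in> K \<Longrightarrow> t' k \<in> {a..b}"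
    "\<And>k. k \<in> K \<Longrightarrow> (\<lambda>n. t (r1 (r2 n)) k) \<longlonglongrightarrow> t' k"
    using finite_family_convergent_subseq[OF fin compact_Icc, of "\<lambda>k n. t (r1 n) k" a b] tab by blast
  obtain r3 y' where r3: "strict_mono (r3 :: nat \<Rightarrow> nat)" "\<And>k. k \<in> P \<Longrightarrow> y' k \<in> {a..b}"
    "\<And>k. k \<in> P \<Longrightarrow> (\<lambda>n. y (r1 (r2 (r3 n))) k) \<longlonglongrightarrow> y' k"
    using finite_family_convergent_subseq[OF finP compact_Icc, of "\<lambda>k n. y (r1 (r2 n)) k" a b] yab
    by blast
  define r where "r = r1 \<circ> (r2 \<circ> r3)"
  have r: "strict_mono r" unfolding r_def using r1 r2 r3 by (intro strict_mono_o)
  have sl: "(\<lambda>n. s (r n) k) \<longlonglongrightarrow> s' k" if "k \<in> K" for k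
    using LIMSEQ_subseq_LIMSEQ[OF r1(3)[OF that] strict_mono_o[OF r2(1) r3(1)]] by (simp add: r_def o_def)
  have tl: "(\<lambda>n. t (r n) k) \<longlonglongrightarrow> t' k" if "k \<in> K" for k
    using LIMSEQ_subseq_LIMSEQ[OF r2(3)[OF that] r3(1)] by (simp add: r_def o_def)
  have yl: "(\<lambda>n. y (r n) k) \<longlonglongrightarrow> y' k" if "k \<in> P" for k
    using r3(3)[OF that] by (simp add: r_def o_def)
  note u' = uniform_limit_subseq[OF u r]
  have lim: "(\<lambda>n. H (r n) (x n)) \<longlonglongrightarrow> h l" if "x \<longlonglongrightarrow> l" "\<And>n. x n \<in> {a..b}" for x l
  proof (rule uniform_limit_tendsto_compose[OF u' h that])
    show "l \<in> {a..b}" using closed_sequentially[OF closed_atLeastAtMost, of x a b l] that by blast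
  qed
  have W: "weakly_separated_system a b h K s' t' j"
    unfolding weakly_separated_system_def
  proof (intro conjI ballI impI)
    fix k assume k: "k \<in> K"
    show "a \<le> s' k" "t' k \<le> b" using r1(2)[OF k] r2(2)[OF k] by auto
    show st': "s' k \<le> t' k" by (rule LIMSEQ_le[OF sl[OF k] tl[OF k]]) (use st[OF k] in auto)
    {
      fix z assume z: "z \<in> {s' k..t' k}"
      \<comment> \<open>Clamping \<open>z\<close> to the n-th interval gives points where the n-th
        slab condition applies and which still converge to \<open>z\<close>.\<close>
      define zz where "zz = (\<lambda>n. max (s (r n) k) (min z (t (r n) k)))"
      have "zz \<longlonglongrightarrow> max (s' k) (min z (t' k))"
        unfolding zz_def by (intro tendsto_intros sl tl k)
      then have zl: "zz \<longlonglongrightarrow> z" using z by simp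
      have zz: "s (r n) k \<le> zz n" "zz n \<le> t (r n) k" for n using st[OF k, of "r n"] by (auto simp: zz_def)
      have "zz n \<in> {a..b}" for n using zz[of n] st[OF k, of "r n"] by auto
      from lim[OF zl this] have l: "(\<lambda>n. H (r n) (zz n)) \<longlonglongrightarrow> h z" .
      show "of_int (j k) \<le> h z" by (rule LIMSEQ_le_const[OF l]) (use op[OF k zz] in \<open>auto intro: less_imp_le\<close>)
      show "h z \<le> of_int (j k) + 1" by (rule LIMSEQ_le_const2[OF l]) (use op[OF k zz] in \<open>auto intro: less_imp_le\<close>)
    }
    fix l assume l: "l \<in> K" "k \<noteq> l" "j k = j l"
    then have kl: "(k, l) \<in> P" using k by (simp add: P_def)
    have hl: "(\<lambda>n. H (r n) (y (r n) (k,l))) \<longlonglongrightarrow> h (y' (k,l))"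
      by (rule lim[OF yl[OF kl] yab[OF kl]])
    \<comment> \<open>Lying outside the open slab says that this minimum is at most 0, a form in
      which the disjunction of the two sides passes to the limit.\<close>
    have "(\<lambda>n. min (H (r n) (y (r n) (k,l)) - of_int (j k)) (of_int (j k) + 1 - H (r n) (y (r n) (k,l))))
        \<longlonglongrightarrow> min (h (y' (k,l)) - of_int (j k)) (of_int (j k) + 1 - h (y' (k,l)))"
      by (intro tendsto_intros hl)
    moreover have "min (H (r n) (y (r n) (k,l)) - of_int (j k)) (of_int (j k) + 1 - H (r n) (y (r n) (k,l))) \<le> 0" for n
      using y(1)[OF kl, of "r n"] by auto
    ultimately have 1: "min (h (y' (k,l)) - of_int (j k)) (of_int (j k) + 1 - h (y' (k,l))) \<le> 0"
      by (intro LIMSEQ_le_const2) auto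
    \<comment> \<open>In the same way one closed inequality expresses that the separating point
      follows one interval and precedes the other, in either order.\<close>
    let ?f = "\<lambda>tk y sl tl sk. min (max (tk - y) (y - sl)) (max (tl - y) (y - sk)) :: real"
    have "(\<lambda>n. ?f (t (r n) k) (y (r n) (k,l)) (s (r n) l) (t (r n) l) (s (r n) k))
        \<longlonglongrightarrow> ?f (t' k) (y' (k,l)) (s' l) (t' l) (s' k)"
      by (intro tendsto_intros sl tl yl k l kl)
    moreover have "?f (t (r n) k) (y (r n) (k,l)) (s (r n) l) (t (r n) l) (s (r n) k) \<le> 0" for n
      using y(2)[OF kl, of "r n"] by auto
    ultimately have 2: "?f (t' k) (y' (k,l)) (s' l) (t' l) (s' k) \<le> 0"
      by (intro LIMSEQ_le_const2) auto
    show "\<exists>r. h r \<notin> {of_int (j k)<..<of_int (j k) + 1} \<and> (t' k \<le> r \<and> r \<le> s' l \<or> t' l \<le> r \<and> r \<le> s' k)"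
      using 1 2 by (intro exI[of _ "y' (k,l)"]) (auto simp: min_le_iff_disj max_def split: if_splits)
  qed (use fin in auto)
  have "(\<lambda>n. system_sum (H (r n)) K (s (r n)) (t (r n))) \<longlonglongrightarrow> system_sum h K s' t'"
    unfolding system_sum_def
  proof (intro tendsto_sum tendsto_mult tendsto_const tendsto_rabs tendsto_diff)
    fix k assume k: "k \<in> K"
    have "t n k \<in> {a..b}" "s n k \<in> {a..b}" for n using st[OF k, of n] by auto
    then show "(\<lambda>n. H (r n) (t (r n) k)) \<longlonglongrightarrow> h (t' k)" "(\<lambda>n. H (r n) (s (r n) k)) \<longlonglongrightarrow> h (s' k)"
      using k by (auto intro!: lim sl tl)
  qed
  then show ?thesis using that r W by blast
qed

text \<open>Up to an error that tends to 0 only indices below \<open>N\<close> count. This leaves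
  finitely many index sets for the pigeonhole argument behind upper semicontinuity.\<close>

lemma system_sum_truncate:
  assumes W: "weakly_separated_system a b h K s t j"
  shows "system_sum h K s t \<le> system_sum h (K \<inter> {..<N}) s t + 2 * (1/2)^N"
proof -
  have fin: "finite K" using W by (simp add: weakly_separated_system_def)
  have "system_sum h K s t = system_sum h (K \<inter> {..<N}) s t + system_sum h (K - {..<N}) s t"
    unfolding system_sum_def using fin
    by (subst sum.union_disjoint[symmetric]) (auto intro!: sum.cong)
  moreover have "system_sum h (K - {..<N}) s t \<le> (\<Sum>k\<in>K - {..<N}. (1/2::real)^k)"
    unfolding system_sum_def
    using weakly_separated_width[OF W] by (intro sum_mono mult_left_le) auto
  moreover have "(\<Sum>k\<in>K - {..<N}. (1/2::real)^k) = (\<Sum>k\<in>(\<lambda>k. k - N) ` (K - {..<N}). (1/2)^(k + N))"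
    by (subst sum.reindex) (auto simp: inj_on_def)
  moreover have "\<dots> = (\<Sum>k\<in>(\<lambda>k. k - N) ` (K - {..<N}). (1/2)^k) * (1/2)^N"
    by (simp add: power_add sum_distrib_right)
  moreover have "\<dots> \<le> 2 * (1/2)^N"
    using fin by (intro mult_right_mono sum_half_power_le) auto
  ultimately show ?thesis by linarith
qed

text \<open>If the bound failed for infinitely many n, there would be near-optimal systems for
  \<open>H n\<close> with index sets in {..<N} and slab numbers in a bounded range. One
  combinatorial type occurs infinitely often, and its limit is a weak system for \<open>h\<close> of
  sum at least \<open>unit_len a b h + e / 2\<close>, which is impossible without integer
  extrema.\<close>

lemma unit_len_upper_semicontinuous:
  assumes g: "no_integer_extremum a b h" and h: "continuous_on {a..b} h"
    and u: "uniform_limit {a..b} H h sequentially" and e: "0 < e"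
  shows "\<forall>\<^sub>F n in sequentially. unit_len a b (H n) < unit_len a b h + e"
proof (rule ccontr)
  assume "\<not> ?thesis"
  then have fr: "\<exists>\<^sub>F n in sequentially. unit_len a b h + e \<le> unit_len a b (H n)"
    by (simp add: frequently_def not_le)
  have "compact (h ` {a..b})" by (rule compact_continuous_image[OF h compact_Icc])
  then obtain c where c: "\<And>r. r \<in> {a..b} \<Longrightarrow> \<bar>h r\<bar> \<le> c"
    using compact_imp_bounded bounded_iff by (metis imageI real_norm_def)
  obtain N where N: "2 * (1/2)^N < e / 2"
  proof -
    have "\<exists>N. (1/2)^N < e / 4" using e by (intro real_arch_pow_inv) auto
    then obtain N where "(1/2)^N < e / 4" by blast
    then show ?thesis by (intro that[of N]) simp
  qed
  \<comment> \<open>A slab number is within 1 of a value of \<open>H n\<close>, which is within 1 of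
    a value of \<open>h\<close>, which is at most \<open>c\<close> in modulus.\<close>
  define B where "B = \<lceil>c\<rceil> + 2"
  have ev1: "\<forall>\<^sub>F n in sequentially. \<forall>x\<in>{a..b}. dist (H n x) (h x) < 1"
    using u[unfolded uniform_limit_iff, rule_format, of 1] by simp
  define Q where "Q = (\<lambda>n K s t j. separated_system a b (H n) K s t j \<and> K \<subseteq> {..<N} \<and>
      unit_len a b h + e / 2 \<le> system_sum (H n) K s t \<and> j \<in> {j. (\<forall>k. (k \<in> {..<N} \<longrightarrow> j k \<in> {-B..B}) \<and> (k \<notin> {..<N} \<longrightarrow> j k = 0))})"
  have "\<exists>\<^sub>F n in sequentially. \<exists>K s t j. Q n K s t j"
    using frequently_eventually_frequently[OF fr ev1]
  proof (rule frequently_elim1)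
    fix n assume "unit_len a b h + e \<le> unit_len a b (H n) \<and> (\<forall>x\<in>{a..b}. dist (H n x) (h x) < 1)"
    then have n: "unit_len a b h + e \<le> unit_len a b (H n)" "\<forall>x\<in>{a..b}. dist (H n x) (h x) < 1"
      by auto
    have "unit_len a b h + e / 2 + 2 * (1/2)^N < unit_len a b (H n)" using n(1) N by linarith
    then obtain K s t j where S: "separated_system a b (H n) K s t j"
      "unit_len a b h + e / 2 + 2 * (1/2)^N < system_sum (H n) K s t"
      by (rule less_unit_len_ex)
    define K' where "K' = K \<inter> {..<N}"
    \<comment> \<open>Fixing \<open>j\<close> to be 0 off \<open>K'\<close> leaves only finitely
      many candidates.\<close>
    define j' where "j' = (\<lambda>k. if k \<in> K' then j k else 0)"
    have S': "separated_system a b (H n) K' s t j'"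
      using separated_system_subset[OF S(1), of K'] unfolding K'_def j'_def separated_system_def by simp
    have B: "j k \<in> {-B..B}" if k: "k \<in> K'" for k
    proof -
      have st: "a \<le> s k" "s k \<le> t k" "t k \<le> b" "of_int (j k) < H n (s k)" "H n (s k) < of_int (j k) + 1"
        using S(1) k by (auto simp: separated_system_def K'_def)
      then have "dist (H n (s k)) (h (s k)) < 1" "\<bar>h (s k)\<bar> \<le> c" using n(2) c by auto
      then have "\<bar>of_int (j k)\<bar> < c + 2" using st by (auto simp: dist_real_def)
      then show ?thesis unfolding B_def by auto linarith+
    qed
    have "0 \<le> c" if "k \<in> K'" for k
    proof -
      have "s k \<in> {a..b}" using S(1) that by (auto simp: separated_system_def K'_def)
      from c[OF this] show ?thesis by linarith
    qed
    \<comment> \<open>For empty {a..b} the bound \<open>c\<close> may be negative. A nonempty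
      \<open>K'\<close> supplies a point of {a..b}, so that the default value 0 of \<open>j'\<close>
      lies in {-B..B}.\<close>
    then have B0: "K' = {} \<or> 0 \<le> B" unfolding B_def by fastforce
    have ne: "K' \<noteq> {}"
    proof
      assume "K' = {}"
      then have "system_sum (H n) K s t \<le> 2 * (1/2)^N"
        using system_sum_truncate[OF separated_imp_weakly_separated[OF S(1)], of N]
        by (simp add: system_sum_def K'_def)
      then show False using S(2) unit_len_nonneg[of a b h] e by linarith
    qed
    have "Q n K' s t j'"
      unfolding Q_def
    proof (intro conjI S')
      show "K' \<subseteq> {..<N}" by (auto simp: K'_def)
      show "unit_len a b h + e / 2 \<le> system_sum (H n) K' s t"
        using system_sum_truncate[OF separated_imp_weakly_separated[OF S(1)], of N] S(2) unfolding K'_def by linarith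
      show "j' \<in> {j. \<forall>k. (k \<in> {..<N} \<longrightarrow> j k \<in> {-B..B}) \<and> (k \<notin> {..<N} \<longrightarrow> j k = 0)}"
        using B B0 ne by (auto simp: j'_def K'_def)
    qed
    then show "\<exists>K s t j. Q n K s t j" by blast
  qed
  then have inf: "infinite {n. \<exists>K s t j. Q n K s t j}" (is "infinite ?A")
    by (simp add: frequently_cofinite[symmetric] cofinite_eq_sequentially)
  have "\<forall>n\<in>?A. \<exists>K s t j. Q n K s t j" by simp
  then have "\<exists>K s t j. \<forall>n\<in>?A. Q n (K n) (s n) (t n) (j n)" unfolding bchoice_iff .
  then obtain K s t j where Q: "\<And>n. n \<in> ?A \<Longrightarrow> Q n (K n) (s n) (t n) (j n)" by blast
  have "(\<lambda>n. (K n, j n)) ` ?A \<subseteq> Pow {..<N} \<times> {j. \<forall>k. (k \<in> {..<N} \<longrightarrow> j k \<in> {-B..B}) \<and> (k \<notin> {..<N} \<longrightarrow> j k = 0)}"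
  proof (rule image_subsetI)
    fix n assume "n \<in> ?A"
    from Q[OF this] show "(K n, j n) \<in> Pow {..<N} \<times> {j. \<forall>k. (k \<in> {..<N} \<longrightarrow> j k \<in> {-B..B}) \<and> (k \<notin> {..<N} \<longrightarrow> j k = 0)}"
      unfolding Q_def by blast
  qed
  moreover have "finite {j :: nat \<Rightarrow> int. \<forall>k. (k \<in> {..<N} \<longrightarrow> j k \<in> {-B..B}) \<and> (k \<notin> {..<N} \<longrightarrow> j k = 0)}"
    by (rule finite_set_of_finite_funs) auto
  ultimately have "finite ((\<lambda>n. (K n, j n)) ` ?A)"
    using finite_subset[OF _ finite_cartesian_product[OF iffD2[OF finite_Pow_iff finite_lessThan]]] by auto
  from pigeonhole_infinite[OF inf this] obtain n0 where n0: "n0 \<in> ?A"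
    "infinite {n\<in>?A. (K n, j n) = (K n0, j n0)}" by blast
  obtain r0 where r0: "strict_mono (r0 :: nat \<Rightarrow> nat)" "\<And>i. r0 i \<in> {n\<in>?A. (K n, j n) = (K n0, j n0)}"
    using infinite_enumerate[OF n0(2)] by blast
  have S: "separated_system a b (H (r0 i)) (K n0) (s (r0 i)) (t (r0 i)) (j n0)"
    and U: "unit_len a b h + e / 2 \<le> system_sum (H (r0 i)) (K n0) (s (r0 i)) (t (r0 i))" for i
    using Q[of "r0 i"] r0(2)[of i] unfolding Q_def by auto
  obtain r s' t' where r: "strict_mono (r :: nat \<Rightarrow> nat)" "weakly_separated_system a b h (K n0) s' t' (j n0)"
    "(\<lambda>n. system_sum (H (r0 (r n))) (K n0) (s (r0 (r n))) (t (r0 (r n)))) \<longlonglongrightarrow> system_sum h (K n0) s' t'"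
    using separated_system_limit[OF h uniform_limit_subseq[OF u r0(1)], of "K n0" "\<lambda>i. s (r0 i)" "\<lambda>i. t (r0 i)" "j n0"] S
    by blast
  have "unit_len a b h + e / 2 \<le> system_sum h (K n0) s' t'"
    by (rule LIMSEQ_le_const[OF r(3)]) (use U in auto)
  also have "\<dots> \<le> unit_len a b h" by (rule weakly_separated_sum_le_unit_len[OF g h r(2)])
  finally show False using e by simp
qed

lemma unit_len_tendsto:
  assumes g: "no_integer_extremum a b h" and h: "continuous_on {a..b} h"
    and u: "uniform_limit {a..b} H h sequentially"
  shows "(\<lambda>n. unit_len a b (H n)) \<longlonglongrightarrow> unit_len a b h"
proof (rule order_tendstoI)
  fix c assume "c < unit_len a b h"
  from unit_len_lower_semicontinuous[OF this h] obtain \<delta>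
    where \<delta>: "\<delta> > 0" "\<And>h'. (\<And>r. r \<in> {a..b} \<Longrightarrow> \<bar>h' r - h r\<bar> < \<delta>) \<Longrightarrow> c < unit_len a b h'" by blast
  have "\<forall>\<^sub>F n in sequentially. \<forall>x\<in>{a..b}. dist (H n x) (h x) < \<delta>"
    using u \<delta>(1) by (simp add: uniform_limit_iff)
  then show "\<forall>\<^sub>F n in sequentially. c < unit_len a b (H n)"
    by eventually_elim (auto intro!: \<delta>(2) simp: dist_real_def)
next
  fix c assume "unit_len a b h < c"
  then show "\<forall>\<^sub>F n in sequentially. unit_len a b (H n) < c"
    using unit_len_upper_semicontinuous[OF g h u, of "c - unit_len a b h"] by simp
qed

section \<open>Crossing a whole slab\<close>

lemma crossing_interval:
  fixes h :: "real \<Rightarrow> real"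
  assumes h: "continuous_on {p..q} h" and "p \<le> q" "h p \<le> A" "A < B" "B \<le> h q"
  obtains s t where "p \<le> s" "s < t" "t \<le> q" "h s = A" "h t = B" "\<And>r. s \<le> r \<Longrightarrow> r \<le> t \<Longrightarrow> A \<le> h r \<and> h r \<le> B"
proof -
  \<comment> \<open>\<open>t\<close> will be the first time at level \<open>B\<close>, and
    \<open>s\<close> the last time before it at level \<open>A\<close>, so that no value in between
    can leave [A, B].\<close>
  let ?T = "{r\<in>{p..q}. h r = B}"
  have "compact ?T"
    using continuous_closed_preimage[OF h closed_atLeastAtMost, of "{B}"]
    by (auto simp: compact_eq_bounded_closed vimage_def Int_def intro: bounded_subset[OF bounded_closed_interval])
  moreover have "?T \<noteq> {}" using IVT'[of h p B q] assms by auto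
  ultimately have "\<exists>t\<in>?T. \<forall>r\<in>?T. t \<le> r" by (rule compact_attains_inf)
  then obtain t where t: "t \<in> ?T" "\<And>r. r \<in> ?T \<Longrightarrow> t \<le> r" by blast
  let ?S = "{r\<in>{p..t}. h r = A}"
  have c: "continuous_on {p..t} h" by (rule continuous_on_subset[OF h]) (use t in auto)
  have "compact ?S"
    using continuous_closed_preimage[OF c closed_atLeastAtMost, of "{A}"]
    by (auto simp: compact_eq_bounded_closed vimage_def Int_def intro: bounded_subset[OF bounded_closed_interval])
  moreover have "?S \<noteq> {}" using IVT'[of h p A t] assms t c by auto
  ultimately have "\<exists>s\<in>?S. \<forall>r\<in>?S. r \<le> s" by (rule compact_attains_sup)
  then obtain s where s: "s \<in> ?S" "\<And>r. r \<in> ?S \<Longrightarrow> r \<le> s" by blast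
  show ?thesis
  proof (rule that[of s t])
    show "p \<le> s" "t \<le> q" "h s = A" "h t = B" using s t by auto
    have "s \<noteq> t" using s t assms by auto
    then show "s < t" using s by auto
    fix r assume r: "s \<le> r" "r \<le> t"
    have "A \<le> h r"
    proof (rule ccontr)
      assume "\<not> A \<le> h r"
      moreover have "continuous_on {r..t} h" by (rule continuous_on_subset[OF c]) (use s r in auto)
      ultimately obtain z where "r \<le> z" "z \<le> t" "h z = A" using IVT'[of h r A t] t assms r by auto
      then have "z \<le> s" using s r by auto
      then have "z = s" "r = s" using r \<open>r \<le> z\<close> by auto
      then show False using \<open>\<not> A \<le> h r\<close> s by auto
    qed
    moreover have "h r \<le> B"
    proof (rule ccontr)
      assume "\<not> h r \<le> B"
      moreover have "continuous_on {s..r} h" by (rule continuous_on_subset[OF c]) (use s r in auto)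
      ultimately obtain z where "s \<le> z" "z \<le> r" "h z = B" using IVT'[of h s B r] s assms r by auto
      then have "t \<le> z" using s r t by auto
      then have "z = r" using r \<open>z \<le> r\<close> by auto
      then show False using \<open>\<not> h r \<le> B\<close> \<open>h z = B\<close> by auto
    qed
    ultimately show "A \<le> h r \<and> h r \<le> B" by blast
  qed
qed

lemma crossing_interval_either:
  fixes h :: "real \<Rightarrow> real"
  assumes h: "continuous_on {p..q} h" and pq: "p \<le> q" and AB: "A < B"
    and cr: "h p \<le> A \<and> B \<le> h q \<or> h q \<le> A \<and> B \<le> h p"
  obtains s t where "p \<le> s" "s < t" "t \<le> q" "\<bar>h t - h s\<bar> = B - A" "\<And>r. s \<le> r \<Longrightarrow> r \<le> t \<Longrightarrow> A \<le> h r \<and> h r \<le> B"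
  using cr
proof (elim disjE conjE)
  assume "h p \<le> A" "B \<le> h q"
  from crossing_interval[OF h pq this(1) AB this(2)] show ?thesis using that AB by (metis abs_of_nonneg diff_ge_0_iff_ge less_imp_le)
next
  assume 1: "h q \<le> A" "B \<le> h p"
  obtain s t where st: "p \<le> s" "s < t" "t \<le> q" "- h s = -B" "- h t = -A" "\<And>r. s \<le> r \<Longrightarrow> r \<le> t \<Longrightarrow> -B \<le> - h r \<and> - h r \<le> -A"
    using crossing_interval[of p q "\<lambda>r. - h r" "-B" "-A"] h pq AB 1 by (auto intro: continuous_intros)
  show ?thesis by (rule that[OF st(1-3)]) (use st AB in \<open>force+\<close>)
qed

text \<open>The crossing contributes a component of the maximal width 1, which moves every
  component inside \<open>{a..c}\<close> at most one place down in the enumeration.\<close>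

lemma unit_len_crossing:
  assumes h: "continuous_on {a..b} h" and ac: "a \<le> c" and pq: "c \<le> p" "p \<le> q" "q \<le> b"
    and cr: "h p \<le> of_int i \<and> of_int i + 1 \<le> h q \<or> h q \<le> of_int i \<and> of_int i + 1 \<le> h p"
    and hc: "h c \<notin> {of_int i..of_int i + 1}"
  shows "1 + unit_len a c h / 2 \<le> unit_len a b h"
proof -
  have main: "1 - 2 * e + system_sum h K s t / 2 \<le> unit_len a b h"
    if S: "separated_system a c h K s t j" and e: "0 < e" "e < 1/2" for e K s t j
  proof -
    \<comment> \<open>The margin \<open>e\<close> puts the crossing strictly inside the open slab,
      as a system requires. It costs 2e of the width 1 and is removed at the end.\<close>
    have cr': "h p \<le> of_int i + e \<and> of_int i + 1 - e \<le> h q \<or> h q \<le> of_int i + e \<and> of_int i + 1 - e \<le> h p"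
      using cr e by auto
    have "continuous_on {p..q} h" by (rule continuous_on_subset[OF h]) (use ac pq in auto)
    from crossing_interval_either[OF this pq(2) _ cr'] e obtain s0 t0
      where st0: "p \<le> s0" "s0 < t0" "t0 \<le> q" "\<bar>h t0 - h s0\<bar> = of_int i + 1 - e - (of_int i + e)"
        "\<And>r. s0 \<le> r \<Longrightarrow> r \<le> t0 \<Longrightarrow> of_int i + e \<le> h r \<and> h r \<le> of_int i + 1 - e" by auto
    \<comment> \<open>The crossing takes index 0 with weight 1; all other indices move up by one,
      which halves their sum.\<close>
    define K' s' t' j' where "K' = insert 0 (Suc ` K)" and "s' = case_nat s0 s" and "t' = case_nat t0 t" and "j' = case_nat i j"
    have fin: "finite K" using S by (simp add: separated_system_def)
    have st: "a \<le> s k" "s k \<le> t k" "t k \<le> c" if "k \<in> K" for k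
      using S that by (auto simp: separated_system_def)
    have op: "of_int (j k) < h r" "h r < of_int (j k) + 1" if "k \<in> K" "s k \<le> r" "r \<le> t k" for k r
      using S that by (auto simp: separated_system_def)
    have "separated_system a b h K' s' t' j'"
      unfolding separated_system_def
    proof (intro conjI ballI impI)
      show "finite K'" using fin by (simp add: K'_def)
      fix k assume k: "k \<in> K'"
      show "a \<le> s' k" "s' k \<le> t' k" "t' k \<le> b"
        using k st st0 ac pq by (fastforce simp: K'_def s'_def t'_def)+
      show "of_int (j' k) < h r" "h r < of_int (j' k) + 1" if r: "r \<in> {s' k..t' k}" for r
        using k r op st0(5)[of r] e by (auto simp: K'_def s'_def t'_def j'_def)
      fix l assume l: "l \<in> K'" "k \<noteq> l" "j' k = j' l"
      consider (1) k' l' where "k = Suc k'" "l = Suc l'" "k' \<in> K" "l' \<in> K" | (2) l' where "k = 0" "l = Suc l'" "l' \<in> K" | (3) k' where "l = 0" "k = Suc k'" "k' \<in> K"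
        using k l by (auto simp: K'_def)
      then show "\<exists>r. h r \<notin> {of_int (j' k)..of_int (j' k) + 1} \<and> (t' k \<le> r \<and> r \<le> s' l \<or> t' l \<le> r \<and> r \<le> s' k)"
      proof cases
        case 1
        then show ?thesis using S l(2,3) unfolding separated_system_def by (simp add: s'_def t'_def j'_def)
      next
        case 2
        \<comment> \<open>The point \<open>c\<close> separates: it comes after all old intervals and
          before the crossing, and \<open>h c\<close> is outside the closed slab
          \<open>i\<close>.\<close>
        then show ?thesis using hc st[of l'] st0 pq by (intro exI[of _ c]) (auto simp: s'_def t'_def j'_def)
      next
        case 3
        then show ?thesis using hc st[of k'] st0 pq l(3) by (intro exI[of _ c]) (auto simp: s'_def t'_def j'_def)
      qed
    qed
    from unit_len_upper[OF this] have "system_sum h K' s' t' \<le> unit_len a b h" .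
    moreover have "system_sum h K' s' t' = 1 - 2 * e + system_sum h K s t / 2"
      unfolding system_sum_def K'_def using fin st0(4)
      by (simp add: s'_def t'_def sum.reindex o_def sum_divide_distrib)
    ultimately show ?thesis by simp
  qed
  have "1 - 2 * e + unit_len a c h / 2 \<le> unit_len a b h" if e: "0 < e" "e < 1/2" for e
  proof -
    have "unit_len a c h \<le> 2 * (unit_len a b h - 1 + 2 * e)"
      by (rule unit_len_least) (use main[OF _ e] in force)
    then show ?thesis by simp
  qed
  then have 1: "1 + unit_len a c h / 2 \<le> unit_len a b h + 2 * e" if "0 < e" "e < 1/2" for e
    using that by force
  show ?thesis
  proof (rule field_le_epsilon)
    fix e :: real assume "0 < e"
    define d where "d = min (e/2) (1/4)"
    have "0 < d" "d < 1/2" "2 * d \<le> e" using \<open>0 < e\<close> by (auto simp: d_def)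
    then show "1 + unit_len a c h / 2 \<le> unit_len a b h + e"
      using 1[of d] by linarith
  qed
qed

text \<open>The crossing gives at least 1 + L/2 with L = \<open>unit_len a c h\<close>, and this
  exceeds L precisely because L < 2.\<close>

lemma unit_len_strict_mono:
  assumes h: "continuous_on {a..b} h" and ac: "a \<le> c" and pq: "c \<le> p" "p \<le> q" "q \<le> b"
    and cr: "h p \<le> of_int i \<and> of_int i + 1 \<le> h q \<or> h q \<le> of_int i \<and> of_int i + 1 \<le> h p"
    and hc: "h c \<notin> {of_int i..of_int i + 1}"
  shows "unit_len a c h < unit_len a b h"
proof -
  have "continuous_on {a..c} h" by (rule continuous_on_subset[OF h]) (use pq in auto)
  from unit_len_less_2[OF this] unit_len_crossing[OF assms] show ?thesis by linarith
qed

section \<open>Identification with the slab sums\<close>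

text \<open>Induction on the largest element, which is at least the number of elements below it and
  so has a value no larger than \<open>f\<close> at that number.\<close>

lemma sum_decseq_le_initial:
  fixes f :: "nat \<Rightarrow> real"
  assumes f: "decseq f" and "finite A"
  shows "(\<Sum>a\<in>A. f a) \<le> (\<Sum>k<card A. f k)"
  using assms(2)
proof (induction A rule: finite_linorder_max_induct)
  case empty
  then show ?case by simp
next
  case (insert b A)
  have "A \<subseteq> {..<b}" using insert by auto
  then have "card A \<le> b" using card_mono[of "{..<b}" A] by simp
  then have "f b \<le> f (card A)" using f by (simp add: decseq_def)
  moreover have "b \<notin> A" using insert by auto
  ultimately show ?case using insert by simp
qed

text \<open>Abel summation: decreasing weights preserve domination of partial sums.\<close>

lemma sum_half_powers_mono:
  fixes p q :: "nat \<Rightarrow> real"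
  assumes "\<And>m. (\<Sum>k<m. p k) \<le> (\<Sum>k<m. q k)"
  shows "(\<Sum>k<n. (1/2)^k * p k) \<le> (\<Sum>k<n. (1/2)^k * q k)"
proof -
  define D where "D = (\<lambda>m. \<Sum>k<m. q k - p k)"
  have D: "0 \<le> D m" for m using assms[of m] by (simp add: D_def sum_subtractf)
  \<comment> \<open>The factor (1/2)^k / 2 is the difference of two consecutive weights.\<close>
  have "(\<Sum>k<n. (1/2)^k * (q k - p k)) = (\<Sum>k<n. (1/2)^k / 2 * D (Suc k)) + (1/2)^n * D n"
    by (induction n) (auto simp: D_def algebra_simps)
  also have "\<dots> \<ge> 0" using D by (intro add_nonneg_nonneg sum_nonneg mult_nonneg_nonneg) auto
  finally show ?thesis by (simp add: right_diff_distrib sum_subtractf)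
qed

text \<open>The terms on the left with index below \<open>m\<close> are values of \<open>f\<close>
  at no more than \<open>m\<close> distinct places, so the sum of those values is at most that of
  the \<open>m\<close> largest ones. Abel summation then brings in the weights.\<close>

lemma weighted_rearrangement:
  fixes f :: "nat \<Rightarrow> real"
  assumes f: "decseq f" "\<And>k. 0 \<le> f k" and K: "finite K" "inj_on \<sigma> K" "K \<subseteq> {..<n}"
  shows "(\<Sum>k\<in>K. (1/2)^k * f (\<sigma> k)) \<le> (\<Sum>k<n. (1/2)^k * f k)"
proof -
  define p where "p = (\<lambda>k. if k \<in> K then f (\<sigma> k) else 0)"
  have "(\<Sum>k\<in>K. (1/2)^k * f (\<sigma> k)) = (\<Sum>k<n. (1/2)^k * p k)"
    using K by (intro sum.mono_neutral_cong_left) (auto simp: p_def)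
  also have "\<dots> \<le> (\<Sum>k<n. (1/2)^k * f k)"
  proof (rule sum_half_powers_mono)
    fix m
    let ?A = "K \<inter> {..<m}"
    have fin: "finite ?A" using K by auto
    have "(\<Sum>k<m. p k) = (\<Sum>k\<in>?A. f (\<sigma> k))"
      by (intro sum.mono_neutral_cong_right) (auto simp: p_def)
    also have "\<dots> = (\<Sum>a\<in>\<sigma> ` ?A. f a)"
      using K by (subst sum.reindex) (auto intro: inj_on_subset)
    also have "\<dots> \<le> (\<Sum>k<card (\<sigma> ` ?A). f k)" using fin by (intro sum_decseq_le_initial f) auto
    also have "\<dots> \<le> (\<Sum>k<m. f k)"
    proof (rule sum_mono2)
      have "card (\<sigma> ` ?A) \<le> card ?A" by (rule card_image_le[OF fin])
      also have "\<dots> \<le> m" using card_mono[of "{..<m}" ?A] by simp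
      finally show "{..<card (\<sigma> ` ?A)} \<subseteq> {..<m}" by auto
    qed (use f in auto)
    finally show "(\<Sum>k<m. p k) \<le> (\<Sum>k<m. f k)" .
  qed
  finally show ?thesis .
qed

lemma downward_closed_nat_set:
  assumes "\<And>n. Suc n \<in> R \<Longrightarrow> n \<in> R"
  obtains N where "R = {k. enat k < N}"
proof (cases "R = UNIV")
  case True
  then show ?thesis using that[of \<infinity>] by simp
next
  case False
  then have ex: "\<exists>k. k \<notin> R" by auto
  define n where "n = (LEAST k. k \<notin> R)"
  have n: "n \<notin> R" using LeastI_ex[OF ex] by (simp add: n_def)
  have up: "k \<notin> R" if "n \<le> k" for k using that
    by (induction k rule: dec_induct) (use n assms in auto)
  have "k \<in> R" if "k < n" for k using not_less_Least that by (auto simp: n_def)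
  with up have "k \<in> R \<longleftrightarrow> k < n" for k by (cases "k < n") auto
  then have "R = {k. enat k < enat n}" by auto
  then show ?thesis using that by blast
qed

text \<open>Finiteness above each positive level makes \<open>D\<close> countable, and an injection
  into the naturals breaks ties. Each element then has finitely many predecessors, and their number
  is its position in the list.\<close>

lemma decreasing_enum_exists:
  fixes w :: "'b \<Rightarrow> real"
  assumes pos: "\<And>C. C \<in> D \<Longrightarrow> 0 < w C" and fin: "\<And>e. 0 < e \<Longrightarrow> finite {C\<in>D. e \<le> w C}"
  obtains N c where "decreasing_enum w D N c"
proof -
  have "D \<subseteq> (\<Union>n. {C\<in>D. 1 / real (Suc n) \<le> w C})"
  proof
    fix C assume C: "C \<in> D"
    obtain n where "inverse (real (Suc n)) < w C" using reals_Archimedean[OF pos[OF C]] by blast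
    then show "C \<in> (\<Union>n. {C\<in>D. 1 / real (Suc n) \<le> w C})" using C by (auto simp: inverse_eq_divide intro!: exI[of _ n])
  qed
  moreover have "countable (\<Union>n. {C\<in>D. 1 / real (Suc n) \<le> w C})"
    by (intro countable_UN countableI_type countable_finite fin) auto
  ultimately have "countable D" using countable_subset by blast
  then obtain e :: "'b \<Rightarrow> nat" where e: "inj_on e D" by (auto simp: countable_def)
  define before where "before = (\<lambda>C' C. w C < w C' \<or> w C' = w C \<and> e C' < e C)"
  have tot: "before C C' \<or> before C' C" if "C \<in> D" "C' \<in> D" "C \<noteq> C'" for C C'
    using that e by (auto simp: before_def inj_on_def) (metis linorder_neqE_nat not_less_iff_gr_or_eq)
  have tr: "before C C''" if "before C C'" "before C' C''" for C C' C''
    using that by (auto simp: before_def)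
  have irr: "\<not> before C C" for C by (simp add: before_def)
  define P where "P = (\<lambda>C. {C'\<in>D. before C' C})"
  have finP: "finite (P C)" if "C \<in> D" for C
    by (rule finite_subset[OF _ fin[OF pos[OF that]]]) (auto simp: P_def before_def)
  define rank where "rank = (\<lambda>C. card (P C))"
  have less: "rank C' < rank C" if "C' \<in> D" "C \<in> D" "before C' C" for C' C
  proof -
    have "P C' \<subseteq> P C" using that tr by (auto simp: P_def)
    moreover have "C' \<in> P C" "C' \<notin> P C'" using that irr by (auto simp: P_def)
    ultimately show ?thesis unfolding rank_def by (intro psubset_card_mono finP that) auto
  qed
  have bef: "before C' C" if "C' \<in> D" "C \<in> D" "rank C' < rank C" for C' C
    using tot[OF that(1,2)] less[OF that(2,1)] that(3) by fastforce
  have inj: "inj_on rank D"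
    by (rule inj_onI) (metis less tot less_irrefl)
  \<comment> \<open>The predecessor of largest rank is the immediate one, so no rank is
    skipped.\<close>
  have down: "n \<in> rank ` D" if "Suc n \<in> rank ` D" for n
  proof -
    obtain C where C: "C \<in> D" "rank C = Suc n" using \<open>Suc n \<in> rank ` D\<close> by auto
    have f: "finite (P C)" by (rule finP[OF C(1)])
    have "P C \<noteq> {}" using C by (auto simp: rank_def)
    have "Max (rank ` P C) \<in> rank ` P C" using f \<open>P C \<noteq> {}\<close> by (intro Max_in) auto
    then obtain C' where C': "C' \<in> P C" "rank C' = Max (rank ` P C)" by auto
    have mx: "rank C'' \<le> rank C'" if "C'' \<in> P C" for C''
      using f that by (simp add: C'(2))
    have C'D: "C' \<in> D" "before C' C" using C' by (auto simp: P_def)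
    have "P C = insert C' (P C')"
    proof
      show "insert C' (P C') \<subseteq> P C" using C'D tr by (auto simp: P_def)
      show "P C \<subseteq> insert C' (P C')"
      proof
        fix C'' assume C'': "C'' \<in> P C"
        then have "C'' \<in> D" by (simp add: P_def)
        show "C'' \<in> insert C' (P C')"
        proof (rule ccontr)
          assume "\<not> ?thesis"
          then have "before C' C''" using tot[OF \<open>C'' \<in> D\<close> C'D(1)] \<open>C'' \<in> D\<close> by (auto simp: P_def)
          then show False using less[OF C'D(1) \<open>C'' \<in> D\<close>] mx[OF C''] by simp
        qed
      qed
    qed
    moreover have "C' \<notin> P C'" using irr by (simp add: P_def)
    ultimately have "rank C = Suc (rank C')" using finP[OF C'D(1)] by (simp add: rank_def)
    then show ?thesis using C C'D by auto
  qed
  obtain N where N: "rank ` D = {k. enat k < N}" using downward_closed_nat_set[OF down] .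
  define c where "c = inv_into D rank"
  have "bij_betw c {k. enat k < N} D"
    unfolding c_def N[symmetric] by (intro bij_betw_inv_into) (simp add: bij_betw_def inj)
  moreover have "w (c (Suc k)) \<le> w (c k)" if "enat (Suc k) < N" for k
  proof -
    have "Suc k \<in> rank ` D" using that N by auto
    then have "k \<in> rank ` D" by (rule down)
    have "rank (c (Suc k)) = Suc k" "rank (c k) = k" "c (Suc k) \<in> D" "c k \<in> D"
      using \<open>Suc k \<in> rank ` D\<close> \<open>k \<in> rank ` D\<close> unfolding c_def by (simp_all add: f_inv_into_f inv_into_into)
    then have "before (c k) (c (Suc k))" using bef[of "c k" "c (Suc k)"] by simp
    then show ?thesis by (auto simp: before_def)
  qed
  ultimately show ?thesis using that[of N c] unfolding decreasing_enum_def by blast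
qed

text \<open>The second part connects ordered enumerations with systems, which may list intervals in
  any order and leave gaps: the decreasing order gives the largest weighted sum.\<close>

lemma decreasing_enum_sum:
  fixes w :: "'b \<Rightarrow> real"
  assumes c: "decreasing_enum w D N c" and pos: "\<And>C. C \<in> D \<Longrightarrow> 0 < w C"
  defines "f \<equiv> \<lambda>k. if enat k < N then w (c k) else 0"
  shows "summable (\<lambda>k. (1/2)^k * f k)"
    and "finite K \<Longrightarrow> inj_on d K \<Longrightarrow> d ` K \<subseteq> D \<Longrightarrow> (\<Sum>k\<in>K. (1/2)^k * w (d k)) \<le> (\<Sum>k. (1/2)^k * f k)"
proof -
  have bij: "bij_betw c {k. enat k < N} D" and dec: "\<And>k. enat (Suc k) < N \<Longrightarrow> w (c (Suc k)) \<le> w (c k)"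
    using c by (auto simp: decreasing_enum_def)
  have cD: "c k \<in> D" if "enat k < N" for k using bij that by (auto simp: bij_betw_def)
  have f0: "0 \<le> f k" for k using cD pos by (auto simp: f_def less_imp_le)
  have "decseq f"
  proof (rule decseq_SucI)
    fix k show "f (Suc k) \<le> f k"
    proof (cases "enat (Suc k) < N")
      case True
      moreover have "enat k < N" using True by (meson Suc_ile_eq less_imp_le)
      ultimately show ?thesis using dec by (simp add: f_def)
    qed (use f0 in \<open>auto simp: f_def\<close>)
  qed
  have fb: "f k \<le> f 0" for k using \<open>decseq f\<close> by (simp add: decseq_def)
  show sm: "summable (\<lambda>k. (1/2)^k * f k)"
  proof (rule summable_comparison_test)
    show "\<exists>N. \<forall>n\<ge>N. norm ((1/2)^n * f n) \<le> (1/2)^n * f 0"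
      using f0 fb by (auto simp: abs_mult intro!: mult_left_mono)
    show "summable (\<lambda>n. (1/2)^n * f 0)" by (intro summable_mult2 summable_geometric) simp
  qed
  assume K: "finite K" "inj_on d K" "d ` K \<subseteq> D"
  define \<sigma> where "\<sigma> = inv_into {k. enat k < N} c \<circ> d"
  have im: "c ` {k. enat k < N} = D" using bij by (simp add: bij_betw_def)
  have \<sigma>: "c (\<sigma> k) = d k" "enat (\<sigma> k) < N" if "k \<in> K" for k
  proof -
    have "d k \<in> c ` {k. enat k < N}" using K that im by auto
    then show "c (\<sigma> k) = d k" "enat (\<sigma> k) < N"
      using f_inv_into_f[of "d k" c "{k. enat k < N}"] inv_into_into[of "d k" c "{k. enat k < N}"] by (simp_all add: \<sigma>_def)
  qed
  have "inj_on \<sigma> K"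
    by (rule inj_onI) (metis K(2) \<sigma>(1) inj_onD)
  obtain n where n: "K \<subseteq> {..<n}" using K(1) finite_nat_iff_bounded by blast
  have "(\<Sum>k\<in>K. (1/2)^k * w (d k)) = (\<Sum>k\<in>K. (1/2)^k * f (\<sigma> k))"
    using \<sigma> by (intro sum.cong) (auto simp: f_def)
  also have "\<dots> \<le> (\<Sum>k<n. (1/2)^k * f k)"
    by (rule weighted_rearrangement[OF \<open>decseq f\<close> f0 K(1) \<open>inj_on \<sigma> K\<close> n])
  also have "\<dots> \<le> (\<Sum>k. (1/2)^k * f k)"
    using f0 by (intro sum_le_suminf sm) auto
  finally show "(\<Sum>k\<in>K. (1/2)^k * w (d k)) \<le> (\<Sum>k. (1/2)^k * f k)" .
qed

section \<open>Components of slab preimages for a fixed direction\<close>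

locale slab_path =
  fixes a b :: real and \<gamma> :: "real \<Rightarrow> 'a::euclidean_space" and x :: real and u :: 'a and \<mu> :: real
    and h :: "real \<Rightarrow> real"
  assumes \<gamma>: "continuous_on {a..b} \<gamma>" and \<mu>: "0 < \<mu>"
  defines "h \<equiv> \<lambda>t. (\<gamma> t \<bullet> u) / \<mu> - x"
begin

definition strip :: "int \<Rightarrow> real set" where
  "strip j = {t\<in>{a..b}. of_int j \<le> h t \<and> h t \<le> of_int j + 1}"

abbreviation W :: "real set \<Rightarrow> real" where "W C \<equiv> width u (\<gamma> ` C)"

lemma cont_h: "continuous_on {a..b} h"
  unfolding h_def using \<gamma> \<mu> by (intro continuous_intros) auto

lemma slab_eq: "{t\<in>{a..b}. \<gamma> t \<in> slab x u \<mu> j} = strip j"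
  unfolding strip_def slab_def h_def using \<mu> by (auto simp: field_simps)

lemma slab_components_eq: "slab_components a b \<gamma> x u \<mu> = {C. (\<exists>j. C \<in> components (strip j)) \<and> 0 < W C}"
  unfolding slab_components_def slab_eq ..

lemma compact_strip: "compact (strip j)"
proof -
  have "strip j = {a..b} \<inter> h -` {of_int j..of_int j + 1}" by (auto simp: strip_def)
  then have "closed (strip j)" using continuous_closed_preimage[OF cont_h] by auto
  then show ?thesis by (auto simp: compact_eq_bounded_closed strip_def intro: bounded_subset[OF bounded_closed_interval[of a b]])
qed

lemma component:
  assumes "C \<in> components (strip j)"
  shows "compact C" "C \<noteq> {}" "C \<subseteq> {a..b}" "\<And>t. t \<in> C \<Longrightarrow> of_int j \<le> h t \<and> h t \<le> of_int j + 1"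
    "\<And>p q r. p \<in> C \<Longrightarrow> q \<in> C \<Longrightarrow> p \<le> r \<Longrightarrow> r \<le> q \<Longrightarrow> r \<in> C"
proof -
  show "compact C" using compact_components[OF compact_strip assms] .
  show "C \<noteq> {}" using in_components_nonempty[OF assms] .
  have sub: "C \<subseteq> strip j" using in_components_subset[OF assms] .
  show "C \<subseteq> {a..b}" "\<And>t. t \<in> C \<Longrightarrow> of_int j \<le> h t \<and> h t \<le> of_int j + 1" using sub by (auto simp: strip_def)
  have "connected C" using in_components_connected[OF assms] .
  then show "\<And>p q r. p \<in> C \<Longrightarrow> q \<in> C \<Longrightarrow> p \<le> r \<Longrightarrow> r \<le> q \<Longrightarrow> r \<in> C"
    unfolding connected_iff_interval by blast
qed

lemma inner_diff_eq: "\<gamma> q \<bullet> u - \<gamma> p \<bullet> u = \<mu> * (h q - h p)"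
  unfolding h_def using \<mu> by (simp add: field_simps)

lemma width_ge:
  assumes C: "C \<in> components (strip j)" and "p \<in> C" "q \<in> C"
  shows "\<mu> * \<bar>h q - h p\<bar> \<le> W C"
proof -
  have "compact ((\<lambda>z. z \<bullet> u) ` \<gamma> ` C)"
    using component(1,3)[OF C] \<gamma> by (intro compact_continuous_image continuous_intros) (auto intro: continuous_on_subset)
  then have "bounded ((\<lambda>z. z \<bullet> u) ` \<gamma> ` C)" by (rule compact_imp_bounded)
  then have "dist (\<gamma> q \<bullet> u) (\<gamma> p \<bullet> u) \<le> diameter ((\<lambda>z. z \<bullet> u) ` \<gamma> ` C)"
    using assms by (intro diameter_bounded_bound) auto
  then show ?thesis using \<mu> by (simp add: width_def dist_real_def inner_diff_eq abs_mult)
qed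

lemma width_attained:
  assumes C: "C \<in> components (strip j)"
  obtains p q where "p \<in> C" "q \<in> C" "p \<le> q" "W C = \<mu> * \<bar>h q - h p\<bar>"
proof -
  have "compact ((\<lambda>z. z \<bullet> u) ` \<gamma> ` C)"
    using component(1,3)[OF C] \<gamma> by (intro compact_continuous_image continuous_intros) (auto intro: continuous_on_subset)
  then have "\<exists>x\<in>(\<lambda>z. z \<bullet> u) ` \<gamma> ` C. \<exists>y\<in>(\<lambda>z. z \<bullet> u) ` \<gamma> ` C. dist x y = diameter ((\<lambda>z. z \<bullet> u) ` \<gamma> ` C)"
    using component(2)[OF C] by (intro diameter_compact_attained) auto
  then obtain p q where pq: "p \<in> C" "q \<in> C" "dist (\<gamma> p \<bullet> u) (\<gamma> q \<bullet> u) = W C"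
    by (auto simp: width_def)
  then have "W C = \<mu> * \<bar>h p - h q\<bar>" using \<mu> by (simp add: dist_real_def inner_diff_eq abs_mult)
  then show ?thesis using that pq by (metis abs_minus_commute nle_le)
qed

text \<open>By uniform continuity a component of width at least \<open>e\<close> contains an
  interval of a fixed length. Components of one strip are disjoint, and \<open>h\<close> is bounded,
  so only finitely many strips occur.\<close>

lemma finite_wide_components:
  assumes e: "0 < e"
  shows "finite {C. (\<exists>j. C \<in> components (strip j)) \<and> e \<le> W C}"
proof -
  obtain \<delta> where \<delta>: "0 < \<delta>" "\<And>p q. a \<le> p \<Longrightarrow> p \<le> q \<Longrightarrow> q \<le> b \<Longrightarrow> e / \<mu> \<le> \<bar>h q - h p\<bar> \<Longrightarrow> p + \<delta> \<le> q"
    using oscillation_length[OF cont_h, of "e / \<mu>"] e \<mu> by auto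
  have "compact (h ` {a..b})" by (rule compact_continuous_image[OF cont_h compact_Icc])
  then obtain c where c: "\<And>r. r \<in> {a..b} \<Longrightarrow> \<bar>h r\<bar> \<le> c"
    using compact_imp_bounded bounded_iff by (metis imageI real_norm_def)
  have fin: "finite {C\<in>components (strip j). e \<le> W C}" for j
  proof (rule ccontr)
    assume "infinite {C\<in>components (strip j). e \<le> W C}"
    then obtain \<C> where \<C>: "\<C> \<subseteq> {C\<in>components (strip j). e \<le> W C}" "finite \<C>" "card \<C> = Suc (nat (\<lfloor>(b - a) / \<delta>\<rfloor> + 1))"
      using infinite_arbitrarily_large by blast
    have "\<forall>C\<in>\<C>. \<exists>p q. p \<in> C \<and> q \<in> C \<and> p + \<delta> \<le> q"
    proof
      fix C assume "C \<in> \<C>"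
      then have C: "C \<in> components (strip j)" "e \<le> W C" using \<C> by auto
      obtain p q where pq: "p \<in> C" "q \<in> C" "p \<le> q" "W C = \<mu> * \<bar>h q - h p\<bar>" using width_attained[OF C(1)] .
      have "e / \<mu> \<le> \<bar>h q - h p\<bar>" using C(2) pq(4) \<mu> by (simp add: field_simps)
      then have "p + \<delta> \<le> q" using pq component(3)[OF C(1)] by (intro \<delta>) auto
      then show "\<exists>p q. p \<in> C \<and> q \<in> C \<and> p + \<delta> \<le> q" using pq by blast
    qed
    then obtain p q where pq: "\<And>C. C \<in> \<C> \<Longrightarrow> p C \<in> C \<and> q C \<in> C \<and> p C + \<delta> \<le> q C" by metis
    have "card \<C> \<le> nat (\<lfloor>(b - a) / \<delta>\<rfloor> + 1)"
    proof (rule card_disjoint_long_intervals[OF \<C>(2) \<delta>(1)])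
      fix C assume C: "C \<in> \<C>"
      then have CS: "C \<in> components (strip j)" using \<C> by auto
      show "a \<le> p C \<and> p C + \<delta> \<le> q C \<and> q C \<le> b" using pq[OF C] component(3)[OF CS] by auto
      fix C' assume C': "C' \<in> \<C>" "C \<noteq> C'"
      then have CS': "C' \<in> components (strip j)" using \<C> by auto
      have "C \<inter> C' = {}" using components_nonoverlap[OF CS CS'] C' by auto
      then show "q C \<le> p C' \<or> q C' \<le> p C"
        using component(5)[OF CS, of "p C" "q C" "p C'"] component(5)[OF CS', of "p C'" "q C'" "p C"]
          pq[OF C] pq[OF C'(1)] by (cases "p C \<le> p C'") auto
    qed
    then show False using \<C>(3) by simp
  qed
  have "{C. (\<exists>j. C \<in> components (strip j)) \<and> e \<le> W C} \<subseteq> (\<Union>j\<in>{- \<lceil>c\<rceil> - 1..\<lceil>c\<rceil>}. {C\<in>components (strip j). e \<le> W C})"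
  proof
    fix C assume "C \<in> {C. (\<exists>j. C \<in> components (strip j)) \<and> e \<le> W C}"
    then obtain j where C: "C \<in> components (strip j)" "e \<le> W C" by auto
    obtain t where t: "t \<in> C" using component(2)[OF C(1)] by auto
    have "\<bar>h t\<bar> \<le> c" using t component(3)[OF C(1)] c by blast
    moreover have "of_int j \<le> h t \<and> h t \<le> of_int j + 1" by (rule component(4)[OF C(1) t])
    ultimately have "j \<in> {- \<lceil>c\<rceil> - 1..\<lceil>c\<rceil>}" unfolding atLeastAtMost_iff by linarith
    then show "C \<in> (\<Union>j\<in>{- \<lceil>c\<rceil> - 1..\<lceil>c\<rceil>}. {C\<in>components (strip j). e \<le> W C})" using C by blast
  qed
  then show ?thesis by (rule finite_subset) (use fin in auto)
qed

text \<open>Every interval of a system lies in a component, which is at least as wide. Different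
  intervals lie in different components, because a component containing two of them would contain a
  separating point outside the slab.\<close>

lemma system_le_enum_sum:
  assumes K: "separated_system a b h K s t j"
    and c: "decreasing_enum W (slab_components a b \<gamma> x u \<mu>) N c"
  shows "\<mu> * system_sum h K s t \<le> (\<Sum>k. (1/2)^k * (if enat k < N then W (c k) else 0))"
proof -
  \<comment> \<open>An interval of width 0 may lie in a component of width 0, which
    \<open>slab_components\<close> omits.\<close>
  define K' where "K' = {k\<in>K. h (s k) \<noteq> h (t k)}"
  have fin: "finite K" "finite K'" using K by (auto simp: separated_system_def K'_def)
  have st: "a \<le> s k" "s k \<le> t k" "t k \<le> b" if "k \<in> K" for k
    using K that by (auto simp: separated_system_def)
  have op: "of_int (j k) < h r" "h r < of_int (j k) + 1" if "k \<in> K" "s k \<le> r" "r \<le> t k" for k r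
    using K that by (auto simp: separated_system_def)
  define d where "d = (\<lambda>k. connected_component_set (strip (j k)) (s k))"
  have sS: "{s k..t k} \<subseteq> strip (j k)" if "k \<in> K" for k
    using st[OF that] op[OF that] by (force simp: strip_def intro: less_imp_le)
  have dC: "d k \<in> components (strip (j k))" if "k \<in> K" for k
    unfolding d_def using sS[OF that] st[OF that] by (intro componentsI) auto
  have std: "{s k..t k} \<subseteq> d k" if "k \<in> K" for k
    unfolding d_def using sS[OF that] st[OF that] by (intro connected_component_maximal) auto
  have wd: "\<mu> * \<bar>h (t k) - h (s k)\<bar> \<le> W (d k)" if "k \<in> K" for k
    using std[OF that] st[OF that] by (intro width_ge[OF dC[OF that]]) auto
  have dD: "d ` K' \<subseteq> slab_components a b \<gamma> x u \<mu>"
  proof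
    fix C assume "C \<in> d ` K'"
    then obtain k where k: "k \<in> K'" "C = d k" by auto
    then have kK: "k \<in> K" "h (t k) \<noteq> h (s k)" by (auto simp: K'_def)
    have "0 < \<mu> * \<bar>h (t k) - h (s k)\<bar>" using \<mu> kK by simp
    then have "0 < W C" using wd[OF kK(1)] k by simp
    then show "C \<in> slab_components a b \<gamma> x u \<mu>" unfolding slab_components_eq using dC[OF kK(1)] k by auto
  qed
  have inj: "inj_on d K'"
  proof (rule inj_onI, rule ccontr)
    fix k l assume kl: "k \<in> K'" "l \<in> K'" "d k = d l" "k \<noteq> l"
    then have k: "k \<in> K" and l: "l \<in> K" by (auto simp: K'_def)
    have "s k \<in> d l" "s l \<in> d k" "t k \<in> d l" "t l \<in> d k" using std[OF k] std[OF l] st[OF k] st[OF l] kl(3) by auto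
    have "of_int (j l) \<le> h (s k)" "h (s k) \<le> of_int (j l) + 1"
      using component(4)[OF dC[OF l] \<open>s k \<in> d l\<close>] by auto
    moreover have "of_int (j k) < h (s k)" "h (s k) < of_int (j k) + 1" using op[OF k, of "s k"] st[OF k] by auto
    \<comment> \<open>\<open>h (s k)\<close> is strictly inside slab \<open>j k\<close>, so no other
      closed slab contains it.\<close>
    ultimately have jj: "j k = j l" by linarith
    then obtain r where r: "h r \<notin> {of_int (j k)..of_int (j k) + 1}" "t k \<le> r \<and> r \<le> s l \<or> t l \<le> r \<and> r \<le> s k"
      using K k l kl(4) unfolding separated_system_def by blast
    have "r \<in> d k" using r(2)
    proof
      assume "t k \<le> r \<and> r \<le> s l"
      then show ?thesis using component(5)[OF dC[OF k], of "t k" "s l" r] \<open>s l \<in> d k\<close> \<open>t k \<in> d l\<close> kl(3) by auto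
    next
      assume "t l \<le> r \<and> r \<le> s k"
      then show ?thesis using component(5)[OF dC[OF k], of "t l" "s k" r] \<open>s k \<in> d l\<close> \<open>t l \<in> d k\<close> kl(3) by auto
    qed
    from component(4)[OF dC[OF k] this] r(1) show False by auto
  qed
  have "\<mu> * system_sum h K s t = (\<Sum>k\<in>K. (1/2)^k * (\<mu> * \<bar>h (t k) - h (s k)\<bar>))"
    by (simp add: system_sum_def sum_distrib_left mult.left_commute)
  also have "\<dots> = (\<Sum>k\<in>K'. (1/2)^k * (\<mu> * \<bar>h (t k) - h (s k)\<bar>))"
    using fin by (intro sum.mono_neutral_right) (auto simp: K'_def)
  also have "\<dots> \<le> (\<Sum>k\<in>K'. (1/2)^k * W (d k))"
    using wd by (intro sum_mono mult_left_mono) (auto simp: K'_def)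
  also have "\<dots> \<le> (\<Sum>k. (1/2)^k * (if enat k < N then W (c k) else 0))"
    by (rule decreasing_enum_sum(2)[OF c _ fin(2) inj dD]) (simp add: slab_components_eq)
  finally show ?thesis .
qed

text \<open>Two points realizing the width of each listed component form a system, but only a weak
  one, since components are parts of closed slabs. This is where integer extrema have to be
  excluded.\<close>

lemma enum_sum_le_unit_len:
  assumes g: "no_integer_extremum a b h"
    and c: "decreasing_enum W (slab_components a b \<gamma> x u \<mu>) N c"
  shows "(\<Sum>k. (1/2)^k * (if enat k < N then W (c k) else 0)) \<le> \<mu> * unit_len a b h"
proof (rule suminf_le_const)
  let ?D = "slab_components a b \<gamma> x u \<mu>"
  show "summable (\<lambda>k. (1/2)^k * (if enat k < N then W (c k) else 0))"
    by (rule decreasing_enum_sum(1)[OF c]) (simp add: slab_components_eq)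
  fix n
  define K where "K = {k. k < n \<and> enat k < N}"
  have cD: "c k \<in> ?D" if "k \<in> K" for k
    using c that by (auto simp: decreasing_enum_def bij_betw_def K_def)
  have "\<forall>k\<in>K. \<exists>p q j. c k \<in> components (strip j) \<and> p \<in> c k \<and> q \<in> c k \<and> p \<le> q \<and> W (c k) = \<mu> * \<bar>h q - h p\<bar>"
  proof
    fix k assume "k \<in> K"
    then obtain j where "c k \<in> components (strip j)" using cD unfolding slab_components_eq by blast
    then show "\<exists>p q j. c k \<in> components (strip j) \<and> p \<in> c k \<and> q \<in> c k \<and> p \<le> q \<and> W (c k) = \<mu> * \<bar>h q - h p\<bar>"
      using width_attained by metis
  qed
  then have "\<exists>p q j. \<forall>k\<in>K. c k \<in> components (strip (j k)) \<and> p k \<in> c k \<and> q k \<in> c k \<and> p k \<le> q k \<and> W (c k) = \<mu> * \<bar>h (q k) - h (p k)\<bar>"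
    unfolding bchoice_iff .
  then obtain p q j where pq: "\<And>k. k \<in> K \<Longrightarrow> c k \<in> components (strip (j k))" "\<And>k. k \<in> K \<Longrightarrow> p k \<in> c k"
    "\<And>k. k \<in> K \<Longrightarrow> q k \<in> c k" "\<And>k. k \<in> K \<Longrightarrow> p k \<le> q k" "\<And>k. k \<in> K \<Longrightarrow> W (c k) = \<mu> * \<bar>h (q k) - h (p k)\<bar>"
    by blast
  have ck: "{p k..q k} \<subseteq> c k" if "k \<in> K" for k
    using component(5)[OF pq(1)[OF that] pq(2)[OF that] pq(3)[OF that]] by auto
  have sep: "\<exists>r. h r \<notin> {of_int (j k)..of_int (j k) + 1} \<and> q k \<le> r \<and> r \<le> p l"
    if k: "k \<in> K" and l: "l \<in> K" and jj: "j k = j l" and dis: "c k \<inter> c l = {}" and ql: "q k \<le> p l" for k l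
  proof (rule ccontr)
    assume no: "\<nexists>r. h r \<notin> {of_int (j k)..of_int (j k) + 1} \<and> q k \<le> r \<and> r \<le> p l"
    have kS: "q k \<in> c k" "c k \<subseteq> {a..b}" "p l \<in> c l" "c l \<subseteq> {a..b}"
      using pq(2,3) component(3)[OF pq(1)] k l by auto
    then have ab: "a \<le> q k" "p l \<le> b" by auto
    \<comment> \<open>A gap that stays in the strip would join the two components, contrary to
      maximality.\<close>
    have "{q k..p l} \<subseteq> strip (j k)"
    proof
      fix r assume r: "r \<in> {q k..p l}"
      then have "h r \<in> {of_int (j k)..of_int (j k) + 1}" using no by auto
      then show "r \<in> strip (j k)" using r ab by (auto simp: strip_def)
    qed
    then have "{q k..p l} \<subseteq> c k"
      using kS ql by (intro components_maximal[OF pq(1)[OF k]]) auto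
    then have "p l \<in> c k" using ql by auto
    then show False using kS dis by auto
  qed
  have "weakly_separated_system a b h K p q j"
    unfolding weakly_separated_system_def
  proof (intro conjI ballI impI)
    show "finite K" by (simp add: K_def)
    fix k assume k: "k \<in> K"
    show "a \<le> p k" "p k \<le> q k" "q k \<le> b"
      using component(3)[OF pq(1)[OF k]] pq(2,3,4)[OF k] by auto
    show "of_int (j k) \<le> h r" "h r \<le> of_int (j k) + 1" if "r \<in> {p k..q k}" for r
      using component(4)[OF pq(1)[OF k]] ck[OF k] that by auto
    fix l assume l: "l \<in> K" "k \<noteq> l" "j k = j l"
    have "inj_on c {k. enat k < N}" using c by (auto simp: decreasing_enum_def bij_betw_def)
    then have "c k \<noteq> c l" using k l by (auto simp: K_def inj_on_def)
    then have dis: "c k \<inter> c l = {}" using components_nonoverlap[OF pq(1)[OF k], of "c l"] pq(1)[OF l(1)] l(3) by auto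
    have "q k \<le> p l \<or> q l \<le> p k"
    proof (rule ccontr)
      assume "\<not> ?thesis"
      then have "max (p k) (p l) \<in> {p k..q k} \<inter> {p l..q l}" using pq(4)[OF k] pq(4)[OF l(1)] by auto
      then show False using ck[OF k] ck[OF l(1)] dis by blast
    qed
    then obtain r where "h r \<notin> {of_int (j k)..of_int (j k) + 1}" "q k \<le> r \<and> r \<le> p l \<or> q l \<le> r \<and> r \<le> p k"
    proof
      assume "q k \<le> p l"
      from sep[OF k l(1) l(3) dis this] show ?thesis using that by blast
    next
      assume "q l \<le> p k"
      from sep[OF l(1) k l(3)[symmetric] _ this] dis show ?thesis using that l(3) by (metis inf_commute)
    qed
    then show "\<exists>r. h r \<notin> {of_int (j k)<..<of_int (j k) + 1} \<and> (q k \<le> r \<and> r \<le> p l \<or> q l \<le> r \<and> r \<le> p k)"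
      by (intro exI[of _ r]) auto
  qed
  from weakly_separated_sum_le_unit_len[OF g cont_h this]
  have le: "system_sum h K p q \<le> unit_len a b h" .
  have "(\<Sum>k<n. (1/2)^k * (if enat k < N then W (c k) else 0)) = (\<Sum>k\<in>K. (1/2)^k * W (c k))"
    by (intro sum.mono_neutral_cong_right) (auto simp: K_def)
  also have "\<dots> = \<mu> * system_sum h K p q"
    unfolding system_sum_def sum_distrib_left by (intro sum.cong) (auto simp: pq(5))
  also have "\<dots> \<le> \<mu> * unit_len a b h" using le \<mu> by (intro mult_left_mono) auto
  finally show "(\<Sum>k<n. (1/2)^k * (if enat k < N then W (c k) else 0)) \<le> \<mu> * unit_len a b h" .
qed

text \<open>Both inequalities hold for every decreasing enumeration, so all of them have the same
  sum; this justifies the definite description in \<open>slab_sum\<close> at such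
  \<open>x\<close>.\<close>

lemma slab_sum_eq:
  assumes g: "no_integer_extremum a b h"
  shows "slab_sum a b \<gamma> x u \<mu> = \<mu> * unit_len a b h"
proof -
  let ?D = "slab_components a b \<gamma> x u \<mu>"
  have eq: "(\<Sum>k. if enat k < N then (1/2)^k * W (c k) else 0) = \<mu> * unit_len a b h"
    if c: "decreasing_enum W ?D N c" for N c
  proof -
    have "(\<Sum>k. if enat k < N then (1/2)^k * W (c k) else 0) = (\<Sum>k. (1/2)^k * (if enat k < N then W (c k) else 0))"
      by (intro arg_cong[where f = suminf] ext) auto
    also have "\<dots> = \<mu> * unit_len a b h"
    proof (rule antisym)
      show "(\<Sum>k. (1/2)^k * (if enat k < N then W (c k) else 0)) \<le> \<mu> * unit_len a b h"
        by (rule enum_sum_le_unit_len[OF g c])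
      have "unit_len a b h \<le> (\<Sum>k. (1/2)^k * (if enat k < N then W (c k) else 0)) / \<mu>"
        using system_le_enum_sum[OF _ c] \<mu> by (intro unit_len_least) (simp add: field_simps)
      then show "\<mu> * unit_len a b h \<le> (\<Sum>k. (1/2)^k * (if enat k < N then W (c k) else 0))"
        using \<mu> by (simp add: field_simps)
    qed
    finally show ?thesis .
  qed
  obtain N c where c: "decreasing_enum W ?D N c"
  proof (rule decreasing_enum_exists[of ?D W])
    show "0 < W C" if "C \<in> ?D" for C using that by (simp add: slab_components_eq)
    show "finite {C \<in> ?D. e \<le> W C}" if "0 < e" for e
      by (rule finite_subset[OF _ finite_wide_components[OF that]]) (auto simp: slab_components_eq)
  qed
  show ?thesis
    unfolding slab_sum_def
  proof (rule the_equality)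
    show "\<exists>N c. decreasing_enum W ?D N c \<and> \<mu> * unit_len a b h = (\<Sum>k. if enat k < N then (1/2)^k * W (c k) else 0)"
      by (intro exI[of _ N] exI[of _ c] conjI c eq[OF c, symmetric])
    show "l = \<mu> * unit_len a b h"
      if "\<exists>N c. decreasing_enum W ?D N c \<and> l = (\<Sum>k. if enat k < N then (1/2)^k * W (c k) else 0)" for l
      using that eq by blast
  qed
qed

end

section \<open>Countability of the exceptional shifts\<close>

lemma countable_local_max_values:
  fixes g :: "real \<Rightarrow> real"
  shows "countable {g r | r. \<exists>e>0. \<forall>q. \<bar>q - r\<bar> < e \<longrightarrow> g q \<le> g r}"
proof -
  \<comment> \<open>A local maximum value is the supremum over a small interval with rational ends,
    and there are countably many of those.\<close>
  let ?F = "\<lambda>(p, q). Sup (g ` {real_of_rat p<..<real_of_rat q})"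
  have "{g r | r. \<exists>e>0. \<forall>q. \<bar>q - r\<bar> < e \<longrightarrow> g q \<le> g r} \<subseteq> range ?F"
  proof
    fix y assume "y \<in> {g r | r. \<exists>e>0. \<forall>q. \<bar>q - r\<bar> < e \<longrightarrow> g q \<le> g r}"
    then obtain r e where r: "y = g r" "e > 0" "\<And>q. \<bar>q - r\<bar> < e \<Longrightarrow> g q \<le> g r" by auto
    obtain p where p: "r - e < of_rat p" "of_rat p < r" using of_rat_dense[of "r - e" r] r by auto
    obtain q where q: "r < of_rat q" "of_rat q < r + e" using of_rat_dense[of r "r + e"] r by auto
    have "Sup (g ` {real_of_rat p<..<real_of_rat q}) = g r"
      by (rule cSup_eq_maximum) (use p q r in auto)
    then show "y \<in> range ?F" using r by (auto intro!: image_eqI[of _ _ "(p, q)"])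
  qed
  then show ?thesis by (rule countable_subset) auto
qed

text \<open>An excluded \<open>x\<close> differs by an integer from a local extreme value of
  \<open>g\<close>; minima are handled as maxima of \<open>- g\<close>.\<close>

lemma countable_integer_extremum:
  fixes g :: "real \<Rightarrow> real"
  shows "countable {x. \<not> no_integer_extremum a b (\<lambda>t. g t - x)}"
proof -
  let ?M = "{g r | r. \<exists>e>0. \<forall>q. \<bar>q - r\<bar> < e \<longrightarrow> g q \<le> g r}"
  let ?m = "{- g r | r. \<exists>e>0. \<forall>q. \<bar>q - r\<bar> < e \<longrightarrow> - g q \<le> - g r}"
  have "{x. \<not> no_integer_extremum a b (\<lambda>t. g t - x)} \<subseteq> (\<lambda>(y, i). y - of_int i) ` (?M \<times> UNIV) \<union> (\<lambda>(y, i). - y - of_int i) ` (?m \<times> UNIV)"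
  proof
    fix x assume "x \<in> {x. \<not> no_integer_extremum a b (\<lambda>t. g t - x)}"
    then obtain r e where r: "0 < e" "g r - x \<in> \<int>"
      "(\<forall>q. \<bar>q - r\<bar> < e \<longrightarrow> g q \<le> g r) \<or> (\<forall>q. \<bar>q - r\<bar> < e \<longrightarrow> g r \<le> g q)"
      unfolding no_integer_extremum_def by auto
    obtain i where i: "g r - x = of_int i" using r(2) by (auto elim: Ints_cases)
    show "x \<in> (\<lambda>(y, i). y - of_int i) ` (?M \<times> UNIV) \<union> (\<lambda>(y, i). - y - of_int i) ` (?m \<times> UNIV)"
      using r(3)
    proof
      assume "\<forall>q. \<bar>q - r\<bar> < e \<longrightarrow> g q \<le> g r"
      then have "g r \<in> ?M" using r(1) by blast
      then have "x \<in> (\<lambda>(y, i). y - of_int i) ` (?M \<times> UNIV)" using i by (intro image_eqI[of _ _ "(g r, i)"]) auto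
      then show ?thesis by blast
    next
      assume "\<forall>q. \<bar>q - r\<bar> < e \<longrightarrow> g r \<le> g q"
      then have "- g r \<in> ?m" using r(1) by auto
      then have "x \<in> (\<lambda>(y, i). - y - of_int i) ` (?m \<times> UNIV)" using i by (intro image_eqI[of _ _ "(- g r, i)"]) auto
      then show ?thesis by blast
    qed
  qed
  moreover have "countable \<dots>"
    by (intro countable_Un countable_image countable_SIGMA countable_local_max_values countableI_type)
  ultimately show ?thesis by (rule countable_subset)
qed

section \<open>Integration over slabs\<close>

text \<open>Cut off at \<open>\<mu> = 1\<close> so that the density is bounded on the whole space.\<close>

definition slab_density :: "real \<Rightarrow> real \<Rightarrow> (real \<Rightarrow> 'a::euclidean_space) \<Rightarrow> real \<times> 'a \<times> real \<Rightarrow> real" where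
  "slab_density a b \<gamma> = (\<lambda>(\<mu>, u, x). if 0 < \<mu> \<and> \<mu> \<le> 1 then \<mu> * unit_len a b (\<lambda>t. (\<gamma> t \<bullet> u) / \<mu> - x) else 0)"

lemma slab_density_nonneg: "0 \<le> slab_density a b \<gamma> p"
  by (auto simp: slab_density_def unit_len_nonneg split: prod.split)

lemma slab_density_le_2: "slab_density a b \<gamma> p \<le> 2"
proof -
  have "\<mu> * unit_len a b h \<le> 1 * 2" if "0 < \<mu>" "\<mu> \<le> 1" for \<mu> h
    using that unit_len_nonneg unit_len_le_2 by (intro mult_mono) auto
  then show ?thesis by (auto simp: slab_density_def split: prod.split)
qed

text \<open>Openness is joint lower semicontinuity in \<mu>, u and x: a small change of the three
  changes the rescaled function uniformly little on the compact interval. It makes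
  \<open>slab_density\<close> measurable.\<close>

lemma open_slab_density_greater:
  fixes \<gamma> :: "real \<Rightarrow> 'a::euclidean_space"
  assumes \<gamma>: "continuous_on {a..b} \<gamma>"
  shows "open {(\<mu>, u, x). 0 < \<mu> \<and> y < \<mu> * unit_len a b (\<lambda>t. (\<gamma> t \<bullet> u) / \<mu> - x)}" (is "open ?S")
proof (subst open_subopen, safe)
  fix \<mu>0 :: real and u0 :: 'a and x0 :: real
  assume \<mu>0: "0 < \<mu>0" and y: "y < \<mu>0 * unit_len a b (\<lambda>t. (\<gamma> t \<bullet> u0) / \<mu>0 - x0)"
  let ?p = "(\<mu>0, u0, x0)"
  have "y / \<mu>0 < unit_len a b (\<lambda>t. (\<gamma> t \<bullet> u0) / \<mu>0 - x0)" using y \<mu>0 by (simp add: field_simps)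
  \<comment> \<open>A level \<open>c\<close> strictly in between leaves room for the variation of
    the factor \<mu>.\<close>
  then obtain c where c: "y / \<mu>0 < c" "c < unit_len a b (\<lambda>t. (\<gamma> t \<bullet> u0) / \<mu>0 - x0)" using dense by blast
  have "continuous_on {a..b} (\<lambda>t. (\<gamma> t \<bullet> u0) / \<mu>0 - x0)" using \<gamma> \<mu>0 by (intro continuous_intros) auto
  from unit_len_lower_semicontinuous[OF c(2) this] obtain \<delta> where \<delta>: "0 < \<delta>"
    "\<And>h'. (\<And>r. r \<in> {a..b} \<Longrightarrow> \<bar>h' r - ((\<gamma> r \<bullet> u0) / \<mu>0 - x0)\<bar> < \<delta>) \<Longrightarrow> c < unit_len a b h'" by blast
  have "compact (\<gamma> ` {a..b})" by (rule compact_continuous_image[OF \<gamma> compact_Icc])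
  then obtain B where B: "\<And>r. r \<in> {a..b} \<Longrightarrow> norm (\<gamma> r) \<le> B"
    using compact_imp_bounded bounded_iff by (metis imageI)
  have id: "((\<lambda>p. p) \<longlongrightarrow> ?p) (nhds ?p)" by (rule filterlim_ident)
  have f: "(fst \<longlongrightarrow> \<mu>0) (nhds ?p)" using tendsto_fst[OF id] by simp
  have s: "((\<lambda>p. fst (snd p)) \<longlongrightarrow> u0) (nhds ?p)" using tendsto_fst[OF tendsto_snd[OF id]] by simp
  have t: "((\<lambda>p. snd (snd p)) \<longlongrightarrow> x0) (nhds ?p)" using tendsto_snd[OF tendsto_snd[OF id]] by simp
  have "((\<lambda>p. \<bar>B\<bar> * norm (fst (snd p) /\<^sub>R fst p - u0 /\<^sub>R \<mu>0) + \<bar>snd (snd p) - x0\<bar>)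
      \<longlongrightarrow> \<bar>B\<bar> * norm (u0 /\<^sub>R \<mu>0 - u0 /\<^sub>R \<mu>0) + \<bar>x0 - x0\<bar>) (nhds ?p)"
    using \<mu>0 by (intro tendsto_intros f s t) auto
  then have e1: "\<forall>\<^sub>F p in nhds ?p. \<bar>B\<bar> * norm (fst (snd p) /\<^sub>R fst p - u0 /\<^sub>R \<mu>0) + \<bar>snd (snd p) - x0\<bar> < \<delta>"
    using \<delta>(1) by (intro order_tendstoD(2)) auto
  have e2: "\<forall>\<^sub>F p in nhds ?p. 0 < fst p" by (rule order_tendstoD(1)[OF f \<mu>0])
  have "((\<lambda>p. c * fst p) \<longlongrightarrow> c * \<mu>0) (nhds ?p)" by (intro tendsto_intros f)
  then have e3: "\<forall>\<^sub>F p in nhds ?p. y < c * fst p"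
    by (rule order_tendstoD(1)) (use c(1) \<mu>0 in \<open>simp add: field_simps\<close>)
  from e1 e2 e3 have "\<forall>\<^sub>F p in nhds ?p. p \<in> ?S"
  proof eventually_elim
    case (elim p)
    obtain \<mu> u x where p: "p = (\<mu>, u, x)" by (cases p)
    have "c < unit_len a b (\<lambda>t. (\<gamma> t \<bullet> u) / \<mu> - x)"
    proof (rule \<delta>(2))
      fix r assume r: "r \<in> {a..b}"
      have "(\<gamma> r \<bullet> u) / \<mu> - x - ((\<gamma> r \<bullet> u0) / \<mu>0 - x0) = \<gamma> r \<bullet> (u /\<^sub>R \<mu> - u0 /\<^sub>R \<mu>0) - (x - x0)"
        by (simp add: inner_diff_right divide_inverse_commute)
      also have "\<bar>\<dots>\<bar> \<le> \<bar>\<gamma> r \<bullet> (u /\<^sub>R \<mu> - u0 /\<^sub>R \<mu>0)\<bar> + \<bar>x - x0\<bar>" by linarith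
      also have "\<bar>\<gamma> r \<bullet> (u /\<^sub>R \<mu> - u0 /\<^sub>R \<mu>0)\<bar> \<le> norm (\<gamma> r) * norm (u /\<^sub>R \<mu> - u0 /\<^sub>R \<mu>0)" by (rule Cauchy_Schwarz_ineq2)
      also have "\<dots> \<le> \<bar>B\<bar> * norm (u /\<^sub>R \<mu> - u0 /\<^sub>R \<mu>0)" using B[OF r] by (intro mult_right_mono) auto
      also have "\<dots> + \<bar>x - x0\<bar> < \<delta>" using elim by (simp add: p)
      finally show "\<bar>(\<gamma> r \<bullet> u) / \<mu> - x - ((\<gamma> r \<bullet> u0) / \<mu>0 - x0)\<bar> < \<delta>" by simp
    qed
    then have "c * \<mu> < \<mu> * unit_len a b (\<lambda>t. (\<gamma> t \<bullet> u) / \<mu> - x)" using elim by (simp add: p mult.commute)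
    moreover have "y < c * \<mu>" "0 < \<mu>" using elim by (simp_all add: p)
    ultimately have "y < \<mu> * unit_len a b (\<lambda>t. (\<gamma> t \<bullet> u) / \<mu> - x)" by linarith
    then show ?case using \<open>0 < \<mu>\<close> by (simp add: p)
  qed
  then obtain T where "open T" "?p \<in> T" "\<forall>p\<in>T. p \<in> ?S" unfolding eventually_nhds by (elim exE conjE)
  then have "T \<subseteq> ?S" by (intro subsetI) (rule bspec)
  with \<open>open T\<close> \<open>?p \<in> T\<close> show "\<exists>T. open T \<and> ?p \<in> T \<and> T \<subseteq> ?S" by (intro exI[of _ T] conjI)
qed

lemma borel_measurable_slab_density:
  fixes \<gamma> :: "real \<Rightarrow> 'a::euclidean_space"
  assumes \<gamma>: "continuous_on {a..b} \<gamma>"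
  shows "slab_density a b \<gamma> \<in> borel_measurable (borel \<Otimes>\<^sub>M (borel \<Otimes>\<^sub>M borel))"
  unfolding borel_prod
proof (rule borel_measurableI_greater)
  fix y :: real
  show "{p \<in> space borel. y < slab_density a b \<gamma> p} \<in> sets borel"
  proof (cases "y < 0")
    case True
    then have "y < slab_density a b \<gamma> p" for p using slab_density_nonneg[of a b \<gamma> p] by simp
    then show ?thesis by simp
  next
    case False
    then have "{p \<in> space borel. y < slab_density a b \<gamma> p} =
        {(\<mu>, u, x). 0 < \<mu> \<and> y < \<mu> * unit_len a b (\<lambda>t. (\<gamma> t \<bullet> u) / \<mu> - x)} \<inter> {p. fst p \<le> 1}"
      by (auto simp: slab_density_def split: if_splits)
    moreover have "closed {p :: real \<times> 'a \<times> real. fst p \<le> 1}"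
      by (intro closed_Collect_le continuous_intros)
    ultimately show ?thesis using open_slab_density_greater[OF \<gamma>, of y] by auto
  qed
qed

text \<open>The nested integrals of \<open>len\<close> for a general integrand, one definition per
  layer, so that limits and inequalities can be carried outward layer by layer.\<close>

definition fibre_integral :: "(real \<times> 'a::euclidean_space \<times> real \<Rightarrow> real) \<Rightarrow> real \<Rightarrow> 'a \<Rightarrow> real" where
  "fibre_integral F \<mu> u = (\<integral>x. indicator {0..1} x * F (\<mu>, u, x) \<partial>lborel)"

definition sphere_integral :: "(real \<times> 'a::euclidean_space \<times> real \<Rightarrow> real) \<Rightarrow> real \<Rightarrow> real" where
  "sphere_integral F \<mu> = (\<integral>u. indicator (sphere 0 1) u * fibre_integral F \<mu> (u::'a::euclidean_space) \<partial>sphere_prob)"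

definition triple_integral :: "(real \<times> 'a::euclidean_space \<times> real \<Rightarrow> real) \<Rightarrow> real" where
  "triple_integral F = (\<integral>\<mu>. indicator {0<..1} \<mu> * sphere_integral F \<mu> \<partial>lborel)"

lemma finite_measure_sphere_prob: "finite_measure (sphere_prob :: 'a::euclidean_space measure)"
  by (rule finite_measureI) (simp add: emeasure_sphere_prob_UNIV)

text \<open>With mass at most 1 the bound \<open>B\<close> is reproduced, so the same lemma serves
  each layer of the triple integral.\<close>

lemma integral_indicator_bounds:
  fixes f :: "'b \<Rightarrow> real"
  assumes A: "A \<in> sets M" "emeasure M A \<le> 1" and f: "\<And>x. 0 \<le> f x" "\<And>x. f x \<le> B"
    and m: "f \<in> borel_measurable M"
  shows "integrable M (\<lambda>x. indicator A x * f x)" "0 \<le> (\<integral>x. indicator A x * f x \<partial>M)"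
    "(\<integral>x. indicator A x * f x \<partial>M) \<le> B"
proof -
  have fin: "emeasure M A < \<infinity>" using A(2) by (rule order.strict_trans1) simp
  have i: "integrable M (\<lambda>x. indicator A x * B)" using A(1) fin by (intro integrable_mult_left) (simp add: integrable_indicator_iff)
  show int: "integrable M (\<lambda>x. indicator A x * f x)"
    by (rule Bochner_Integration.integrable_bound[OF i])
      (use A m f in \<open>auto simp: indicator_def intro!: AE_I2 order_trans[OF _ abs_ge_self]\<close>)
  show "0 \<le> (\<integral>x. indicator A x * f x \<partial>M)" using f by (intro integral_nonneg_AE) (auto simp: indicator_def)
  have "(\<integral>x. indicator A x * f x \<partial>M) \<le> (\<integral>x. indicator A x * B \<partial>M)"
    using f by (intro integral_mono int i) (auto simp: indicator_def)
  also have "\<dots> = measure M A * B" using A by simp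
  also have "\<dots> \<le> 1 * B"
  proof (rule mult_right_mono)
    show "measure M A \<le> 1" using A(2) by (simp add: measure_def enn2real_leI)
    show "0 \<le> B" using f by (meson order_trans)
  qed
  finally show "(\<integral>x. indicator A x * f x \<partial>M) \<le> B" by simp
qed

lemma integral_strict_mono:
  fixes f g :: "'b \<Rightarrow> real"
  assumes f: "integrable M f" and g: "integrable M g" and le: "\<And>x. f x \<le> g x"
    and A: "A \<in> sets M" "emeasure M A \<noteq> 0" "\<And>x. x \<in> A \<Longrightarrow> f x < g x"
  shows "(\<integral>x. f x \<partial>M) < (\<integral>x. g x \<partial>M)"
proof -
  have d: "integrable M (\<lambda>x. g x - f x)" using f g by simp
  have "0 \<le> (\<integral>x. g x - f x \<partial>M)" using le by (intro integral_nonneg_AE) auto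
  moreover have "(\<integral>x. g x - f x \<partial>M) \<noteq> 0"
  proof
    assume "(\<integral>x. g x - f x \<partial>M) = 0"
    then have "AE x in M. g x - f x = 0"
      using integral_nonneg_eq_0_iff_AE[OF d] le by auto
    then have "AE x in M. x \<notin> A" by eventually_elim (use A(3) in force)
    then have "A \<in> null_sets M" using A(1) AE_iff_null_sets by blast
    then show False using A(2) by auto
  qed
  ultimately show ?thesis using f g by simp
qed

context
  fixes F :: "real \<times> 'a::euclidean_space \<times> real \<Rightarrow> real" and B :: real
  assumes m[measurable]: "F \<in> borel_measurable (borel \<Otimes>\<^sub>M (borel \<Otimes>\<^sub>M borel))"
    and F0: "\<And>p. 0 \<le> F p" and FB: "\<And>p. F p \<le> B"
begin

lemma measurable_fibre: "(\<lambda>x. F (\<mu>, u, x)) \<in> borel_measurable lborel"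
  by measurable

lemma fibre_integral_bounds:
  "integrable lborel (\<lambda>x. indicator {0..1} x * F (\<mu>, u, x))" "0 \<le> fibre_integral F \<mu> u" "fibre_integral F \<mu> u \<le> B"
  unfolding fibre_integral_def
  by (rule integral_indicator_bounds[OF _ _ F0 FB measurable_fibre]; simp)+

lemma measurable_fibre_integral:
  "(\<lambda>(\<mu>, u). fibre_integral F \<mu> u) \<in> borel_measurable (borel \<Otimes>\<^sub>M borel)"
proof -
  have "(\<lambda>p. \<integral>x. indicator {0..1} x * F (fst p, snd p, x) \<partial>lborel) \<in> borel_measurable (borel \<Otimes>\<^sub>M borel)"
    by measurable
  then show ?thesis by (simp add: fibre_integral_def case_prod_unfold)
qed

lemma measurable_fibre_integral_compose[measurable (raw)]:
  assumes "f \<in> borel_measurable M" "g \<in> borel_measurable M"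
  shows "(\<lambda>z. fibre_integral F (f z) (g z)) \<in> borel_measurable M"
  using measurable_compose[OF measurable_Pair[OF assms] measurable_fibre_integral] by simp

lemma measurable_fibre_integral': "fibre_integral F \<mu> \<in> borel_measurable sphere_prob"
  by measurable

lemma sphere_integral_bounds:
  "integrable sphere_prob (\<lambda>u. indicator (sphere 0 1) u * fibre_integral F \<mu> u)"
  "0 \<le> sphere_integral F \<mu>" "sphere_integral F \<mu> \<le> B"
  unfolding sphere_integral_def
  by (rule integral_indicator_bounds[OF _ _ fibre_integral_bounds(2,3) measurable_fibre_integral'];
      simp add: emeasure_sphere_prob_sphere)+

lemma measurable_sphere_integral[measurable]: "sphere_integral F \<in> borel_measurable borel"
proof -
  interpret finite_measure "sphere_prob :: 'a measure" by (rule finite_measure_sphere_prob)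
  have [measurable]: "sphere (0::'a) 1 \<in> sets borel" by (rule borel_closed) (rule closed_sphere)
  have "(\<lambda>\<mu>. \<integral>u. indicator (sphere 0 1) u * fibre_integral F \<mu> u \<partial>sphere_prob) \<in> borel_measurable borel"
    by measurable
  then show ?thesis by (simp add: sphere_integral_def[abs_def])
qed

lemma triple_integral_integrable:
  "integrable lborel (\<lambda>\<mu>. indicator {0<..1} \<mu> * sphere_integral F \<mu>)"
  by (rule integral_indicator_bounds(1)[OF _ _ sphere_integral_bounds(2,3)]) auto

end

text \<open>The exceptional \<open>x\<close> may vary with \<mu> and u, but for fixed \<mu> and u
  they form a null set. So dominated convergence in the inner layer gives convergence at every u and
  every \<mu> in (0, 1], and then applies twice more.\<close>

lemma triple_integral_tendsto:
  fixes F :: "real \<times> 'a::euclidean_space \<times> real \<Rightarrow> real"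
  assumes mn: "\<And>n. Fn n \<in> borel_measurable (borel \<Otimes>\<^sub>M (borel \<Otimes>\<^sub>M borel))"
    and m: "F \<in> borel_measurable (borel \<Otimes>\<^sub>M (borel \<Otimes>\<^sub>M borel))"
    and Fn: "\<And>n p. 0 \<le> Fn n p" "\<And>n p. Fn n p \<le> B" and F: "\<And>p. 0 \<le> F p" "\<And>p. F p \<le> B"
    and lim: "\<And>\<mu> u. 0 < \<mu> \<Longrightarrow> \<mu> \<le> 1 \<Longrightarrow> countable {x. \<not> (\<lambda>n. Fn n (\<mu>, u, x)) \<longlonglongrightarrow> F (\<mu>, u, x)}"
  shows "(\<lambda>n. triple_integral (Fn n)) \<longlonglongrightarrow> triple_integral F"
proof -
  note bn = fibre_integral_bounds[OF mn Fn] sphere_integral_bounds[OF mn Fn] triple_integral_integrable[OF mn Fn]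
  note b = fibre_integral_bounds[OF m F] sphere_integral_bounds[OF m F] triple_integral_integrable[OF m F]
  have B: "0 \<le> B" using F by (meson order_trans)
  have 1: "(\<lambda>n. fibre_integral (Fn n) \<mu> u) \<longlonglongrightarrow> fibre_integral F \<mu> u" if \<mu>: "0 < \<mu>" "\<mu> \<le> 1" for \<mu> u
    unfolding fibre_integral_def
  proof (rule integral_dominated_convergence[where w = "\<lambda>x. indicator {0..1} x * B"])
    show "(\<lambda>x. indicator {0..1} x * F (\<mu>, u, x)) \<in> borel_measurable lborel" using b(1) by blast
    show "(\<lambda>x. indicator {0..1} x * Fn n (\<mu>, u, x)) \<in> borel_measurable lborel" for n using bn(1) by blast
    show "integrable lborel (\<lambda>x::real. indicator {0..1} x * B)"
      by (intro integrable_mult_left) (simp add: integrable_indicator_iff)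
    have "AE x in lborel. x \<notin> {x. \<not> (\<lambda>n. Fn n (\<mu>, u, x)) \<longlonglongrightarrow> F (\<mu>, u, x)}"
      using countable_imp_null_set_lborel[OF lim[OF \<mu>]] AE_not_in by blast
    then show "AE x in lborel. (\<lambda>n. indicator {0..1} x * Fn n (\<mu>, u, x)) \<longlonglongrightarrow> indicator {0..1} x * F (\<mu>, u, x)"
      by eventually_elim (auto intro: tendsto_intros)
    show "AE x in lborel. norm (indicator {0..1} x * Fn n (\<mu>, u, x)) \<le> indicator {0..1} x * B" for n
      using Fn by (auto simp: indicator_def)
  qed
  have 2: "(\<lambda>n. sphere_integral (Fn n) \<mu>) \<longlonglongrightarrow> sphere_integral F \<mu>" if \<mu>: "0 < \<mu>" "\<mu> \<le> 1" for \<mu>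
    unfolding sphere_integral_def
  proof (rule integral_dominated_convergence[where w = "\<lambda>x. B"])
    interpret finite_measure "sphere_prob :: 'a measure" by (rule finite_measure_sphere_prob)
    show "(\<lambda>u. indicator (sphere 0 1) u * fibre_integral F \<mu> u) \<in> borel_measurable sphere_prob" using b(4) by blast
    show "(\<lambda>u. indicator (sphere 0 1) u * fibre_integral (Fn n) \<mu> u) \<in> borel_measurable sphere_prob" for n using bn(4) by blast
    show "integrable (sphere_prob :: 'a measure) (\<lambda>x. B)" by simp
    show "AE u in sphere_prob. (\<lambda>n. indicator (sphere 0 1) u * fibre_integral (Fn n) \<mu> u) \<longlonglongrightarrow> indicator (sphere 0 1) u * fibre_integral F \<mu> u"
      using 1[OF \<mu>] by (auto intro!: tendsto_intros)
    show "AE u in sphere_prob. norm (indicator (sphere 0 1) u * fibre_integral (Fn n) \<mu> u) \<le> B" for n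
      using bn(2,3) B by (auto simp: indicator_def)
  qed
  show ?thesis
    unfolding triple_integral_def
  proof (rule integral_dominated_convergence[where w = "\<lambda>x. indicator {0<..1} x * B"])
    show "(\<lambda>\<mu>. indicator {0<..1} \<mu> * sphere_integral F \<mu>) \<in> borel_measurable lborel" using b(7) by blast
    show "(\<lambda>\<mu>. indicator {0<..1} \<mu> * sphere_integral (Fn n) \<mu>) \<in> borel_measurable lborel" for n using bn(7) by blast
    show "integrable lborel (\<lambda>x::real. indicator {0<..1} x * B)"
      by (intro integrable_mult_left) (simp add: integrable_indicator_iff)
    show "AE \<mu> in lborel. (\<lambda>n. indicator {0<..1} \<mu> * sphere_integral (Fn n) \<mu>) \<longlonglongrightarrow> indicator {0<..1} \<mu> * sphere_integral F \<mu>"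
      using 2 by (auto simp: indicator_def)
    show "AE \<mu> in lborel. norm (indicator {0<..1} \<mu> * sphere_integral (Fn n) \<mu>) \<le> indicator {0<..1} \<mu> * B" for n
      using bn(5,6) by (auto simp: indicator_def)
  qed
qed

lemma triple_integral_mono:
  fixes F G :: "real \<times> 'a::euclidean_space \<times> real \<Rightarrow> real"
  assumes mF: "F \<in> borel_measurable (borel \<Otimes>\<^sub>M (borel \<Otimes>\<^sub>M borel))"
    and mG: "G \<in> borel_measurable (borel \<Otimes>\<^sub>M (borel \<Otimes>\<^sub>M borel))"
    and F: "\<And>p. 0 \<le> F p" "\<And>p. F p \<le> B" and G: "\<And>p. 0 \<le> G p" "\<And>p. G p \<le> B"
    and le: "\<And>p. F p \<le> G p"
  shows "fibre_integral F \<mu> u \<le> fibre_integral G \<mu> u" "sphere_integral F \<mu> \<le> sphere_integral G \<mu>"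
    "triple_integral F \<le> triple_integral G"
proof -
  note bF = fibre_integral_bounds[OF mF F] sphere_integral_bounds[OF mF F] triple_integral_integrable[OF mF F]
  note bG = fibre_integral_bounds[OF mG G] sphere_integral_bounds[OF mG G] triple_integral_integrable[OF mG G]
  show 1: "fibre_integral F \<mu> u \<le> fibre_integral G \<mu> u" for \<mu> u
    unfolding fibre_integral_def using le by (intro integral_mono bF(1) bG(1) mult_left_mono) auto
  show 2: "sphere_integral F \<mu> \<le> sphere_integral G \<mu>" for \<mu>
    unfolding sphere_integral_def using 1 by (intro integral_mono bF(4) bG(4) mult_left_mono) auto
  show "triple_integral F \<le> triple_integral G"
    unfolding triple_integral_def using 2 by (intro integral_mono bF(7) bG(7) mult_left_mono) auto
qed

text \<open>The preimage of this double cone under \<open>sgn\<close> contains a nonempty open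
  subset of the ball; half the unit vector in the direction of \<open>v\<close> belongs to
  it.\<close>

lemma sphere_prob_cone_pos:
  fixes v :: "'a::euclidean_space"
  assumes "v \<noteq> 0"
  shows "emeasure sphere_prob (sphere 0 1 \<inter> {u. norm v / 2 < \<bar>v \<bullet> u\<bar>}) \<noteq> 0"
proof -
  let ?b = "ball (0::'a) 1" and ?U = "sphere 0 1 \<inter> {u. norm v / 2 < \<bar>v \<bullet> u\<bar>}"
  let ?T = "?b \<inter> {z. 0 < norm z} \<inter> {z. norm v / 2 * norm z < \<bar>v \<bullet> z\<bar>}"
  have U: "?U \<in> sets borel"
    by (intro sets.Int borel_closed closed_sphere borel_open open_Collect_less continuous_intros)
  have sg: "sgn -` ?U \<in> sets borel"
    using measurable_sets_borel[OF borel_measurable_sgn U] by simp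
  have e: "emeasure sphere_prob ?U = emeasure lborel (?b \<inter> sgn -` ?U) / emeasure lborel ?b"
    unfolding sphere_prob_def using U sg by (subst emeasure_distr) auto
  have oT: "open ?T"
    by (intro open_Int open_ball open_Collect_less continuous_intros)
  have "(1/2) *\<^sub>R sgn v \<in> ?T"
    using assms by (auto simp: norm_sgn sgn_div_norm dot_square_norm power2_eq_square field_simps)
  then have "?T \<noteq> {}" by blast
  then have "\<not> negligible ?T" using oT open_not_negligible by blast
  then have "emeasure lborel ?T \<noteq> 0"
    using oT by (auto simp: negligible_iff_null_sets null_sets_def)
  moreover have "?T \<subseteq> ?b \<inter> sgn -` ?U"
    by (auto simp: norm_sgn) (auto simp: sgn_div_norm field_simps abs_mult)
  then have "emeasure lborel ?T \<le> emeasure lborel (?b \<inter> sgn -` ?U)"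
    using sg by (intro emeasure_mono) auto
  ultimately have "emeasure lborel (?b \<inter> sgn -` ?U) \<noteq> 0" by auto
  then show ?thesis unfolding e using emeasure_unit_ball_bounds[where 'a='a]
    by (auto simp: ennreal_divide_eq_0_iff)
qed

text \<open>Each layer needs strictness on a set of positive measure: all of [0, 1] for x, the
  double cone around \<open>v\<close> for u, and (0, \<mu>0) for \<mu>.\<close>

lemma triple_integral_strict_mono:
  fixes F G :: "real \<times> 'a::euclidean_space \<times> real \<Rightarrow> real"
  assumes mF: "F \<in> borel_measurable (borel \<Otimes>\<^sub>M (borel \<Otimes>\<^sub>M borel))"
    and mG: "G \<in> borel_measurable (borel \<Otimes>\<^sub>M (borel \<Otimes>\<^sub>M borel))"
    and F: "\<And>p. 0 \<le> F p" "\<And>p. F p \<le> B" and G: "\<And>p. 0 \<le> G p" "\<And>p. G p \<le> B"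
    and le: "\<And>p. F p \<le> G p"
    and v: "v \<noteq> 0" and \<mu>0: "0 < \<mu>0" "\<mu>0 \<le> 1"
    and less: "\<And>\<mu> u x. 0 < \<mu> \<Longrightarrow> \<mu> < \<mu>0 \<Longrightarrow> norm v / 2 < \<bar>v \<bullet> u\<bar> \<Longrightarrow> F (\<mu>, u, x) < G (\<mu>, u, x)"
  shows "triple_integral F < triple_integral G"
proof -
  note bF = fibre_integral_bounds[OF mF F] sphere_integral_bounds[OF mF F] triple_integral_integrable[OF mF F]
  note bG = fibre_integral_bounds[OF mG G] sphere_integral_bounds[OF mG G] triple_integral_integrable[OF mG G]
  note mono = triple_integral_mono[OF mF mG F G le]
  have 1: "fibre_integral F \<mu> u < fibre_integral G \<mu> u" if "0 < \<mu>" "\<mu> < \<mu>0" "norm v / 2 < \<bar>v \<bullet> u\<bar>" for \<mu> u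
    unfolding fibre_integral_def
    by (rule integral_strict_mono[OF bF(1) bG(1), where A = "{0..1}"])
      (use le less[OF that] in \<open>auto intro: mult_left_mono\<close>)
  have 2: "sphere_integral F \<mu> < sphere_integral G \<mu>" if "0 < \<mu>" "\<mu> < \<mu>0" for \<mu>
    unfolding sphere_integral_def
  proof (rule integral_strict_mono[OF bF(4) bG(4), where A = "sphere 0 1 \<inter> {u. norm v / 2 < \<bar>v \<bullet> u\<bar>}"])
    show "sphere 0 1 \<inter> {u. norm v / 2 < \<bar>v \<bullet> u\<bar>} \<in> sets sphere_prob"
      unfolding sets_sphere_prob
      by (intro sets.Int borel_closed closed_sphere borel_open open_Collect_less continuous_intros)
  qed (use mono sphere_prob_cone_pos[OF v] 1[OF that] in \<open>auto intro!: mult_left_mono\<close>)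
  show ?thesis
    unfolding triple_integral_def
    by (rule integral_strict_mono[OF bF(7) bG(7), where A = "{0<..<\<mu>0}"])
      (use mono 2 \<mu>0 in \<open>auto intro!: mult_left_mono\<close>)
qed

text \<open>By \<open>slab_sum_eq\<close> the two integrands in \<open>x\<close> differ only on a
  countable set, and \<open>integral_discrete_difference\<close> then equates the integrals without
  a separate measurability proof for \<open>slab_sum\<close>.\<close>

lemma len_eq_triple_integral:
  fixes \<gamma> :: "real \<Rightarrow> 'a::euclidean_space"
  assumes \<gamma>: "continuous_on {a..b} \<gamma>"
  shows "len a b \<gamma> = triple_integral (slab_density a b \<gamma>)"
proof -
  have "(LBINT x:{0..1}. slab_sum a b \<gamma> x u \<mu>) = fibre_integral (slab_density a b \<gamma>) \<mu> u"
    if m: "0 < \<mu>" "\<mu> \<le> 1" for u :: 'a and \<mu>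
    unfolding set_lebesgue_integral_def fibre_integral_def
  proof (rule integral_discrete_difference)
    show "countable {x. \<not> no_integer_extremum a b (\<lambda>t. (\<gamma> t \<bullet> u) / \<mu> - x)}"
      by (rule countable_integer_extremum)
    fix x assume "x \<notin> {x. \<not> no_integer_extremum a b (\<lambda>t. (\<gamma> t \<bullet> u) / \<mu> - x)}"
    then have g: "no_integer_extremum a b (\<lambda>t. (\<gamma> t \<bullet> u) / \<mu> - x)" by simp
    interpret slab_path a b \<gamma> x u \<mu> "\<lambda>t. (\<gamma> t \<bullet> u) / \<mu> - x" by unfold_locales (use \<gamma> m in auto)
    show "indicat_real {0..1} x *\<^sub>R slab_sum a b \<gamma> x u \<mu> = indicat_real {0..1} x * slab_density a b \<gamma> (\<mu>, u, x)"
      using slab_sum_eq[OF g] m by (simp add: slab_density_def)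
  qed auto
  then show ?thesis
    unfolding len_def triple_integral_def sphere_integral_def set_lebesgue_integral_def
    by (intro Bochner_Integration.integral_cong refl) (auto simp: indicator_def)
qed

section \<open>Continuity and monotonicity of len\<close>

lemma len_eqI:
  fixes \<gamma> \<eta> :: "real \<Rightarrow> 'a::euclidean_space"
  assumes "continuous_on {a..b} \<gamma>" "continuous_on {c..d} \<eta>"
    and "\<And>u \<mu> x. 0 < \<mu> \<Longrightarrow> unit_len a b (\<lambda>t. (\<gamma> t \<bullet> u) / \<mu> - x) = unit_len c d (\<lambda>t. (\<eta> t \<bullet> u) / \<mu> - x)"
  shows "len a b \<gamma> = len c d \<eta>"
proof -
  have "slab_density a b \<gamma> = slab_density c d \<eta>"
    using assms(3) by (auto simp: slab_density_def)
  then show ?thesis using len_eq_triple_integral[OF assms(1)] len_eq_triple_integral[OF assms(2)] by simp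
qed

lemma len_cong:
  fixes \<gamma> \<eta> :: "real \<Rightarrow> 'a::euclidean_space"
  assumes \<gamma>: "continuous_on {a..b} \<gamma>" and eq: "\<And>t. t \<in> {a..b} \<Longrightarrow> \<gamma> t = \<eta> t"
  shows "len a b \<gamma> = len a b \<eta>"
proof (rule len_eqI[OF \<gamma>])
  show "continuous_on {a..b} \<eta>" using continuous_on_eq[OF \<gamma> eq] .
qed (auto intro!: unit_len_cong simp: eq)

lemma continuous_inj_mono_or_antimono:
  fixes \<phi> :: "real \<Rightarrow> real"
  assumes "continuous_on {a..b} \<phi>" "inj_on \<phi> {a..b}"
  shows "mono_on {a..b} \<phi> \<or> antimono_on {a..b} \<phi>"
proof -
  have "strict_mono_on {a..b} \<phi> \<or> strict_antimono_on {a..b} \<phi>"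
    using injective_eq_monotone_map[of "{a..b}" \<phi>] assms is_interval_cc by blast
  then show ?thesis
  proof
    assume "strict_mono_on {a..b} \<phi>"
    then show ?thesis using strict_mono_on_imp_mono_on by blast
  next
    assume "strict_antimono_on {a..b} \<phi>"
    then have "antimono_on {a..b} \<phi>"
      unfolding monotone_on_def by (metis order_le_less)
    then show ?thesis ..
  qed
qed

lemma unit_len_compose_le:
  assumes "continuous_on {a..b} \<phi>" "inj_on \<phi> {a..b}" "\<phi> ` {a..b} \<subseteq> {c..d}"
  shows "unit_len a b (h \<circ> \<phi>) \<le> unit_len c d h"
  using continuous_inj_mono_or_antimono[OF assms(1,2)] unit_len_compose_mono unit_len_compose_antimono assms by blast

text \<open>Injective continuous maps are monotone in one of the two senses, so neither composition
  with \<phi> nor composition with its inverse can increase \<open>unit_len\<close>.\<close>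

lemma len_homeomorphism:
  fixes \<gamma> :: "real \<Rightarrow> 'a::euclidean_space"
  assumes \<gamma>: "continuous_on {c..d} \<gamma>" and \<phi>: "homeomorphism {a..b} {c..d} \<phi> \<psi>"
  shows "len a b (\<gamma> \<circ> \<phi>) = len c d \<gamma>"
proof (rule len_eqI[OF _ \<gamma>])
  have c\<phi>: "continuous_on {a..b} \<phi>" "\<phi> ` {a..b} = {c..d}" and c\<psi>: "continuous_on {c..d} \<psi>" "\<psi> ` {c..d} = {a..b}"
    and inv: "\<And>x. x \<in> {a..b} \<Longrightarrow> \<psi> (\<phi> x) = x" "\<And>y. y \<in> {c..d} \<Longrightarrow> \<phi> (\<psi> y) = y"
    using \<phi> by (auto simp: homeomorphism_def)
  have inj: "inj_on \<phi> {a..b}" "inj_on \<psi> {c..d}" using inv by (metis inj_on_inverseI)+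
  show "continuous_on {a..b} (\<gamma> \<circ> \<phi>)" using c\<phi> \<gamma> by (intro continuous_on_compose) auto
  fix u \<mu> x
  define h where "h = (\<lambda>t. (\<gamma> t \<bullet> u) / \<mu> - x)"
  have "unit_len c d h = unit_len c d ((h \<circ> \<phi>) \<circ> \<psi>)" using inv(2) by (intro unit_len_cong) auto
  also have "\<dots> \<le> unit_len a b (h \<circ> \<phi>)" using c\<psi> inj by (intro unit_len_compose_le) auto
  finally have "unit_len c d h \<le> unit_len a b (h \<circ> \<phi>)" .
  moreover have "unit_len a b (h \<circ> \<phi>) \<le> unit_len c d h"
    by (rule unit_len_compose_le[OF c\<phi>(1) inj(1)]) (simp add: c\<phi>(2))
  ultimately have "unit_len a b (h \<circ> \<phi>) = unit_len c d h" by simp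
  then show "unit_len a b (\<lambda>t. ((\<gamma> \<circ> \<phi>) t \<bullet> u) / \<mu> - x) = unit_len c d (\<lambda>t. (\<gamma> t \<bullet> u) / \<mu> - x)"
    by (simp add: h_def o_def)
qed

lemma len_affine_pos:
  fixes \<gamma> :: "real \<Rightarrow> 'a::euclidean_space"
  assumes "0 < q" "continuous_on {p + q * a..p + q * b} \<gamma>"
  shows "len a b (\<lambda>t. \<gamma> (p + q * t)) = len (p + q * a) (p + q * b) \<gamma>"
proof -
  have "homeomorphism {a..b} {p + q * a..p + q * b} (\<lambda>t. p + q * t) (\<lambda>y. (y - p) / q)"
    using assms(1) by (intro homeomorphismI continuous_intros) (auto simp: field_simps)
  from len_homeomorphism[OF assms(2) this] show ?thesis by (simp add: o_def)
qed

lemma len_affine_neg: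
  fixes \<gamma> :: "real \<Rightarrow> 'a::euclidean_space"
  assumes "0 < q" "continuous_on {p - q * b..p - q * a} \<gamma>"
  shows "len a b (\<lambda>t. \<gamma> (p - q * t)) = len (p - q * b) (p - q * a) \<gamma>"
proof -
  have "homeomorphism {a..b} {p - q * b..p - q * a} (\<lambda>t. p - q * t) (\<lambda>y. (p - y) / q)"
    using assms(1) by (intro homeomorphismI continuous_intros) (auto simp: field_simps)
  from len_homeomorphism[OF assms(2) this] show ?thesis by (simp add: o_def)
qed

lemma unit_len_const:
  assumes "\<And>t. t \<in> {a..b} \<Longrightarrow> h t = y" shows "unit_len a b h = 0"
proof (rule antisym[OF unit_len_least unit_len_nonneg])
  fix K s t j assume "separated_system a b h K s t j"
  then have "s k \<in> {a..b} \<and> t k \<in> {a..b}" if "k \<in> K" for k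
    using that by (fastforce simp: separated_system_def)
  then show "system_sum h K s t \<le> 0" using assms by (simp add: system_sum_def)
qed

lemma len_const:
  fixes \<gamma> :: "real \<Rightarrow> 'a::euclidean_space"
  assumes "\<And>t. t \<in> {a..b} \<Longrightarrow> \<gamma> t = y" shows "len a b \<gamma> = 0"
proof -
  have "continuous_on {a..b} \<gamma>" by (rule continuous_on_eq[OF continuous_on_const[of _ y]]) (simp add: assms)
  moreover have "unit_len a b (\<lambda>t. (\<gamma> t \<bullet> u) / \<mu> - x) = 0" for u \<mu> x
    by (rule unit_len_const[of _ _ _ "(y \<bullet> u) / \<mu> - x"]) (simp add: assms)
  then have "slab_density a b \<gamma> = (\<lambda>p. 0)" by (auto simp: slab_density_def)
  ultimately show ?thesis
    by (simp add: len_eq_triple_integral triple_integral_def sphere_integral_def fibre_integral_def)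
qed

lemma len_refl [simp]: "len a a \<gamma> = 0"
  by (rule len_const[of _ _ _ "\<gamma> a"]) auto

text \<open>From \<open>c\<close> to \<open>b\<close> the path moves by \<open>v\<close>. For u in a
  double cone around \<open>v\<close> and small \<mu> the rescaled function moves by more than 3,
  hence crosses a whole slab that does not contain its value at \<open>c\<close>.\<close>

lemma len_less_right:
  fixes \<gamma> :: "real \<Rightarrow> 'a::euclidean_space"
  assumes \<gamma>: "continuous_on {a..b} \<gamma>" "\<gamma> c \<noteq> \<gamma> b" and ac: "a \<le> c" "c < b"
  shows "len a c \<gamma> < len a b \<gamma>"
proof -
  have \<gamma>': "continuous_on {a..c} \<gamma>" by (rule continuous_on_subset[OF \<gamma>(1)]) (use ac in auto)
  define v where "v = \<gamma> b - \<gamma> c"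
  have v: "v \<noteq> 0" using \<gamma>(2) by (simp add: v_def)
  have le: "slab_density a c \<gamma> p \<le> slab_density a b \<gamma> p" for p
  proof -
    have "unit_len a c h \<le> unit_len a b h" for h
      using unit_len_compose_mono[of a c id a b h] ac by (auto simp: mono_on_def)
    then show ?thesis by (auto simp: slab_density_def split: prod.split intro!: mult_left_mono)
  qed
  have "triple_integral (slab_density a c \<gamma>) < triple_integral (slab_density a b \<gamma>)"
  \<comment> \<open>The double cone gives \<open>v\<close> a component larger than norm v / 2, which
    is three times the bound norm v / 6 for \<mu>.\<close>
  proof (rule triple_integral_strict_mono[OF borel_measurable_slab_density[OF \<gamma>'] borel_measurable_slab_density[OF \<gamma>(1)]
          slab_density_nonneg slab_density_le_2 slab_density_nonneg slab_density_le_2 le v, where ?\<mu>0.0 = "min 1 (norm v / 6)"])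
    show "0 < min 1 (norm v / 6)" using v by simp
    show "min 1 (norm v / 6) \<le> 1" by simp
    fix \<mu> x :: real and u :: 'a assume \<mu>: "0 < \<mu>" "\<mu> < min 1 (norm v / 6)" and u: "norm v / 2 < \<bar>v \<bullet> u\<bar>"
    define h where "h = (\<lambda>t. (\<gamma> t \<bullet> u) / \<mu> - x)"
    have "h b - h c = (v \<bullet> u) / \<mu>" by (simp add: h_def v_def inner_diff_left diff_divide_distrib)
    then have hb: "\<bar>h b - h c\<bar> = \<bar>v \<bullet> u\<bar> / \<mu>" using \<mu> by (simp add: abs_divide)
    have "3 * \<mu> < \<bar>v \<bullet> u\<bar>" using \<mu> u by auto
    then have "3 < \<bar>h b - h c\<bar>" unfolding hb using \<mu> by (simp add: field_simps)
    \<comment> \<open>Slab \<open>i\<close> is the nearest one lying strictly beyond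
      \<open>h c\<close> in the direction of \<open>h b\<close>.\<close>
    then obtain i where i: "h c \<le> of_int i \<and> of_int i + 1 \<le> h b \<or> h b \<le> of_int i \<and> of_int i + 1 \<le> h c"
      "h c \<notin> {real_of_int i..of_int i + 1}"
    proof (cases "h c < h b")
      case True
      then show ?thesis using that[of "\<lfloor>h c\<rfloor> + 1"] \<open>3 < _\<close> by (simp) linarith
    next
      case False
      then show ?thesis using that[of "\<lceil>h c\<rceil> - 2"] \<open>3 < _\<close> by (simp) linarith
    qed
    have ch: "continuous_on {a..b} h" unfolding h_def using \<gamma> \<mu> by (intro continuous_intros) auto
    have "unit_len a c h < unit_len a b h"
      by (rule unit_len_strict_mono[OF ch ac(1) _ _ _ i]) (use ac in auto)
    then show "slab_density a c \<gamma> (\<mu>, u, x) < slab_density a b \<gamma> (\<mu>, u, x)"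
      using \<mu> by (simp add: slab_density_def h_def)
  qed
  then show ?thesis using len_eq_triple_integral[OF \<gamma>'] len_eq_triple_integral[OF \<gamma>(1)] by simp
qed

lemma len_less_left:
  fixes \<gamma> :: "real \<Rightarrow> 'a::euclidean_space"
  assumes \<gamma>: "continuous_on {a..b} \<gamma>" "\<gamma> c \<noteq> \<gamma> a" and ac: "a < c" "c \<le> b"
  shows "len c b \<gamma> < len a b \<gamma>"
proof -
  have \<gamma>': "continuous_on {c..b} \<gamma>" by (rule continuous_on_subset[OF \<gamma>(1)]) (use ac in auto)
  define \<eta> where "\<eta> = (\<lambda>t. \<gamma> (0 - 1 * t))"
  have "continuous_on {-b..-a} \<eta>"
    unfolding \<eta>_def by (rule continuous_on_compose2[OF \<gamma>(1)]) (auto intro!: continuous_intros)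
  then have "len (-b) (-c) \<eta> < len (-b) (-a) \<eta>"
    using \<gamma>(2) ac by (intro len_less_right) (auto simp: \<eta>_def)
  moreover have "len (-b) (-c) \<eta> = len c b \<gamma>" "len (-b) (-a) \<eta> = len a b \<gamma>"
    unfolding \<eta>_def using len_affine_neg[of 1 0 "-c" "-b" \<gamma>] len_affine_neg[of 1 0 "-a" "-b" \<gamma>] \<gamma>(1) \<gamma>' by auto
  ultimately show ?thesis by simp
qed

text \<open>For fixed \<mu> and direction the densities converge at every \<open>x\<close> for which
  the limit function has no integer extremum, thus off a countable set.\<close>

lemma len_tendsto:
  fixes \<gamma> :: "real \<Rightarrow> 'a::euclidean_space"
  assumes \<gamma>n: "\<And>n. continuous_on {a..b} (\<gamma>n n)" and \<gamma>: "continuous_on {a..b} \<gamma>"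
    and u: "uniform_limit {a..b} \<gamma>n \<gamma> sequentially"
  shows "(\<lambda>n. len a b (\<gamma>n n)) \<longlonglongrightarrow> len a b \<gamma>"
proof -
  have "(\<lambda>n. triple_integral (slab_density a b (\<gamma>n n))) \<longlonglongrightarrow> triple_integral (slab_density a b \<gamma>)"
  proof (rule triple_integral_tendsto[OF borel_measurable_slab_density[OF \<gamma>n] borel_measurable_slab_density[OF \<gamma>]
        slab_density_nonneg slab_density_le_2 slab_density_nonneg slab_density_le_2])
    fix \<mu> :: real and v :: 'a assume \<mu>: "0 < \<mu>" "\<mu> \<le> 1"
    have "(\<lambda>n. slab_density a b (\<gamma>n n) (\<mu>, v, x)) \<longlonglongrightarrow> slab_density a b \<gamma> (\<mu>, v, x)"
      if g: "no_integer_extremum a b (\<lambda>t. (\<gamma> t \<bullet> v) / \<mu> - x)" for x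
    proof -
      have "continuous_on {a..b} (\<lambda>t. (\<gamma> t \<bullet> v) / \<mu> - x)" using \<gamma> \<mu> by (intro continuous_intros) auto
      moreover have "uniform_limit {a..b} (\<lambda>n t. (\<gamma>n n t \<bullet> v) / \<mu> - x) (\<lambda>t. (\<gamma> t \<bullet> v) / \<mu> - x) sequentially"
      proof -
        have "uniform_limit {a..b} (\<lambda>n t. (\<gamma>n n t \<bullet> (v /\<^sub>R \<mu>)) - x) (\<lambda>t. (\<gamma> t \<bullet> (v /\<^sub>R \<mu>)) - x) sequentially"
          by (intro uniform_limit_intros bounded_linear.uniform_limit[OF bounded_linear_inner_left] u)
        then show ?thesis by (simp add: divide_inverse_commute)
      qed
      ultimately have "(\<lambda>n. unit_len a b (\<lambda>t. (\<gamma>n n t \<bullet> v) / \<mu> - x)) \<longlonglongrightarrow> unit_len a b (\<lambda>t. (\<gamma> t \<bullet> v) / \<mu> - x)"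
        using unit_len_tendsto[OF g] by blast
      then show ?thesis using \<mu> by (auto simp: slab_density_def intro!: tendsto_intros)
    qed
    then have "{x. \<not> (\<lambda>n. slab_density a b (\<gamma>n n) (\<mu>, v, x)) \<longlonglongrightarrow> slab_density a b \<gamma> (\<mu>, v, x)}
        \<subseteq> {x. \<not> no_integer_extremum a b (\<lambda>t. (\<gamma> t \<bullet> v) / \<mu> - x)}" by blast
    then show "countable {x. \<not> (\<lambda>n. slab_density a b (\<gamma>n n) (\<mu>, v, x)) \<longlonglongrightarrow> slab_density a b \<gamma> (\<mu>, v, x)}"
      by (rule countable_subset[OF _ countable_integer_extremum])
  qed
  then show ?thesis using len_eq_triple_integral[OF \<gamma>n] len_eq_triple_integral[OF \<gamma>] by simp
qed

lemma uniform_limit_compose_inner: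
  fixes f :: "nat \<Rightarrow> 'a::metric_space \<Rightarrow> 'b::metric_space"
  assumes f: "uniform_limit S f g sequentially" and g: "uniformly_continuous_on S g"
    and p: "uniform_limit T p q sequentially" and im: "\<And>n x. x \<in> T \<Longrightarrow> p n x \<in> S" "\<And>x. x \<in> T \<Longrightarrow> q x \<in> S"
  shows "uniform_limit T (\<lambda>n x. f n (p n x)) (\<lambda>x. g (q x)) sequentially"
  unfolding uniform_limit_iff
proof (intro allI impI)
  fix e :: real assume e: "0 < e"
  obtain d where d: "d > 0" "\<And>x y. x \<in> S \<Longrightarrow> y \<in> S \<Longrightarrow> dist y x < d \<Longrightarrow> dist (g y) (g x) < e / 2"
    using g e unfolding uniformly_continuous_on_def by (meson half_gt_zero)
  have "\<forall>\<^sub>F n in sequentially. \<forall>x\<in>S. dist (f n x) (g x) < e / 2" using f[unfolded uniform_limit_iff, rule_format, of "e / 2"] e by simp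
  moreover have "\<forall>\<^sub>F n in sequentially. \<forall>x\<in>T. dist (p n x) (q x) < d" using p d(1) by (simp add: uniform_limit_iff)
  ultimately show "\<forall>\<^sub>F n in sequentially. \<forall>x\<in>T. dist (f n (p n x)) (g (q x)) < e"
  proof eventually_elim
    case (elim n)
    show ?case
    proof
      fix x assume x: "x \<in> T"
      have "dist (f n (p n x)) (g (p n x)) < e / 2" using elim(1) im(1)[OF x] by blast
      moreover have "dist (g (p n x)) (g (q x)) < e / 2" using elim(2) x im by (intro d(2)) auto
      ultimately show "dist (f n (p n x)) (g (q x)) < e"
        using dist_triangle[of "f n (p n x)" "g (q x)" "g (p n x)"] by linarith
    qed
  qed
qed

text \<open>Affine rescaling to {0..1} turns moving end points into moving paths. When the ends
  coincide the rescaled path is constant and both sides of \<open>norm01\<close> are 0, so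
  degenerate intervals are covered too.\<close>

lemma len_tendsto_ends:
  fixes \<gamma> :: "real \<Rightarrow> 'a::euclidean_space"
  assumes \<gamma>n: "\<And>n. continuous_on {0..1} (\<gamma>n n)" and \<gamma>: "continuous_on {0..1} \<gamma>"
    and u: "uniform_limit {0..1} \<gamma>n \<gamma> sequentially"
    and cd: "c \<longlonglongrightarrow> c'" "d \<longlonglongrightarrow> d'" "\<And>n. 0 \<le> c n" "\<And>n. c n \<le> d n" "\<And>n. d n \<le> 1"
  shows "(\<lambda>n. len (c n) (d n) (\<gamma>n n)) \<longlonglongrightarrow> len c' d' \<gamma>"
proof -
  have c'd': "0 \<le> c'" "c' \<le> d'" "d' \<le> 1"
    using cd by (auto intro: LIMSEQ_le_const LIMSEQ_le_const2 LIMSEQ_le)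
  have in01: "c + (d - c) * t \<in> {0..1}" if "0 \<le> c" "c \<le> d" "d \<le> 1" "t \<in> {0..1}" for c d t :: real
  proof -
    have "0 \<le> (d - c) * t" "(d - c) * t \<le> (d - c) * 1" using that by (auto intro!: mult_left_le)
    then show ?thesis using that by auto
  qed
  have norm01: "len c d \<eta> = len 0 1 (\<lambda>t. \<eta> (c + (d - c) * t))"
    if "0 \<le> c" "c \<le> d" "d \<le> 1" "continuous_on {0..1} \<eta>" for c d and \<eta> :: "real \<Rightarrow> 'a"
  proof (cases "c = d")
    case True
    then show ?thesis using len_const[of 0 1 "\<lambda>t. \<eta> (c + (d - c) * t)" "\<eta> c"] by simp
  next
    case False
    moreover have "continuous_on {c..d} \<eta>" by (rule continuous_on_subset[OF that(4)]) (use that in auto)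
    ultimately show ?thesis using len_affine_pos[of "d - c" c 0 1 \<eta>] that by simp
  qed
  have cont: "continuous_on {0..1} (\<lambda>t. \<eta> (c + (d - c) * t))"
    if "0 \<le> c" "c \<le> d" "d \<le> 1" "continuous_on {0..1} \<eta>" for c d and \<eta> :: "real \<Rightarrow> 'a"
    by (rule continuous_on_compose2[OF that(4)]) (use in01 that in \<open>auto intro!: continuous_intros\<close>)
  have "uniform_limit {0..1} (\<lambda>n t. c n + (d n - c n) * t) (\<lambda>t. c' + (d' - c') * t) sequentially"
    unfolding uniform_limit_iff
  proof (intro allI impI)
    fix e :: real assume e: "0 < e"
    have "(\<lambda>n. \<bar>c n - c'\<bar> + \<bar>(d n - c n) - (d' - c')\<bar>) \<longlonglongrightarrow> \<bar>c' - c'\<bar> + \<bar>(d' - c') - (d' - c')\<bar>"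
      by (intro tendsto_intros cd)
    then have "\<forall>\<^sub>F n in sequentially. \<bar>c n - c'\<bar> + \<bar>(d n - c n) - (d' - c')\<bar> < e"
      by (rule order_tendstoD(2)) (use e in auto)
    then show "\<forall>\<^sub>F n in sequentially. \<forall>t\<in>{0..1}. dist (c n + (d n - c n) * t) (c' + (d' - c') * t) < e"
    proof eventually_elim
      case (elim n)
      show ?case
      proof
        fix t :: real assume t: "t \<in> {0..1}"
        have "c n + (d n - c n) * t - (c' + (d' - c') * t) = (c n - c') + ((d n - c n) - (d' - c')) * t"
          by (simp add: algebra_simps)
        also have "\<bar>\<dots>\<bar> \<le> \<bar>c n - c'\<bar> + \<bar>((d n - c n) - (d' - c')) * t\<bar>" by linarith
        also have "\<bar>((d n - c n) - (d' - c')) * t\<bar> \<le> \<bar>(d n - c n) - (d' - c')\<bar>"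
          unfolding abs_mult using t by (intro mult_left_le) auto
        finally show "dist (c n + (d n - c n) * t) (c' + (d' - c') * t) < e"
          using elim by (simp add: dist_real_def)
      qed
    qed
  qed
  then have "uniform_limit {0..1} (\<lambda>n t. \<gamma>n n (c n + (d n - c n) * t)) (\<lambda>t. \<gamma> (c' + (d' - c') * t)) sequentially"
    by (rule uniform_limit_compose_inner[OF u compact_uniformly_continuous[OF \<gamma> compact_Icc]])
      (intro in01 cd c'd'; assumption)+
  then have "(\<lambda>n. len 0 1 (\<lambda>t. \<gamma>n n (c n + (d n - c n) * t))) \<longlonglongrightarrow> len 0 1 (\<lambda>t. \<gamma> (c' + (d' - c') * t))"
    by (intro len_tendsto cont cd c'd' \<gamma> \<gamma>n)
  then show ?thesis using norm01[OF cd(3-5) \<gamma>n] norm01[OF c'd' \<gamma>] by simp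
qed

lemma continuous_on_len_upper:
  fixes \<gamma> :: "real \<Rightarrow> 'a::euclidean_space"
  assumes \<gamma>: "continuous_on {0..1} \<gamma>"
  shows "continuous_on {0..1} (\<lambda>t. len 0 t \<gamma>)"
  unfolding continuous_on_sequentially o_def
proof (intro allI ballI impI, elim conjE)
  fix x and a :: real assume "\<forall>n. x n \<in> {0..1}" "x \<longlonglongrightarrow> a"
  then show "(\<lambda>n. len 0 (x n) \<gamma>) \<longlonglongrightarrow> len 0 a \<gamma>"
    by (intro len_tendsto_ends \<gamma> tendsto_const uniform_limit_const) auto
qed

lemma continuous_on_len_lower:
  fixes \<gamma> :: "real \<Rightarrow> 'a::euclidean_space"
  assumes \<gamma>: "continuous_on {0..1} \<gamma>"
  shows "continuous_on {0..1} (\<lambda>t. len t 1 \<gamma>)"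
  unfolding continuous_on_sequentially o_def
proof (intro allI ballI impI, elim conjE)
  fix x and a :: real assume "\<forall>n. x n \<in> {0..1}" "x \<longlonglongrightarrow> a"
  then show "(\<lambda>n. len (x n) 1 \<gamma>) \<longlonglongrightarrow> len a 1 \<gamma>"
    by (intro len_tendsto_ends \<gamma> tendsto_const uniform_limit_const) auto
qed

lemma len_nonneg:
  fixes \<gamma> :: "real \<Rightarrow> 'a::euclidean_space"
  assumes \<gamma>: "continuous_on {a..b} \<gamma>" shows "0 \<le> len a b \<gamma>"
  unfolding len_eq_triple_integral[OF \<gamma>] triple_integral_def
  by (intro integral_nonneg_AE AE_I2 mult_nonneg_nonneg
    sphere_integral_bounds(2)[OF borel_measurable_slab_density[OF \<gamma>] slab_density_nonneg slab_density_le_2]) simp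

section \<open>The midpoint parameterization\<close>

text \<open>The signed equation covers both halves of the parameterization at once (one of the two
  terms on its left is \<open>len m m \<gamma> = 0\<close>), and it is preserved under limits.\<close>

definition midpoint_relation :: "(real \<Rightarrow> 'a::euclidean_space) \<Rightarrow> real \<Rightarrow> real \<Rightarrow> real \<Rightarrow> bool" where
  "midpoint_relation \<gamma> m s v \<longleftrightarrow> m \<in> {0..1} \<and> v \<in> {0..1} \<and> s \<in> {0..1} \<and> len 0 m \<gamma> = len m 1 \<gamma> \<and>
     len (min v m) m \<gamma> - len m (max v m) \<gamma> = (1 - 2 * s) * len 0 m \<gamma>"

lemma arcD:
  assumes "arc \<gamma>" shows "continuous_on {0..1} \<gamma>" "\<And>s t. s \<in> {0..1} \<Longrightarrow> t \<in> {0..1} \<Longrightarrow> \<gamma> s = \<gamma> t \<longleftrightarrow> s = t"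
  using assms by (auto simp: arc_def path_def inj_on_def)

context
  fixes \<gamma> :: "real \<Rightarrow> 'a::euclidean_space"
  assumes \<gamma>: "arc \<gamma>"
begin

lemma arc_len_less_right: "0 \<le> a \<Longrightarrow> a \<le> c \<Longrightarrow> c < b \<Longrightarrow> b \<le> 1 \<Longrightarrow> len a c \<gamma> < len a b \<gamma>"
  using arcD[OF \<gamma>] by (intro len_less_right) (auto intro: continuous_on_subset)

lemma arc_len_less_left: "0 \<le> a \<Longrightarrow> a < c \<Longrightarrow> c \<le> b \<Longrightarrow> b \<le> 1 \<Longrightarrow> len c b \<gamma> < len a b \<gamma>"
  using arcD[OF \<gamma>] by (intro len_less_left) (auto intro: continuous_on_subset)

lemma midpoint_unique:
  assumes "m \<in> {0..1}" "m' \<in> {0..1}" "len 0 m \<gamma> = len m 1 \<gamma>" "len 0 m' \<gamma> = len m' 1 \<gamma>"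
  shows "m = m'"
proof -
  have "\<not> m < m'" if "m \<in> {0..1}" "m' \<in> {0..1}" "len 0 m \<gamma> = len m 1 \<gamma>" "len 0 m' \<gamma> = len m' 1 \<gamma>" for m m'
    using that arc_len_less_right[of 0 m m'] arc_len_less_left[of m m' 1] by auto
  then show ?thesis using assms by (meson linorder_neqE_linordered_idom)
qed

lemma midpoint_interior:
  assumes "m \<in> {0..1}" "len 0 m \<gamma> = len m 1 \<gamma>"
  shows "0 < m" "m < 1"
proof -
  have "0 < len 0 1 \<gamma>" using arc_len_less_right[of 0 0 1] by simp
  then have "m \<noteq> 0" "m \<noteq> 1" using assms(2) by auto
  then show "0 < m" "m < 1" using assms(1) by auto
qed

lemma len_midpoint: "len_midpoint \<gamma> \<in> {0<..<1}" "len 0 (len_midpoint \<gamma>) \<gamma> = len (len_midpoint \<gamma>) 1 \<gamma>"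
proof -
  have pos: "0 < len 0 1 \<gamma>" using arc_len_less_right[of 0 0 1] by simp
  have "continuous_on {0..1} (\<lambda>t. len 0 t \<gamma> - len t 1 \<gamma>)"
    by (intro continuous_on_diff continuous_on_len_upper continuous_on_len_lower arcD[OF \<gamma>])
  then obtain m where "0 \<le> m" "m \<le> 1" "len 0 m \<gamma> - len m 1 \<gamma> = 0"
    using IVT'[of "\<lambda>t. len 0 t \<gamma> - len t 1 \<gamma>" 0 0 1] pos by auto
  then have "m \<in> {0<..<1} \<and> len 0 m \<gamma> = len m 1 \<gamma>" using midpoint_interior[of m] by auto
  then have "len_midpoint \<gamma> \<in> {0<..<1} \<and> len 0 (len_midpoint \<gamma>) \<gamma> = len (len_midpoint \<gamma>) 1 \<gamma>"
    unfolding len_midpoint_def by (rule someI)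
  then show "len_midpoint \<gamma> \<in> {0<..<1}" "len 0 (len_midpoint \<gamma>) \<gamma> = len (len_midpoint \<gamma>) 1 \<gamma>" by auto
qed

text \<open>The left side of the signed equation strictly decreases in \<open>v\<close>, on both
  sides of the midpoint and across it.\<close>

lemma midpoint_relation_unique:
  assumes "midpoint_relation \<gamma> m s v" "midpoint_relation \<gamma> m' s v'"
  shows "v = v'"
proof -
  have m: "m' = m" by (rule midpoint_unique) (use assms in \<open>auto simp: midpoint_relation_def\<close>)
  have "\<not> v < v'" if v: "midpoint_relation \<gamma> m s v" "midpoint_relation \<gamma> m s v'" for v v'
  proof
    assume vv: "v < v'"
    have 01: "m \<in> {0..1}" "v \<in> {0..1}" "v' \<in> {0..1}" and
      eq: "len (min v m) m \<gamma> - len m (max v m) \<gamma> = len (min v' m) m \<gamma> - len m (max v' m) \<gamma>"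
      using v by (auto simp: midpoint_relation_def)
    consider "v' \<le> m" | "v < m" "m < v'" | "m \<le> v" using vv by linarith
    then show False
    proof cases
      case 1
      then show False using eq arc_len_less_left[of v v' m] vv 01 by auto
    next
      case 2
      then show False using eq arc_len_less_left[of v m m] arc_len_less_right[of m m v'] 01 by auto
    next
      case 3
      then show False using eq arc_len_less_right[of m v v'] vv 01 by auto
    qed
  qed
  then show ?thesis using assms m by (meson linorder_neqE_linordered_idom)
qed

lemma midpoint_relation_inj:
  assumes "midpoint_relation \<gamma> m s v" "midpoint_relation \<gamma> m' s' v"
  shows "s = s'"
proof -
  have m: "m' = m" by (rule midpoint_unique) (use assms in \<open>auto simp: midpoint_relation_def\<close>)
  have "0 < m" by (rule midpoint_interior) (use assms in \<open>auto simp: midpoint_relation_def\<close>)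
  then have "0 < len 0 m \<gamma>" using arc_len_less_right[of 0 0 m] assms by (auto simp: midpoint_relation_def)
  moreover have "(1 - 2 * s) * len 0 m \<gamma> = (1 - 2 * s') * len 0 m \<gamma>"
    using assms m by (auto simp: midpoint_relation_def)
  ultimately show ?thesis by auto
qed

lemma midpoint_relation_surj:
  assumes v: "v \<in> {0..1}"
  obtains m s where "midpoint_relation \<gamma> m s v"
proof -
  define m where "m = len_midpoint \<gamma>"
  have m: "0 < m" "m < 1" "len 0 m \<gamma> = len m 1 \<gamma>" using len_midpoint by (auto simp: m_def)
  have T: "0 < len 0 m \<gamma>" using arc_len_less_right[of 0 0 m] m by auto
  define w where "w = len (min v m) m \<gamma> - len m (max v m) \<gamma>"
  have 0: "0 \<le> len p q \<gamma>" if "0 \<le> p" "q \<le> 1" for p q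
    by (rule len_nonneg) (rule continuous_on_subset[OF arcD(1)[OF \<gamma>]], use that in auto)
  have "- len 0 m \<gamma> \<le> w \<and> w \<le> len 0 m \<gamma>"
  proof (cases "v \<le> m")
    case True
    have "len v m \<gamma> \<le> len 0 m \<gamma>" using arc_len_less_left[of 0 v m] True v m by (cases "v = 0") auto
    then show ?thesis using True 0[of v m] v m T by (simp add: w_def)
  next
    case False
    have "len m v \<gamma> \<le> len m 1 \<gamma>" using arc_len_less_right[of m v 1] False v m by (cases "v = 1") auto
    then show ?thesis using False 0[of m v] v m T by (simp add: w_def)
  qed
  then have "-1 \<le> w / len 0 m \<gamma>" "w / len 0 m \<gamma> \<le> 1" using T by (auto simp: field_simps)
  moreover have "w = (1 - 2 * ((1 - w / len 0 m \<gamma>) / 2)) * len 0 m \<gamma>" using T by (simp add: field_simps)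
  ultimately have "midpoint_relation \<gamma> m ((1 - w / len 0 m \<gamma>) / 2) v"
    using m(1,2) v unfolding midpoint_relation_def w_def[symmetric] by (intro conjI m(3)) auto
  then show ?thesis using that by blast
qed

end

lemma std_param_eq:
  fixes \<gamma> :: "real \<Rightarrow> 'a::euclidean_space"
  assumes \<gamma>: "continuous_on {0..1} \<gamma>" and nc: "\<not> \<gamma> constant_on {0..1}" and s: "s \<in> {0..1}"
  obtains t where "t \<in> {0..1}" "len 0 t \<gamma> = s * len 0 1 \<gamma>" "std_param \<gamma> s = \<gamma> t"
proof -
  have p: "0 \<le> len 0 1 \<gamma>" by (rule len_nonneg[OF \<gamma>])
  then have "0 \<le> s * len 0 1 \<gamma>" "s * len 0 1 \<gamma> \<le> len 0 1 \<gamma>"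
    using s by (auto intro: mult_left_le_one_le)
  then obtain t where "t \<in> {0..1} \<and> len 0 t \<gamma> = s * len 0 1 \<gamma>"
    using IVT'[of "\<lambda>t. len 0 t \<gamma>" 0 "s * len 0 1 \<gamma>" 1] continuous_on_len_upper[OF \<gamma>] by auto
  then have "(SOME t. t \<in> {0..1} \<and> len 0 t \<gamma> = s * len 0 1 \<gamma>) \<in> {0..1} \<and>
     len 0 (SOME t. t \<in> {0..1} \<and> len 0 t \<gamma> = s * len 0 1 \<gamma>) \<gamma> = s * len 0 1 \<gamma>" by (rule someI)
  then show ?thesis using that nc by (auto simp: std_param_def)
qed

text \<open>Affine changes of variable translate the equations behind the two standard
  parameterizations into the signed equation; injectivity ensures that neither half is
  constant.\<close>

lemma mid_param_eq:
  fixes \<gamma> :: "real \<Rightarrow> 'a::euclidean_space"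
  assumes \<gamma>: "arc \<gamma>" and s: "s \<in> {0..1}"
  obtains m v where "midpoint_relation \<gamma> m s v" "mid_param \<gamma> s = \<gamma> v"
proof -
  define m where "m = len_midpoint \<gamma>"
  have m: "0 < m" "m < 1" "len 0 m \<gamma> = len m 1 \<gamma>" using len_midpoint[OF \<gamma>] by (auto simp: m_def)
  note c = arcD(1)[OF \<gamma>] and inj = arcD(2)[OF \<gamma>]
  show ?thesis
  proof (cases "s \<le> 1/2")
    case True
    let ?g = "\<lambda>t. \<gamma> (m - m * t)"
    have in01: "0 \<le> m * t" "m * t \<le> m" if "t \<in> {0..1}" for t using that m by (auto simp: mult_left_le)
    have cg: "continuous_on {0..1} ?g"
    proof (rule continuous_on_compose2[OF c])
      show "(\<lambda>t. m - m * t) ` {0..1} \<subseteq> {0..1}"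
      proof (rule image_subsetI)
        fix t :: real assume "t \<in> {0..1}"
        from in01[OF this] show "m - m * t \<in> {0..1}" using m by auto
      qed
    qed (intro continuous_intros)
    have "?g 0 \<noteq> ?g 1" using inj[of m 0] m by simp
    then have nc: "\<not> ?g constant_on {0..1}" unfolding constant_on_def by (metis atLeastAtMost_iff order_refl zero_le_one)
    obtain t where t: "t \<in> {0..1}" "len 0 t ?g = (1 - 2 * s) * len 0 1 ?g" "std_param ?g (1 - 2 * s) = ?g t"
      using std_param_eq[OF cg nc, of "1 - 2 * s"] s True by auto
    have mt: "0 \<le> m * t" "m * t \<le> m" using t m by (auto simp: mult_left_le)
    have l: "len 0 q ?g = len (m - m * q) m \<gamma>" if "q \<in> {0..1}" for q
    proof -
      have "0 \<le> m * q" "m * q \<le> m" using that m by (auto simp: mult_left_le)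
      then have "continuous_on {m - m * q..m - m * 0} \<gamma>" by (intro continuous_on_subset[OF c]) (use m in auto)
      from len_affine_neg[OF m(1) this] show ?thesis by simp
    qed
    define v where "v = m - m * t"
    have v: "0 \<le> v" "v \<le> m" "v \<le> 1" using mt m by (auto simp: v_def)
    have "len v m \<gamma> = (1 - 2 * s) * len 0 m \<gamma>" using t(2) l[OF t(1)] l[of 1] by (simp add: v_def)
    then have "midpoint_relation \<gamma> m s (m - m * t)"
      using m s v unfolding v_def[symmetric] by (simp add: midpoint_relation_def)
    moreover have "mid_param \<gamma> s = \<gamma> (m - m * t)"
      using True t(3) by (simp add: mid_param_def m_def[symmetric] Let_def)
    ultimately show ?thesis using that by blast
  next
    case False
    let ?g = "\<lambda>t. \<gamma> (m + (1 - m) * t)"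
    have in01: "0 \<le> (1 - m) * t" "(1 - m) * t \<le> 1 - m" if "t \<in> {0..1}" for t
      using that m by (auto simp: mult_left_le)
    have cg: "continuous_on {0..1} ?g"
    proof (rule continuous_on_compose2[OF c])
      show "(\<lambda>t. m + (1 - m) * t) ` {0..1} \<subseteq> {0..1}"
      proof (rule image_subsetI)
        fix t :: real assume "t \<in> {0..1}"
        from in01[OF this] show "m + (1 - m) * t \<in> {0..1}" using m unfolding atLeastAtMost_iff by linarith
      qed
    qed (intro continuous_intros)
    have "?g 0 \<noteq> ?g 1" using inj[of m 1] m by simp
    then have nc: "\<not> ?g constant_on {0..1}" unfolding constant_on_def by (metis atLeastAtMost_iff order_refl zero_le_one)
    obtain t where t: "t \<in> {0..1}" "len 0 t ?g = (2 * s - 1) * len 0 1 ?g" "std_param ?g (2 * s - 1) = ?g t"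
      using std_param_eq[OF cg nc, of "2 * s - 1"] s False by auto
    note mt = in01[OF t(1)]
    have l: "len 0 q ?g = len m (m + (1 - m) * q) \<gamma>" if "q \<in> {0..1}" for q
    proof -
      have "m + (1 - m) * q \<le> 1" using in01[OF that] by linarith
      then have "continuous_on {m + (1 - m) * 0..m + (1 - m) * q} \<gamma>"
        by (intro continuous_on_subset[OF c] subsetI) (use m in \<open>simp only: atLeastAtMost_iff, linarith\<close>)
      from len_affine_pos[OF _ this] m show ?thesis by simp
    qed
    have "len m (m + (1 - m) * t) \<gamma> = (2 * s - 1) * len m 1 \<gamma>" using t(2) l[OF t(1)] l[of 1] by simp
    \<comment> \<open>The second half is measured by \<open>len m 1 \<gamma>\<close>; the midpoint
      condition replaces this by \<open>len 0 m \<gamma>\<close>.\<close>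
    then have "- len m (m + (1 - m) * t) \<gamma> = (1 - 2 * s) * len 0 m \<gamma>" using m(3) by (simp add: algebra_simps)
    moreover have "m + (1 - m) * t \<le> 1" using mt by linarith
    ultimately have "midpoint_relation \<gamma> m s (m + (1 - m) * t)"
      using m s mt(1) by (simp add: midpoint_relation_def)
    moreover have "mid_param \<gamma> s = \<gamma> (m + (1 - m) * t)"
      using False t(3) by (simp add: mid_param_def m_def[symmetric] Let_def)
    ultimately show ?thesis using that by blast
  qed
qed

text \<open>The relation alone determines the value, so the choice operators hidden in
  \<open>mid_param\<close> are not unfolded any more.\<close>

lemma mid_param_relation:
  fixes \<gamma> :: "real \<Rightarrow> 'a::euclidean_space"
  assumes \<gamma>: "arc \<gamma>" and r: "midpoint_relation \<gamma> m s v"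
  shows "mid_param \<gamma> s = \<gamma> v"
proof -
  have "s \<in> {0..1}" using r by (simp add: midpoint_relation_def)
  then obtain m' v' where "midpoint_relation \<gamma> m' s v'" "mid_param \<gamma> s = \<gamma> v'" using mid_param_eq[OF \<gamma>] by blast
  then show ?thesis using midpoint_relation_unique[OF \<gamma> r] by simp
qed

lemma bij_betw_mid_param:
  fixes \<gamma> :: "real \<Rightarrow> 'a::euclidean_space"
  assumes \<gamma>: "arc \<gamma>"
  shows "bij_betw (mid_param \<gamma>) {0..1} (\<gamma> ` {0..1})"
  unfolding bij_betw_def
proof
  show "inj_on (mid_param \<gamma>) {0..1}"
  proof (rule inj_onI)
    fix s s' :: real assume s: "s \<in> {0..1}" "s' \<in> {0..1}" "mid_param \<gamma> s = mid_param \<gamma> s'"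
    obtain m v where v: "midpoint_relation \<gamma> m s v" "mid_param \<gamma> s = \<gamma> v" using mid_param_eq[OF \<gamma> s(1)] .
    obtain m' v' where v': "midpoint_relation \<gamma> m' s' v'" "mid_param \<gamma> s' = \<gamma> v'" using mid_param_eq[OF \<gamma> s(2)] .
    have "v = v'" using arcD(2)[OF \<gamma>, of v v'] v v' s(3) by (simp add: midpoint_relation_def)
    then show "s = s'" using midpoint_relation_inj[OF \<gamma>] v v' by blast
  qed
  show "mid_param \<gamma> ` {0..1} = \<gamma> ` {0..1}"
  proof safe
    fix s :: real assume s: "s \<in> {0..1}"
    obtain m v where v: "midpoint_relation \<gamma> m s v" "mid_param \<gamma> s = \<gamma> v" using mid_param_eq[OF \<gamma> s] .
    then show "mid_param \<gamma> s \<in> \<gamma> ` {0..1}" by (auto simp: midpoint_relation_def)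
  next
    fix v :: real assume "v \<in> {0..1}"
    then obtain m s where r: "midpoint_relation \<gamma> m s v" using midpoint_relation_surj[OF \<gamma>] by blast
    then have "mid_param \<gamma> s = \<gamma> v" "s \<in> {0..1}" using mid_param_relation[OF \<gamma> r] by (auto simp: midpoint_relation_def)
    then show "\<gamma> v \<in> mid_param \<gamma> ` {0..1}" by (metis imageI)
  qed
qed

lemma mid_param_ends:
  fixes \<gamma> :: "real \<Rightarrow> 'a::euclidean_space"
  assumes \<gamma>: "arc \<gamma>"
  shows "mid_param \<gamma> 0 = \<gamma> 0" "mid_param \<gamma> 1 = \<gamma> 1"
proof -
  define m where "m = len_midpoint \<gamma>"
  have m: "0 < m" "m < 1" "len 0 m \<gamma> = len m 1 \<gamma>" using len_midpoint[OF \<gamma>] by (auto simp: m_def)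
  have "midpoint_relation \<gamma> m 0 0" "midpoint_relation \<gamma> m 1 1" using m by (auto simp: midpoint_relation_def)
  then show "mid_param \<gamma> 0 = \<gamma> 0" "mid_param \<gamma> 1 = \<gamma> 1" using mid_param_relation[OF \<gamma>] by blast+
qed

lemma tendsto_via_subseq:
  fixes f :: "nat \<Rightarrow> 'a::metric_space"
  assumes "\<And>r. strict_mono (r :: nat \<Rightarrow> nat) \<Longrightarrow> \<exists>r'. strict_mono (r' :: nat \<Rightarrow> nat) \<and> (\<lambda>n. f (r (r' n))) \<longlonglongrightarrow> l"
  shows "f \<longlonglongrightarrow> l"
proof (rule ccontr)
  assume "\<not> f \<longlonglongrightarrow> l"
  then obtain e where e: "0 < e" "\<not> (\<forall>\<^sub>F n in sequentially. dist (f n) l < e)" unfolding tendsto_iff by blast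
  then have "infinite {n. \<not> dist (f n) l < e}"
    by (simp add: eventually_cofinite[symmetric] cofinite_eq_sequentially)
  then obtain r where r: "strict_mono (r :: nat \<Rightarrow> nat)" "\<And>n. r n \<in> {n. \<not> dist (f n) l < e}"
    using infinite_enumerate by blast
  obtain r' where "(\<lambda>n. f (r (r' n))) \<longlonglongrightarrow> l" using assms[OF r(1)] by blast
  then have "\<forall>\<^sub>F n in sequentially. dist (f (r (r' n))) l < e" using e(1) by (rule tendstoD)
  then show False using r(2) by (auto simp: eventually_sequentially)
qed

lemma mid_param_tendsto:
  fixes \<gamma> :: "real \<Rightarrow> 'a::euclidean_space"
  assumes \<gamma>n: "\<And>n. arc (\<gamma>n n)" and \<gamma>: "arc \<gamma>" and u: "uniform_limit {0..1} \<gamma>n \<gamma> sequentially"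
    and s: "\<And>n. s n \<in> {0..1}" "s \<longlonglongrightarrow> s'"
  shows "(\<lambda>n. mid_param (\<gamma>n n) (s n)) \<longlonglongrightarrow> mid_param \<gamma> s'"
proof (rule tendsto_via_subseq)
  fix r :: "nat \<Rightarrow> nat" assume r: "strict_mono r"
  have "\<exists>m v. midpoint_relation (\<gamma>n n) m (s n) v \<and> mid_param (\<gamma>n n) (s n) = \<gamma>n n v" for n
    using mid_param_eq[OF \<gamma>n s(1)] by blast
  then obtain m v where mv: "\<And>n. midpoint_relation (\<gamma>n n) (m n) (s n) (v n)" "\<And>n. mid_param (\<gamma>n n) (s n) = \<gamma>n n (v n)"
    by metis
  have m01: "m n \<in> {0..1}" "v n \<in> {0..1}" for n using mv(1)[of n] by (auto simp: midpoint_relation_def)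
  \<comment> \<open>Indexing the two sequences by a boolean extracts one common subsequence.\<close>
  have mv01: "(if i then m (r n) else v (r n)) \<in> {0..1}" if "i \<in> UNIV" for i n using m01 by simp
  have "\<exists>r1 l. strict_mono (r1 :: nat \<Rightarrow> nat) \<and>
      (\<forall>i\<in>UNIV. l i \<in> {0..1} \<and> (\<lambda>n. (if i then m (r (r1 n)) else v (r (r1 n)))) \<longlonglongrightarrow> l i)"
    by (rule finite_family_convergent_subseq[OF finite compact_Icc mv01])
  then obtain r1 l where l: "strict_mono (r1 :: nat \<Rightarrow> nat)"
    "\<forall>i\<in>UNIV. l i \<in> {0..1} \<and> (\<lambda>n. (if i then m (r (r1 n)) else v (r (r1 n)))) \<longlonglongrightarrow> l i"
    by (elim exE conjE)
  define R where "R = (\<lambda>n. r (r1 n))"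
  have R: "strict_mono R" unfolding R_def using strict_mono_o[OF r l(1)] by (simp add: o_def)
  have ml: "(\<lambda>n. m (R n)) \<longlonglongrightarrow> l True" and vl: "(\<lambda>n. v (R n)) \<longlonglongrightarrow> l False" and l01: "l True \<in> {0..1}" "l False \<in> {0..1}"
    using l(2)[rule_format, of True] l(2)[rule_format, of False] by (auto simp: R_def)
  have sl: "(\<lambda>n. s (R n)) \<longlonglongrightarrow> s'" using LIMSEQ_subseq_LIMSEQ[OF s(2) R] by (simp add: o_def)
  have s'01: "s' \<in> {0..1}" by (rule closed_sequentially[OF closed_atLeastAtMost _ s(2)]) (use s(1) in auto)
  note uR = uniform_limit_subseq[OF u R]
  have T: "(\<lambda>n. len (c n) (d n) (\<gamma>n (R n))) \<longlonglongrightarrow> len c' d' \<gamma>"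
    if "c \<longlonglongrightarrow> c'" "d \<longlonglongrightarrow> d'" "\<And>n. 0 \<le> c n" "\<And>n. c n \<le> d n" "\<And>n. d n \<le> 1" for c c' d d'
    by (rule len_tendsto_ends[OF arcD(1)[OF \<gamma>n] arcD(1)[OF \<gamma>] uR that])
  have b: "0 \<le> m n" "m n \<le> 1" "0 \<le> v n" "v n \<le> 1" for n using m01[of n] by auto
  have 1: "(\<lambda>n. len 0 (m (R n)) (\<gamma>n (R n))) \<longlonglongrightarrow> len 0 (l True) \<gamma>"
    by (intro T tendsto_const ml b) simp
  have 2: "(\<lambda>n. len (m (R n)) 1 (\<gamma>n (R n))) \<longlonglongrightarrow> len (l True) 1 \<gamma>"
    by (intro T tendsto_const ml b) simp
  have 3: "(\<lambda>n. len (min (v (R n)) (m (R n))) (m (R n)) (\<gamma>n (R n))) \<longlonglongrightarrow> len (min (l False) (l True)) (l True) \<gamma>"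
    by (intro T tendsto_min ml vl b) (use b in auto)
  have 4: "(\<lambda>n. len (m (R n)) (max (v (R n)) (m (R n))) (\<gamma>n (R n))) \<longlonglongrightarrow> len (l True) (max (l False) (l True)) \<gamma>"
    by (intro T tendsto_max ml vl b) (use b in auto)
  have "len 0 (l True) \<gamma> = len (l True) 1 \<gamma>"
    by (rule LIMSEQ_unique[OF 1]) (use 2 mv(1) in \<open>simp add: midpoint_relation_def\<close>)
  moreover have "len (min (l False) (l True)) (l True) \<gamma> - len (l True) (max (l False) (l True)) \<gamma> = (1 - 2 * s') * len 0 (l True) \<gamma>"
  proof (rule LIMSEQ_unique[OF tendsto_diff[OF 3 4]])
    have "(\<lambda>n. (1 - 2 * s (R n)) * len 0 (m (R n)) (\<gamma>n (R n))) \<longlonglongrightarrow> (1 - 2 * s') * len 0 (l True) \<gamma>"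
      by (intro tendsto_intros sl 1)
    then show "(\<lambda>n. len (min (v (R n)) (m (R n))) (m (R n)) (\<gamma>n (R n)) - len (m (R n)) (max (v (R n)) (m (R n))) (\<gamma>n (R n)))
        \<longlonglongrightarrow> (1 - 2 * s') * len 0 (l True) \<gamma>"
      using mv(1) by (simp add: midpoint_relation_def)
  qed
  ultimately have "midpoint_relation \<gamma> (l True) s' (l False)" using l01 s'01 by (simp add: midpoint_relation_def)
  then have "mid_param \<gamma> s' = \<gamma> (l False)" by (rule mid_param_relation[OF \<gamma>])
  moreover have "(\<lambda>n. \<gamma>n (R n) (v (R n))) \<longlonglongrightarrow> \<gamma> (l False)"
    by (rule uniform_limit_tendsto_compose[OF uR arcD(1)[OF \<gamma>] vl m01(2) l01(2)])
  ultimately have "(\<lambda>n. mid_param (\<gamma>n (R n)) (s (R n))) \<longlonglongrightarrow> mid_param \<gamma> s'" using mv(2) by simp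
  then show "\<exists>r'. strict_mono (r' :: nat \<Rightarrow> nat) \<and> (\<lambda>n. mid_param (\<gamma>n (r (r' n))) (s (r (r' n)))) \<longlonglongrightarrow> mid_param \<gamma> s'"
    using l(1) unfolding R_def by blast
qed

section \<open>Arcs and their parameterizations\<close>

lemma parameterizes_iff_arc:
  fixes \<gamma> :: "real \<Rightarrow> 'a::metric_space"
  shows "parameterizes \<gamma> A \<longleftrightarrow> arc \<gamma> \<and> \<gamma> ` {0..1} = A"
proof
  assume "parameterizes \<gamma> A"
  then obtain \<gamma>' where "homeomorphism {0..1} A \<gamma> \<gamma>'" by (auto simp: parameterizes_def)
  then show "arc \<gamma> \<and> \<gamma> ` {0..1} = A"
    unfolding arc_def path_def homeomorphism_def by (metis inj_on_inverseI)
next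
  assume "arc \<gamma> \<and> \<gamma> ` {0..1} = A"
  then show "parameterizes \<gamma> A"
    unfolding parameterizes_def using homeomorphism_compact[of "{0..1}" \<gamma> A] by (auto simp: arc_def path_def)
qed

lemma mono_homeomorphism_01:
  fixes \<phi> :: "real \<Rightarrow> real"
  assumes h: "homeomorphism {0..1} {0..1} \<phi> \<psi>" and m: "mono_on {0..1} \<phi>"
  shows "\<phi> 0 = 0" "\<phi> 1 = 1" "mono_on {0..1} \<psi>" "\<And>t. t \<in> {0..1} \<Longrightarrow> \<phi> t \<in> {0..1}" "\<And>t. t \<in> {0..1} \<Longrightarrow> \<psi> t \<in> {0..1}"
    "\<And>t. t \<in> {0..1} \<Longrightarrow> \<phi> (\<psi> t) = t" "\<And>t. t \<in> {0..1} \<Longrightarrow> \<psi> (\<phi> t) = t"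
proof -
  have i: "\<phi> ` {0..1} = {0..1}" "\<psi> ` {0..1} = {0..1}" using h by (auto simp: homeomorphism_def)
  show 1: "\<And>t. t \<in> {0..1} \<Longrightarrow> \<phi> t \<in> {0..1}" and 2: "\<And>t. t \<in> {0..1} \<Longrightarrow> \<psi> t \<in> {0..1}" using i by blast+
  show 3: "\<And>t. t \<in> {0..1} \<Longrightarrow> \<phi> (\<psi> t) = t" and 4: "\<And>t. t \<in> {0..1} \<Longrightarrow> \<psi> (\<phi> t) = t"
    using h by (auto simp: homeomorphism_def)
  have mD: "\<phi> s \<le> \<phi> t" if "s \<in> {0..1}" "t \<in> {0..1}" "s \<le> t" for s t
    using m that by (auto simp: mono_on_def)
  show "\<phi> 0 = 0" using mD[of 0 "\<psi> 0"] 3[of 0] 2[of 0] 1[of 0] by auto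
  show "\<phi> 1 = 1" using mD[of "\<psi> 1" 1] 3[of 1] 2[of 1] 1[of 1] by auto
  show "mono_on {0..1} \<psi>"
  proof (rule mono_onI, rule ccontr)
    fix r s :: real assume rs: "r \<in> {0..1}" "s \<in> {0..1}" "r \<le> s" "\<not> \<psi> r \<le> \<psi> s"
    then have "s \<le> r" using mD[of "\<psi> s" "\<psi> r"] 2 3 by auto
    then show False using rs by auto
  qed
qed

lemma homeomorphism_reverse_01: "homeomorphism {0..1} {0..1} (\<lambda>t. 1 - t :: real) (\<lambda>t. 1 - t)"
  by (intro homeomorphismI continuous_intros) auto

lemma len_compose_mono:
  fixes \<gamma> :: "real \<Rightarrow> 'a::euclidean_space"
  assumes \<gamma>: "continuous_on {0..1} \<gamma>" and h: "homeomorphism {0..1} {0..1} \<phi> \<psi>" and m: "mono_on {0..1} \<phi>"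
    and eq: "\<And>t. t \<in> {0..1} \<Longrightarrow> \<eta> t = \<gamma> (\<phi> t)" and xy: "0 \<le> x" "x \<le> y" "y \<le> 1"
  shows "len x y \<eta> = len (\<phi> x) (\<phi> y) \<gamma>"
proof -
  note f = mono_homeomorphism_01[OF h m]
  have mD: "\<phi> s \<le> \<phi> t" if "s \<in> {0..1}" "t \<in> {0..1}" "s \<le> t" for s t
    using m that by (auto simp: mono_on_def)
  have mD': "\<psi> s \<le> \<psi> t" if "s \<in> {0..1}" "t \<in> {0..1}" "s \<le> t" for s t
    using f(3) that by (auto simp: mono_on_def)
  have sub: "{x..y} \<subseteq> {0..1}" "{\<phi> x..\<phi> y} \<subseteq> {0..1}" using xy f(4)[of x] f(4)[of y] by auto
  have "homeomorphism {x..y} {\<phi> x..\<phi> y} \<phi> \<psi>"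
  proof (rule homeomorphismI)
    show "continuous_on {x..y} \<phi>" "continuous_on {\<phi> x..\<phi> y} \<psi>"
      using h sub by (auto simp: homeomorphism_def intro: continuous_on_subset)
    show "\<phi> ` {x..y} \<subseteq> {\<phi> x..\<phi> y}" using xy by (auto intro!: mD)
    show "\<psi> ` {\<phi> x..\<phi> y} \<subseteq> {x..y}"
    proof (rule image_subsetI)
      fix t assume t: "t \<in> {\<phi> x..\<phi> y}"
      then have "\<psi> (\<phi> x) \<le> \<psi> t" "\<psi> t \<le> \<psi> (\<phi> y)" using sub xy f(4)[of x] f(4)[of y] by (auto intro!: mD')
      then show "\<psi> t \<in> {x..y}" using f(7)[of x] f(7)[of y] xy by auto
    qed
    show "\<psi> (\<phi> t) = t" if "t \<in> {x..y}" for t using f(7)[of t] that xy by auto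
    show "\<phi> (\<psi> t) = t" if "t \<in> {\<phi> x..\<phi> y}" for t using f(6)[of t] that sub by auto
  qed
  from len_homeomorphism[OF continuous_on_subset[OF \<gamma> sub(2)] this]
  have "len x y (\<gamma> \<circ> \<phi>) = len (\<phi> x) (\<phi> y) \<gamma>" .
  moreover have "continuous_on {x..y} (\<gamma> \<circ> \<phi>)"
    using h f(4) sub by (intro continuous_on_compose continuous_on_subset[OF \<gamma>]) (auto simp: homeomorphism_def intro: continuous_on_subset)
  then have "len x y (\<gamma> \<circ> \<phi>) = len x y \<eta>" using eq xy by (intro len_cong) auto
  ultimately show ?thesis by simp
qed

lemma arc_compose_homeomorphism:
  fixes \<gamma> :: "real \<Rightarrow> 'a::metric_space"
  assumes "arc \<gamma>" "homeomorphism {0..1} {0..1} \<phi> \<psi>" "\<And>t. t \<in> {0..1} \<Longrightarrow> \<eta> t = \<gamma> (\<phi> t)"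
  shows "arc \<eta>" "\<eta> ` {0..1} = \<gamma> ` {0..1}"
proof -
  have i: "\<phi> ` {0..1} = {0..1}" and c: "continuous_on {0..1} \<phi>" and inv: "\<And>t. t \<in> {0..1} \<Longrightarrow> \<psi> (\<phi> t) = t"
    using assms(2) by (auto simp: homeomorphism_def)
  have \<gamma>: "continuous_on {0..1} \<gamma>" "inj_on \<gamma> {0..1}" using assms(1) by (auto simp: arc_def path_def)
  have "continuous_on {0..1} (\<lambda>t. \<gamma> (\<phi> t))" by (rule continuous_on_compose2[OF \<gamma>(1) c]) (use i in auto)
  then have "continuous_on {0..1} \<eta>" by (rule continuous_on_eq) (simp add: assms(3))
  moreover have "inj_on \<eta> {0..1}"
  proof (rule inj_onI)
    fix x y :: real assume xy: "x \<in> {0..1}" "y \<in> {0..1}" "\<eta> x = \<eta> y"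
    have "\<phi> x \<in> {0..1}" "\<phi> y \<in> {0..1}" using xy i by blast+
    then have "\<phi> x = \<phi> y" using xy assms(3) inj_onD[OF \<gamma>(2)] by metis
    then show "x = y" using inv xy by metis
  qed
  ultimately show "arc \<eta>" by (simp add: arc_def path_def)
  have "\<eta> ` {0..1} = (\<lambda>t. \<gamma> (\<phi> t)) ` {0..1}" by (rule image_cong) (auto simp: assms(3))
  also have "\<dots> = \<gamma> ` \<phi> ` {0..1}" by (simp add: image_image)
  finally show "\<eta> ` {0..1} = \<gamma> ` {0..1}" by (simp only: i)
qed

text \<open>Since \<open>len\<close> is invariant, \<phi> carries midpoint and parameter of \<eta>
  to those of \<gamma> for the same \<open>s\<close>; monotonicity makes it commute with min and
  max.\<close>

lemma mid_param_compose_mono: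
  fixes \<gamma> :: "real \<Rightarrow> 'a::euclidean_space"
  assumes \<gamma>: "arc \<gamma>" and h: "homeomorphism {0..1} {0..1} \<phi> \<psi>" and m: "mono_on {0..1} \<phi>"
    and eq: "\<And>t. t \<in> {0..1} \<Longrightarrow> \<eta> t = \<gamma> (\<phi> t)" and s: "s \<in> {0..1}"
  shows "mid_param \<eta> s = mid_param \<gamma> s"
proof -
  have "arc \<eta>" using arc_compose_homeomorphism[OF \<gamma> h eq] by blast
  then obtain k v where k: "midpoint_relation \<eta> k s v" "mid_param \<eta> s = \<eta> v" using mid_param_eq[OF _ s] by blast
  note f = mono_homeomorphism_01[OF h m]
  have 01: "0 \<le> k" "k \<le> 1" "0 \<le> v" "v \<le> 1" using k(1) by (auto simp: midpoint_relation_def)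
  have l: "len x y \<eta> = len (\<phi> x) (\<phi> y) \<gamma>" if "0 \<le> x" "x \<le> y" "y \<le> 1" for x y
    by (rule len_compose_mono[OF arcD(1)[OF \<gamma>] h m eq that])
  have mm: "\<phi> (min v k) = min (\<phi> v) (\<phi> k)" "\<phi> (max v k) = max (\<phi> v) (\<phi> k)"
    using mono_onD[OF m, of v k] mono_onD[OF m, of k v] 01 by (cases "v \<le> k"; simp)+
  have "midpoint_relation \<gamma> (\<phi> k) s (\<phi> v)"
    using k(1) 01 f(1,2) f(4)[of k] f(4)[of v] l[of 0 k] l[of k 1] l[of "min v k" k] l[of k "max v k"] mm
    by (simp add: midpoint_relation_def)
  then have "mid_param \<gamma> s = \<gamma> (\<phi> v)" by (rule mid_param_relation[OF \<gamma>])
  then show ?thesis using k(2) eq[of v] 01 by simp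
qed

text \<open>Reversal exchanges the two terms on the left of the signed equation and so changes its
  sign; replacing \<open>s\<close> by \<open>1 - s\<close> does the same to the factor
  \<open>1 - 2 * s\<close>.\<close>

lemma mid_param_reverse:
  fixes \<gamma> :: "real \<Rightarrow> 'a::euclidean_space"
  assumes \<gamma>: "arc \<gamma>" and eq: "\<And>t. t \<in> {0..1} \<Longrightarrow> \<eta> t = \<gamma> (1 - t)" and s: "s \<in> {0..1}"
  shows "mid_param \<eta> s = mid_param \<gamma> (1 - s)"
proof -
  have a: "arc \<eta>" using arc_compose_homeomorphism[OF \<gamma> homeomorphism_reverse_01 eq] by blast
  then obtain k v where k: "midpoint_relation \<eta> k s v" "mid_param \<eta> s = \<eta> v" using mid_param_eq[OF _ s] by blast
  have 01: "0 \<le> k" "k \<le> 1" "0 \<le> v" "v \<le> 1" using k(1) by (auto simp: midpoint_relation_def)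
  have l: "len x y \<eta> = len (1 - y) (1 - x) \<gamma>" if "0 \<le> x" "x \<le> y" "y \<le> 1" for x y
  proof -
    have "continuous_on {1 - 1 * y..1 - 1 * x} \<gamma>" by (rule continuous_on_subset[OF arcD(1)[OF \<gamma>]]) (use that in auto)
    from len_affine_neg[OF zero_less_one this]
    have "len x y (\<lambda>t. \<gamma> (1 - 1 * t)) = len (1 - y) (1 - x) \<gamma>" by simp
    moreover have "len x y \<eta> = len x y (\<lambda>t. \<gamma> (1 - 1 * t))"
      by (rule len_cong) (use that eq in \<open>auto intro: continuous_on_subset[OF arcD(1)[OF a]]\<close>)
    ultimately show ?thesis by simp
  qed
  have mm: "1 - min v k = max (1 - v) (1 - k)" "1 - max v k = min (1 - v) (1 - k)" by auto
  have T: "len 0 (1 - k) \<gamma> = len 0 k \<eta>" "len (1 - k) 1 \<gamma> = len 0 k \<eta>"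
    using l[of 0 k] l[of k 1] 01 k(1) by (simp_all add: midpoint_relation_def)
  have "len (min (1 - v) (1 - k)) (1 - k) \<gamma> - len (1 - k) (max (1 - v) (1 - k)) \<gamma>
      = - (len (min v k) k \<eta> - len k (max v k) \<eta>)"
    using l[of "min v k" k] l[of k "max v k"] 01 unfolding mm by simp
  also have "\<dots> = - ((1 - 2 * s) * len 0 k \<eta>)" using k(1) by (simp add: midpoint_relation_def)
  also have "\<dots> = (1 - 2 * (1 - s)) * len 0 (1 - k) \<gamma>" unfolding T by (simp add: algebra_simps)
  finally have "midpoint_relation \<gamma> (1 - k) (1 - s) (1 - v)"
    using 01 s T by (simp add: midpoint_relation_def)
  then have "mid_param \<gamma> (1 - s) = \<gamma> (1 - v)" by (rule mid_param_relation[OF \<gamma>])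
  then show ?thesis using k(2) eq[of v] 01 by simp
qed

lemma parameterizes_reverse:
  fixes \<gamma> :: "real \<Rightarrow> 'a::metric_space"
  assumes "parameterizes \<gamma> A" shows "parameterizes (\<lambda>t. \<gamma> (1 - t)) A"
  using assms arc_compose_homeomorphism[OF _ homeomorphism_reverse_01, of \<gamma> "\<lambda>t. \<gamma> (1 - t)"]
  by (simp add: parameterizes_iff_arc)

text \<open>The transition map is injective and continuous, hence monotone. A decreasing one is
  absorbed by reversing \<eta>, so that \<phi> is increasing in both cases.\<close>

lemma parameterizations_cases:
  fixes \<gamma> \<eta> :: "real \<Rightarrow> 'a::metric_space"
  assumes \<gamma>: "parameterizes \<gamma> A" and \<eta>: "parameterizes \<eta> A"
  shows "\<exists>\<phi> \<psi>. homeomorphism {0..1} {0..1} \<phi> \<psi> \<and> mono_on {0..1} \<phi> \<and>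
     ((\<forall>t\<in>{0..1}. \<eta> t = \<gamma> (\<phi> t)) \<or> (\<forall>t\<in>{0..1}. \<eta> (1 - t) = \<gamma> (\<phi> t)))"
proof -
  obtain \<gamma>' where g: "homeomorphism {0..1} A \<gamma> \<gamma>'" using \<gamma> by (auto simp: parameterizes_def)
  obtain \<eta>' where e: "homeomorphism {0..1} A \<eta> \<eta>'" using \<eta> by (auto simp: parameterizes_def)
  have h: "homeomorphism {0..1} {0..1} (\<gamma>' \<circ> \<eta>) (\<eta>' \<circ> \<gamma>)"
    using homeomorphism_compose[OF e homeomorphism_symD[OF g]] .
  then have c: "continuous_on {0..1} (\<gamma>' \<circ> \<eta>)" "inj_on (\<gamma>' \<circ> \<eta>) {0..1}"
    unfolding homeomorphism_def by (blast, metis inj_on_inverseI)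
  have eq: "\<eta> t = \<gamma> ((\<gamma>' \<circ> \<eta>) t)" if "t \<in> {0..1}" for t
  proof -
    have "\<eta> t \<in> A" using e that unfolding homeomorphism_def by blast
    then show ?thesis using g by (simp add: homeomorphism_def)
  qed
  from continuous_inj_mono_or_antimono[OF c] show ?thesis
  proof
    assume "mono_on {0..1} (\<gamma>' \<circ> \<eta>)"
    then show ?thesis using h eq by blast
  next
    assume an: "antimono_on {0..1} (\<gamma>' \<circ> \<eta>)"
    have "homeomorphism {0..1} {0..1} ((\<gamma>' \<circ> \<eta>) \<circ> (\<lambda>t. 1 - t)) ((\<lambda>t. 1 - t) \<circ> (\<eta>' \<circ> \<gamma>))"
      by (rule homeomorphism_compose[OF homeomorphism_reverse_01 h])
    moreover have "mono_on {0..1} ((\<gamma>' \<circ> \<eta>) \<circ> (\<lambda>t. 1 - t))"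
      using an by (auto simp: monotone_on_def)
    moreover have "\<forall>t\<in>{0..1}. \<eta> (1 - t) = \<gamma> (((\<gamma>' \<circ> \<eta>) \<circ> (\<lambda>t. 1 - t)) t)"
      using eq by auto
    ultimately show ?thesis by blast
  qed
qed

lemma arc_ends_eq:
  fixes \<gamma> :: "real \<Rightarrow> 'a::metric_space"
  assumes \<gamma>: "parameterizes \<gamma> A"
  shows "arc_ends A = {\<gamma> 0, \<gamma> 1}"
proof
  show "{\<gamma> 0, \<gamma> 1} \<subseteq> arc_ends A" using \<gamma> by (auto simp: arc_ends_def)
  show "arc_ends A \<subseteq> {\<gamma> 0, \<gamma> 1}"
  proof
    fix p assume "p \<in> arc_ends A"
    then obtain \<eta> where \<eta>: "parameterizes \<eta> A" "p = \<eta> 0 \<or> p = \<eta> 1" by (auto simp: arc_ends_def)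
    obtain \<phi> \<psi> where \<phi>: "homeomorphism {0..1} {0..1} \<phi> \<psi>" "mono_on {0..1} \<phi>"
     "(\<forall>t\<in>{0..1}. \<eta> t = \<gamma> (\<phi> t)) \<or> (\<forall>t\<in>{0..1}. \<eta> (1 - t) = \<gamma> (\<phi> t))"
      using parameterizations_cases[OF \<gamma> \<eta>(1)] by blast
    have "\<phi> 0 = 0" "\<phi> 1 = 1" using mono_homeomorphism_01[OF \<phi>(1,2)] by auto
    moreover have "\<eta> 0 = \<gamma> (\<phi> 0) \<and> \<eta> 1 = \<gamma> (\<phi> 1) \<or> \<eta> 1 = \<gamma> (\<phi> 0) \<and> \<eta> 0 = \<gamma> (\<phi> 1)"
      using \<phi>(3)
    proof
      assume "\<forall>t\<in>{0..1}. \<eta> t = \<gamma> (\<phi> t)" then show ?thesis by simp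
    next
      assume *: "\<forall>t\<in>{0..1}. \<eta> (1 - t) = \<gamma> (\<phi> t)"
      show ?thesis using bspec[OF *, of 0] bspec[OF *, of 1] by simp
    qed
    ultimately show "p \<in> {\<gamma> 0, \<gamma> 1}" using \<eta>(2) by auto
  qed
qed

lemma parameterizes_ends:
  fixes \<gamma> :: "real \<Rightarrow> 'a::metric_space"
  assumes "parameterizes \<gamma> A" shows "\<gamma> 0 \<noteq> \<gamma> 1" "\<gamma> 0 \<in> A" "\<gamma> 1 \<in> A"
  using assms inj_onD[of \<gamma> "{0..1}" 0 1] by (auto simp: parameterizes_iff_arc arc_def)

lemma mid_param_same_start:
  fixes \<gamma> \<eta> :: "real \<Rightarrow> 'a::euclidean_space"
  assumes \<gamma>: "parameterizes \<gamma> A" and \<eta>: "parameterizes \<eta> A" and 0: "\<gamma> 0 = \<eta> 0" and s: "s \<in> {0..1}"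
  shows "mid_param \<eta> s = mid_param \<gamma> s"
proof -
  obtain \<phi> \<psi> where \<phi>: "homeomorphism {0..1} {0..1} \<phi> \<psi>" "mono_on {0..1} \<phi>"
     "(\<forall>t\<in>{0..1}. \<eta> t = \<gamma> (\<phi> t)) \<or> (\<forall>t\<in>{0..1}. \<eta> (1 - t) = \<gamma> (\<phi> t))"
    using parameterizations_cases[OF \<gamma> \<eta>] by blast
  have "\<phi> 0 = 0" using mono_homeomorphism_01[OF \<phi>(1,2)] by auto
  then have "\<not> (\<forall>t\<in>{0..1}. \<eta> (1 - t) = \<gamma> (\<phi> t))"
    using 0 parameterizes_ends(1)[OF \<eta>] by (intro notI) (drule bspec[of _ _ 0], auto)
  then have "\<And>t. t \<in> {0..1} \<Longrightarrow> \<eta> t = \<gamma> (\<phi> t)" using \<phi>(3) by blast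
  from mid_param_compose_mono[where \<gamma> = \<gamma> and \<eta> = \<eta>, OF _ \<phi>(1,2) this s] show ?thesis using \<gamma> by (simp add: parameterizes_iff_arc)
qed

lemma mid_param_opposite_start:
  fixes \<gamma> \<eta> :: "real \<Rightarrow> 'a::euclidean_space"
  assumes \<gamma>: "parameterizes \<gamma> A" and \<eta>: "parameterizes \<eta> A" and 0: "\<eta> 0 = \<gamma> 1" and s: "s \<in> {0..1}"
  shows "mid_param \<eta> s = mid_param \<gamma> (1 - s)"
proof -
  have "mid_param \<eta> s = mid_param (\<lambda>t. \<gamma> (1 - t)) s"
    by (rule mid_param_same_start[OF parameterizes_reverse[OF \<gamma>] \<eta> _ s]) (simp add: 0)
  also have "\<dots> = mid_param \<gamma> (1 - s)"
    by (rule mid_param_reverse) (use \<gamma> s in \<open>auto simp: parameterizes_iff_arc\<close>)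
  finally show ?thesis .
qed

section \<open>Monotone reparameterizations and the distance \<open>rho\<close>\<close>

lemma mono_onto_continuous:
  fixes \<phi> :: "real \<Rightarrow> real"
  assumes m: "mono_on {0..1} \<phi>" and i: "\<phi> ` {0..1} = {0..1}"
  shows "\<phi> 0 = 0" "\<phi> 1 = 1" "continuous_on {0..1} \<phi>"
proof -
  have mD: "\<phi> s \<le> \<phi> t" if "0 \<le> s" "s \<le> t" "t \<le> 1" for s t
    using m that by (auto simp: mono_on_def)
  have in01: "0 \<le> \<phi> t \<and> \<phi> t \<le> 1" if "0 \<le> t" "t \<le> 1" for t
  proof -
    have "\<phi> t \<in> \<phi> ` {0..1}" using that by auto
    then show ?thesis unfolding i by simp
  qed
  have on: "\<exists>t. 0 \<le> t \<and> t \<le> 1 \<and> \<phi> t = y" if "0 \<le> y" "y \<le> 1" for y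
  proof -
    have "y \<in> \<phi> ` {0..1}" unfolding i using that by simp
    then show ?thesis by auto
  qed
  show "\<phi> 0 = 0" using on[of 0] mD[of 0] in01[of 0] by force
  show "\<phi> 1 = 1" using on[of 1] mD[of _ 1] in01[of 1] by force
  \<comment> \<open>Extended by the identity, \<phi> becomes a monotone map of the line onto itself,
    and such a map cannot jump.\<close>
  define \<Phi> where "\<Phi> = (\<lambda>t. if 0 \<le> t \<and> t \<le> 1 then \<phi> t else t)"
  have "\<exists>t. \<Phi> t = y" for y
    using on[of y] by (cases "0 \<le> y \<and> y \<le> 1") (auto simp: \<Phi>_def)
  then have "range \<Phi> = UNIV" by (metis UNIV_eq_I rangeI)
  then have "continuous_on UNIV \<Phi>"
  proof (intro continuous_onI_mono)
    fix x y :: real assume "x \<le> y"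
    then show "\<Phi> x \<le> \<Phi> y" using mD[of x y] in01[of x] in01[of y] by (auto simp: \<Phi>_def)
  qed simp
  then have "continuous_on {0..1} \<Phi>" by (rule continuous_on_subset) simp
  then show "continuous_on {0..1} \<phi>" by (rule continuous_on_eq) (simp add: \<Phi>_def)
qed

text \<open>An arc is injective, yet constant on the fibres of \<open>m1\<close>. So
  \<open>m1\<close> is injective, and \<open>m2\<close> followed by the inverse of \<open>m1\<close>
  serves as \<phi>.\<close>

lemma reparam_equiv_arc:
  fixes \<eta> :: "real \<Rightarrow> 'a::metric_space"
  assumes \<eta>: "arc \<eta>" and eq: "reparam_equiv \<eta> \<zeta>"
  obtains \<phi> where "mono_on {0..1} \<phi>" "\<phi> ` {0..1} = {0..1}" "\<And>t. t \<in> {0..1} \<Longrightarrow> \<zeta> t = \<eta> (\<phi> t)"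
proof -
  obtain m1 m2 :: "real \<Rightarrow> real" where m1: "mono_on {0..1} m1" "m1 ` {0..1} = {0..1}"
    and m2: "mono_on {0..1} m2" "m2 ` {0..1} = {0..1}"
    and c: "\<forall>s\<in>{0..1}. \<eta> constant_on {t\<in>{0..1}. m1 t = s}"
    and f: "\<forall>s\<in>{0..1}. \<eta> ` {t\<in>{0..1}. m1 t = s} = \<zeta> ` {t\<in>{0..1}. m2 t = s}"
    using eq unfolding reparam_equiv_def by (elim conjE exE)
  note const = bspec[OF c] and fib = bspec[OF f]
  have inj: "p = q" if "p \<in> {0..1}" "q \<in> {0..1}" "m1 p = m1 q" for p q
  proof -
    have "m1 p \<in> {0..1}" using m1(2) that(1) by blast
    then have "\<eta> p = \<eta> q" using const[of "m1 p"] that unfolding constant_on_def by auto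
    then show ?thesis using \<eta> that by (auto simp: arc_def inj_on_def)
  qed
  have "\<exists>t'\<in>{0..1}. m1 t' = m2 t \<and> \<eta> t' = \<zeta> t" if t: "t \<in> {0..1}" for t
  proof -
    have "m2 t \<in> {0..1}" using m2(2) t by blast
    moreover have "\<zeta> t \<in> \<zeta> ` {t'\<in>{0..1}. m2 t' = m2 t}" using t by auto
    ultimately have "\<zeta> t \<in> \<eta> ` {t'\<in>{0..1}. m1 t' = m2 t}" using fib by blast
    then show ?thesis by auto
  qed
  then obtain \<phi> where \<phi>: "\<And>t. t \<in> {0..1} \<Longrightarrow> \<phi> t \<in> {0..1} \<and> m1 (\<phi> t) = m2 t \<and> \<eta> (\<phi> t) = \<zeta> t"
    by metis
  show ?thesis
  proof (rule that)
    show "mono_on {0..1} \<phi>"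
    proof (rule mono_onI, rule ccontr)
      fix r s :: real assume rs: "r \<in> {0..1}" "s \<in> {0..1}" "r \<le> s" "\<not> \<phi> r \<le> \<phi> s"
      have "m2 r \<le> m2 s" using m2(1) rs by (auto simp: mono_on_def)
      moreover have "m1 (\<phi> s) \<le> m1 (\<phi> r)"
        using mono_onD[OF m1(1), of "\<phi> s" "\<phi> r"] rs \<phi>[OF rs(1)] \<phi>[OF rs(2)] by auto
      ultimately have "m1 (\<phi> s) = m1 (\<phi> r)" using \<phi>[OF rs(1)] \<phi>[OF rs(2)] by simp
      then have "\<phi> s = \<phi> r" using inj \<phi>[OF rs(1)] \<phi>[OF rs(2)] by blast
      then show False using rs by simp
    qed
    show "\<phi> ` {0..1} = {0..1}"
    proof
      show "\<phi> ` {0..1} \<subseteq> {0..1}" using \<phi> by blast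
      show "{0..1} \<subseteq> \<phi> ` {0..1}"
      proof
        fix t' :: real assume t': "t' \<in> {0..1}"
        then have "m1 t' \<in> m2 ` {0..1}" using m1(2) m2(2) by blast
        then obtain t where t: "t \<in> {0..1}" "m2 t = m1 t'" by auto
        then have "\<phi> t = t'" using inj \<phi>[OF t(1)] t' by auto
        then show "t' \<in> \<phi> ` {0..1}" using t by auto
      qed
    qed
    show "\<zeta> t = \<eta> (\<phi> t)" if "t \<in> {0..1}" for t using \<phi>[OF that] by simp
  qed
qed

lemma reparam_equiv_refl: "path \<eta> \<Longrightarrow> reparam_equiv \<eta> \<eta>"
  unfolding reparam_equiv_def constant_on_def
  by (intro conjI exI[of _ "\<lambda>t. t"]) (auto simp: mono_on_def)

text \<open>A monotone onto map may be constant on intervals. Mixing in a little of the identity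
  makes it a homeomorphism and moves it by at most \<open>e\<close>.\<close>

lemma mono_onto_perturb:
  fixes \<phi> :: "real \<Rightarrow> real"
  assumes m: "mono_on {0..1} \<phi>" and i: "\<phi> ` {0..1} = {0..1}" and e: "0 < e" "e < 1"
  obtains \<psi> where "homeomorphism {0..1} {0..1} (\<lambda>t. (1 - e) * \<phi> t + e * t) \<psi>"
    "mono_on {0..1} (\<lambda>t. (1 - e) * \<phi> t + e * t)" "\<And>t. t \<in> {0..1} \<Longrightarrow> \<bar>(1 - e) * \<phi> t + e * t - \<phi> t\<bar> \<le> e"
proof -
  let ?f = "\<lambda>t. (1 - e) * \<phi> t + e * t"
  note p = mono_onto_continuous[OF m i]
  have c: "continuous_on {0..1} ?f" by (intro continuous_intros p)
  have less: "?f s < ?f t" if "0 \<le> s" "s < t" "t \<le> 1" for s t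
  proof -
    have "\<phi> s \<le> \<phi> t" using m that by (auto simp: mono_on_def)
    then have "(1 - e) * \<phi> s \<le> (1 - e) * \<phi> t" using e by (intro mult_left_mono) auto
    moreover have "e * s < e * t" using that e by simp
    ultimately show ?thesis by linarith
  qed
  have mono: "mono_on {0..1} ?f"
    by (rule mono_onI) (metis atLeastAtMost_iff less less_eq_real_def)
  have "inj_on ?f {0..1}"
  proof (rule inj_onI)
    fix x y :: real assume "x \<in> {0..1}" "y \<in> {0..1}" "?f x = ?f y"
    then show "x = y" using less[of x y] less[of y x] by (cases x y rule: linorder_cases) auto
  qed
  moreover have "?f ` {0..1} = {0..1}"
  proof
    have m2: "?f s \<le> ?f t" if "0 \<le> s" "s \<le> t" "t \<le> 1" for s t
      using mono that by (simp add: mono_on_def)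
    show "?f ` {0..1} \<subseteq> {0..1}"
      using m2[of 0] m2[of _ 1] p by auto
    show "{0..1} \<subseteq> ?f ` {0..1}"
    proof
      fix y :: real assume "y \<in> {0..1}"
      then obtain x where "0 \<le> x" "x \<le> 1" "?f x = y" using IVT'[of ?f 0 y 1] c p by auto
      then show "y \<in> ?f ` {0..1}" by force
    qed
  qed
  ultimately obtain \<psi> where "homeomorphism {0..1} {0..1} ?f \<psi>"
    using homeomorphism_compact[OF compact_Icc c] by blast
  moreover have "\<bar>?f t - \<phi> t\<bar> \<le> e" if "t \<in> {0..1}" for t
  proof -
    have "\<phi> t \<in> {0..1}" using i that by blast
    then have "\<bar>t - \<phi> t\<bar> \<le> 1" using that by auto
    then have "e * \<bar>t - \<phi> t\<bar> \<le> e" using e by (simp add: mult_left_le)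
    moreover have "?f t - \<phi> t = e * (t - \<phi> t)" by (simp add: algebra_simps)
    ultimately show ?thesis using e by (simp add: abs_mult)
  qed
  ultimately show ?thesis using that mono by blast
qed

text \<open>A pair of paths at distance below \<delta> has the form
  \<open>\<eta>1 \<circ> \<phi>1\<close> and \<open>\<eta>2 \<circ> \<phi>2\<close> with monotone
  maps. Once these are perturbed to homeomorphisms, the first can be inverted and moved to the other
  side.\<close>

lemma rho_less_imp_reparam:
  fixes \<eta>1 \<eta>2 :: "real \<Rightarrow> 'a::metric_space"
  assumes \<eta>1: "arc \<eta>1" and \<eta>2: "arc \<eta>2" and r: "rho (reparam_class \<eta>1) (reparam_class \<eta>2) < \<delta>"
  obtains \<phi> \<psi> where "homeomorphism {0..1} {0..1} \<phi> \<psi>" "mono_on {0..1} \<phi>"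
    "\<And>t. t \<in> {0..1} \<Longrightarrow> dist (\<eta>1 t) (\<eta>2 (\<phi> t)) < \<delta>"
proof -
  have p: "path \<eta>1" "path \<eta>2" using \<eta>1 \<eta>2 by (auto simp: arc_def)
  let ?F = "\<lambda>(\<zeta>1, \<zeta>2). SUP t\<in>{0..1::real}. dist (\<zeta>1 t) (\<zeta>2 t :: 'a)"
  have "?F ` (reparam_class \<eta>1 \<times> reparam_class \<eta>2) \<noteq> {}"
    using reparam_equiv_refl p by (auto simp: reparam_class_def)
  from cInf_lessD[OF this r[unfolded rho_def]] obtain \<zeta>1 \<zeta>2 where z: "reparam_equiv \<eta>1 \<zeta>1" "reparam_equiv \<eta>2 \<zeta>2"
    "(SUP t\<in>{0..1}. dist (\<zeta>1 t) (\<zeta>2 t)) < \<delta>" by (auto simp: reparam_class_def)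
  define \<sigma> where "\<sigma> = (SUP t\<in>{0..1}. dist (\<zeta>1 t) (\<zeta>2 t))"
  have "continuous_on {0..1} \<zeta>1" "continuous_on {0..1} \<zeta>2" using z by (auto simp: reparam_equiv_def path_def)
  then have "compact ((\<lambda>t. dist (\<zeta>1 t) (\<zeta>2 t)) ` {0..1})" by (intro compact_continuous_image continuous_intros compact_Icc)
  then have bdd: "bdd_above ((\<lambda>t. dist (\<zeta>1 t) (\<zeta>2 t)) ` {0..1})" by (intro bounded_imp_bdd_above compact_imp_bounded)
  have \<sigma>: "dist (\<zeta>1 t) (\<zeta>2 t) \<le> \<sigma>" if "t \<in> {0..1}" for t unfolding \<sigma>_def by (rule cSUP_upper[OF that bdd])
  obtain \<phi>1 where \<phi>1: "mono_on {0..1} \<phi>1" "\<phi>1 ` {0..1} = {0..1}" "\<And>t. t \<in> {0..1} \<Longrightarrow> \<zeta>1 t = \<eta>1 (\<phi>1 t)"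
    using reparam_equiv_arc[OF \<eta>1 z(1)] by blast
  obtain \<phi>2 where \<phi>2: "mono_on {0..1} \<phi>2" "\<phi>2 ` {0..1} = {0..1}" "\<And>t. t \<in> {0..1} \<Longrightarrow> \<zeta>2 t = \<eta>2 (\<phi>2 t)"
    using reparam_equiv_arc[OF \<eta>2 z(2)] by blast
  \<comment> \<open>Each of the two paths may use half of the slack for its perturbation.\<close>
  define \<epsilon> where "\<epsilon> = (\<delta> - \<sigma>) / 2"
  have \<epsilon>: "0 < \<epsilon>" using z(3) by (simp add: \<epsilon>_def \<sigma>_def)
  have "uniformly_continuous_on {0..1} \<eta>1" "uniformly_continuous_on {0..1} \<eta>2"
    using p by (auto simp: path_def intro: compact_uniformly_continuous)
  then obtain d1 d2 where d1: "d1 > 0" "\<And>x y. x \<in> {0..1} \<Longrightarrow> y \<in> {0..1} \<Longrightarrow> dist y x < d1 \<Longrightarrow> dist (\<eta>1 y) (\<eta>1 x) < \<epsilon>"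
    and d2: "d2 > 0" "\<And>x y. x \<in> {0..1} \<Longrightarrow> y \<in> {0..1} \<Longrightarrow> dist y x < d2 \<Longrightarrow> dist (\<eta>2 y) (\<eta>2 x) < \<epsilon>"
    using \<epsilon> unfolding uniformly_continuous_on_def by metis
  define e where "e = min (1/2) (min d1 d2 / 2)"
  have e: "0 < e" "e < 1" "e < d1" "e < d2" using d1(1) d2(1) by (auto simp: e_def)
  let ?f1 = "\<lambda>t. (1 - e) * \<phi>1 t + e * t" and ?f2 = "\<lambda>t. (1 - e) * \<phi>2 t + e * t"
  obtain \<psi>1 where f1: "homeomorphism {0..1} {0..1} ?f1 \<psi>1" "mono_on {0..1} ?f1" "\<And>t. t \<in> {0..1} \<Longrightarrow> \<bar>?f1 t - \<phi>1 t\<bar> \<le> e"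
    using mono_onto_perturb[OF \<phi>1(1,2) e(1,2)] by blast
  obtain \<psi>2 where f2: "homeomorphism {0..1} {0..1} ?f2 \<psi>2" "mono_on {0..1} ?f2" "\<And>t. t \<in> {0..1} \<Longrightarrow> \<bar>?f2 t - \<phi>2 t\<bar> \<le> e"
    using mono_onto_perturb[OF \<phi>2(1,2) e(1,2)] by blast
  note F1 = mono_homeomorphism_01[OF f1(1,2)] and F2 = mono_homeomorphism_01[OF f2(1,2)]
  show ?thesis
  proof (rule that)
    show "homeomorphism {0..1} {0..1} (?f2 \<circ> \<psi>1) (?f1 \<circ> \<psi>2)"
      by (rule homeomorphism_compose[OF homeomorphism_symD[OF f1(1)] f2(1)])
    show "mono_on {0..1} (?f2 \<circ> \<psi>1)"
    proof (rule mono_onI)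
      fix r s :: real assume rs: "r \<in> {0..1}" "s \<in> {0..1}" "r \<le> s"
      then have "\<psi>1 r \<le> \<psi>1 s" using F1(3) by (auto simp: mono_on_def)
      then show "(?f2 \<circ> \<psi>1) r \<le> (?f2 \<circ> \<psi>1) s"
        unfolding o_def by (rule mono_onD[OF f2(2) F1(5)[OF rs(1)] F1(5)[OF rs(2)]])
    qed
    fix t :: real assume t: "t \<in> {0..1}"
    let ?z = "\<psi>1 t"
    have z01: "?z \<in> {0..1}" using F1(5)[OF t] .
    have "\<phi>1 ?z \<in> {0..1}" "\<phi>2 ?z \<in> {0..1}" using \<phi>1(2) \<phi>2(2) z01 by blast+
    then have "dist (\<eta>1 (?f1 ?z)) (\<eta>1 (\<phi>1 ?z)) < \<epsilon>" "dist (\<eta>2 (?f2 ?z)) (\<eta>2 (\<phi>2 ?z)) < \<epsilon>"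
      using d1(2)[of "\<phi>1 ?z" "?f1 ?z"] d2(2)[of "\<phi>2 ?z" "?f2 ?z"] F1(4)[OF z01] F2(4)[OF z01] f1(3)[OF z01] f2(3)[OF z01] e
      by (auto simp: dist_real_def)
    moreover have "dist (\<eta>1 (\<phi>1 ?z)) (\<eta>2 (\<phi>2 ?z)) \<le> \<sigma>" using \<sigma>[OF z01] \<phi>1(3)[OF z01] \<phi>2(3)[OF z01] by simp
    ultimately have "dist (\<eta>1 (?f1 ?z)) (\<eta>2 (?f2 ?z)) < \<epsilon> + \<sigma> + \<epsilon>"
      using dist_triangle[of "\<eta>1 (?f1 ?z)" "\<eta>2 (?f2 ?z)" "\<eta>1 (\<phi>1 ?z)"]
        dist_triangle[of "\<eta>1 (\<phi>1 ?z)" "\<eta>2 (?f2 ?z)" "\<eta>2 (\<phi>2 ?z)"] dist_commute[of "\<eta>2 (\<phi>2 ?z)" "\<eta>2 (?f2 ?z)"] by linarith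
    then show "dist (\<eta>1 t) (\<eta>2 ((?f2 \<circ> \<psi>1) t)) < \<delta>" using F1(6)[OF t] by (simp add: \<epsilon>_def)
  qed
qed

section \<open>Convergence of arcs in a lamination\<close>

lemma lamination_parameterization:
  fixes L :: "'a::metric_space set set"
  assumes "lamination Y L" "B \<in> L"
  obtains \<beta> where "parameterizes \<beta> B"
proof -
  have "B homeomorphic {0..1::real}" using assms by (simp add: lamination_def)
  then obtain f g where "homeomorphism B {0..1::real} f g" by (auto simp: homeomorphic_def)
  then have "homeomorphism {0..1} B g f" by (rule homeomorphism_symD)
  then show ?thesis using that unfolding parameterizes_def by blast
qed

lemma lamination_unique_arc:
  fixes L :: "'a::metric_space set set"
  assumes L: "lamination Y L" and B: "B \<in> L" "B' \<in> L" "arc_ends B = arc_ends B'"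
  shows "B = B'"
proof (rule ccontr)
  assume ne: "B \<noteq> B'"
  obtain \<beta> where \<beta>: "parameterizes \<beta> B" using lamination_parameterization[OF L B(1)] .
  obtain \<beta>' where \<beta>': "parameterizes \<beta>' B'" using lamination_parameterization[OF L B(2)] .
  have "{\<beta> 0, \<beta> 1} = {\<beta>' 0, \<beta>' 1}" using arc_ends_eq[OF \<beta>] arc_ends_eq[OF \<beta>'] B(3) by simp
  then have "\<beta> 0 \<in> B \<inter> B'" "\<beta> 1 \<in> B \<inter> B'" "\<beta> 0 \<noteq> \<beta> 1"
    using parameterizes_ends[OF \<beta>] parameterizes_ends[OF \<beta>'] by (auto simp: doubleton_eq_iff)
  moreover have "\<forall>A\<in>L. \<forall>B\<in>L. A \<noteq> B \<longrightarrow> A \<inter> B = {} \<or> (\<exists>p. A \<inter> B = {p} \<and> p \<in> arc_ends A \<and> p \<in> arc_ends B)"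
    using L unfolding lamination_def by (elim conjE)
  then have "B \<inter> B' = {} \<or> (\<exists>p. B \<inter> B' = {p})" using B(1,2) ne by blast
  ultimately show False by (metis empty_iff singletonD)
qed

text \<open>The homeomorphisms of condition (3b) need not respect the direction of \<gamma>. One
  direction occurs infinitely often; if it is the opposite one, the limit arc is parameterized
  backwards.\<close>

lemma lamination_convergent_subseq:
  fixes L :: "'a::metric_space set set"
  assumes L: "lamination Y L" and B: "\<And>n. B n \<in> L" and \<gamma>: "\<And>n. parameterizes (\<gamma> n) (B n)"
    and nd: "\<not> (\<lambda>n. diameter (B n)) \<longlonglongrightarrow> 0"
  obtains r C \<beta> \<phi> \<psi> where "strict_mono (r :: nat \<Rightarrow> nat)" "C \<in> L" "parameterizes \<beta> C"
    "\<And>n. homeomorphism {0..1} {0..1} (\<phi> n) (\<psi> n)" "\<And>n. mono_on {0..1} (\<phi> n)"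
    "uniform_limit {0..1} (\<lambda>n t. \<gamma> (r n) (\<phi> n t)) \<beta> sequentially"
proof -
  have "\<exists>C\<in>L. \<exists>r :: nat \<Rightarrow> nat. \<exists>h h'. strict_mono r \<and> (\<forall>j. homeomorphism C (B (r j)) (h j) (h' j)) \<and>
      (\<lambda>j. SUP p\<in>C. dist (h j p) p) \<longlonglongrightarrow> 0"
  proof -
    have "\<forall>A :: nat \<Rightarrow> 'a set. range A \<subseteq> L \<longrightarrow>
        (if (\<lambda>i. diameter (A i)) \<longlonglongrightarrow> 0
         then \<forall>p. (\<forall>U. open U \<and> p \<in> U \<longrightarrow> infinite {i. A i \<inter> U \<noteq> {}}) \<longrightarrow> p \<in> lam_ends L \<or> p \<notin> Y
         else \<exists>B\<in>L. \<exists>r :: nat \<Rightarrow> nat. \<exists>h h'. strict_mono r \<and>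
                (\<forall>j. homeomorphism B (A (r j)) (h j) (h' j)) \<and>
                (\<lambda>j. SUP p\<in>B. dist (h j p) p) \<longlonglongrightarrow> 0)"
      using L unfolding lamination_def by (elim conjE)
    from spec[OF this, of B] B nd show ?thesis by (simp only: image_subset_iff if_False simp_thms ball_UNIV)
  qed
  then obtain C r h h' where C: "C \<in> L" and r: "strict_mono (r :: nat \<Rightarrow> nat)"
    and h: "\<And>j. homeomorphism C (B (r j)) (h j) (h' j)" and lim: "(\<lambda>j. SUP p\<in>C. dist (h j p) p) \<longlonglongrightarrow> 0"
    by blast
  obtain \<beta> where \<beta>: "parameterizes \<beta> C" using lamination_parameterization[OF L C] .
  have \<beta>C: "\<beta> ` {0..1} = C" and c\<beta>: "continuous_on {0..1} \<beta>" using \<beta> by (auto simp: parameterizes_iff_arc arc_def path_def)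
  have "compact C" using compact_continuous_image[OF c\<beta> compact_Icc] \<beta>C by simp
  have hl: "dist (h j p) p \<le> (SUP p\<in>C. dist (h j p) p)" if "p \<in> C" for j p
  proof (rule cSUP_upper[OF that])
    have "continuous_on C (h j)" using h by (auto simp: homeomorphism_def)
    then have "compact ((\<lambda>p. dist (h j p) p) ` C)" using \<open>compact C\<close> by (intro compact_continuous_image continuous_intros)
    then show "bdd_above ((\<lambda>p. dist (h j p) p) ` C)" by (intro bounded_imp_bdd_above compact_imp_bounded)
  qed
  have hb: "parameterizes (h j \<circ> \<beta>) (B (r j))" for j
  proof -
    obtain \<beta>' where "homeomorphism {0..1} C \<beta> \<beta>'" using \<beta> by (auto simp: parameterizes_def)
    from homeomorphism_compose[OF this h] show ?thesis unfolding parameterizes_def by blast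
  qed
  have u: "uniform_limit {0..1} (\<lambda>j. h j \<circ> \<beta>) \<beta> sequentially"
    unfolding uniform_limit_iff
  proof (intro allI impI)
    fix e :: real assume "0 < e"
    with lim have "\<forall>\<^sub>F j in sequentially. (SUP p\<in>C. dist (h j p) p) < e" by (rule order_tendstoD(2))
    then show "\<forall>\<^sub>F j in sequentially. \<forall>t\<in>{0..1}. dist ((h j \<circ> \<beta>) t) (\<beta> t) < e"
    proof eventually_elim
      case (elim j)
      show ?case
      proof
        fix t :: real assume "t \<in> {0..1}"
        then have "\<beta> t \<in> C" using \<beta>C by blast
        from le_less_trans[OF hl[OF this] elim] show "dist ((h j \<circ> \<beta>) t) (\<beta> t) < e" by simp
      qed
    qed
  qed
  have "\<forall>j. \<exists>\<phi> \<psi>. homeomorphism {0..1} {0..1} \<phi> \<psi> \<and> mono_on {0..1} \<phi> \<and>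
     ((\<forall>t\<in>{0..1}. (h j \<circ> \<beta>) t = \<gamma> (r j) (\<phi> t)) \<or> (\<forall>t\<in>{0..1}. (h j \<circ> \<beta>) (1 - t) = \<gamma> (r j) (\<phi> t)))"
    using parameterizations_cases[OF \<gamma> hb] by blast
  then have "\<exists>\<phi> \<psi>. \<forall>j. homeomorphism {0..1} {0..1} (\<phi> j) (\<psi> j) \<and> mono_on {0..1} (\<phi> j) \<and>
     ((\<forall>t\<in>{0..1}. (h j \<circ> \<beta>) t = \<gamma> (r j) (\<phi> j t)) \<or> (\<forall>t\<in>{0..1}. (h j \<circ> \<beta>) (1 - t) = \<gamma> (r j) (\<phi> j t)))"
    unfolding choice_iff .
  then obtain \<phi> \<psi> where \<phi>: "\<And>j. homeomorphism {0..1} {0..1} (\<phi> j) (\<psi> j)" "\<And>j. mono_on {0..1} (\<phi> j)"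
     "\<And>j. (\<forall>t\<in>{0..1}. (h j \<circ> \<beta>) t = \<gamma> (r j) (\<phi> j t)) \<or> (\<forall>t\<in>{0..1}. (h j \<circ> \<beta>) (1 - t) = \<gamma> (r j) (\<phi> j t))"
    by blast
  let ?P = "{j. \<forall>t\<in>{0..1}. (h j \<circ> \<beta>) t = \<gamma> (r j) (\<phi> j t)}"
  let ?N = "{j. \<forall>t\<in>{0..1}. (h j \<circ> \<beta>) (1 - t) = \<gamma> (r j) (\<phi> j t)}"
  have "?P \<union> ?N = UNIV" using \<phi>(3) by blast
  then have "infinite (?P \<union> ?N)" by simp
  then consider "infinite ?P" | "infinite ?N" by auto
  then show ?thesis
  proof cases
    case 1
    then obtain r' where r': "strict_mono (r' :: nat \<Rightarrow> nat)" "\<And>n. r' n \<in> ?P" using infinite_enumerate by blast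
    show ?thesis
    proof (rule that[of "r \<circ> r'" C \<beta> "\<lambda>n. \<phi> (r' n)" "\<lambda>n. \<psi> (r' n)"])
      show "strict_mono (r \<circ> r')" using r r'(1) by (rule strict_mono_o)
      have "uniform_limit {0..1} (\<lambda>n. h (r' n) \<circ> \<beta>) \<beta> sequentially" by (rule uniform_limit_subseq[OF u r'(1)])
      then show "uniform_limit {0..1} (\<lambda>n t. \<gamma> ((r \<circ> r') n) (\<phi> (r' n) t)) \<beta> sequentially"
        by (rule uniform_limit_cong'[THEN iffD1, rotated 2]) (use r'(2) in auto)
    qed (use C \<beta> \<phi> in auto)
  next
    case 2
    then obtain r' where r': "strict_mono (r' :: nat \<Rightarrow> nat)" "\<And>n. r' n \<in> ?N" using infinite_enumerate by blast
    show ?thesis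
    proof (rule that[of "r \<circ> r'" C "\<lambda>t. \<beta> (1 - t)" "\<lambda>n. \<phi> (r' n)" "\<lambda>n. \<psi> (r' n)"])
      show "strict_mono (r \<circ> r')" using r r'(1) by (rule strict_mono_o)
      have "uniform_limit {0..1} (\<lambda>n. h (r' n) \<circ> \<beta>) \<beta> sequentially" by (rule uniform_limit_subseq[OF u r'(1)])
      then have "uniform_limit {0..1} (\<lambda>n t. (h (r' n) \<circ> \<beta>) (1 - t)) (\<lambda>t. \<beta> (1 - t)) sequentially"
        by (rule uniform_limit_compose') auto
      then show "uniform_limit {0..1} (\<lambda>n t. \<gamma> ((r \<circ> r') n) (\<phi> (r' n) t)) (\<lambda>t. \<beta> (1 - t)) sequentially"
        by (rule uniform_limit_cong'[THEN iffD1, rotated 2]) (use r'(2) in auto)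
      show "parameterizes (\<lambda>t. \<beta> (1 - t)) C" by (rule parameterizes_reverse[OF \<beta>])
    qed (use C \<phi> in auto)
  qed
qed

section \<open>Sequences of arcs and midpoint parameterizations\<close>

lemma dist_le_diameter_arc:
  fixes \<gamma> :: "real \<Rightarrow> 'a::metric_space"
  assumes "parameterizes \<gamma> A" "p \<in> A" "q \<in> A" shows "dist p q \<le> diameter A"
proof -
  have "compact A" using assms(1) compact_arc_image[of \<gamma>] by (auto simp: parameterizes_iff_arc path_image_def)
  then show ?thesis using assms by (intro diameter_bounded_bound compact_imp_bounded)
qed

lemma mid_param_in_arc:
  fixes \<gamma> :: "real \<Rightarrow> 'a::euclidean_space"
  assumes "parameterizes \<gamma> A" "s \<in> {0..1}" shows "mid_param \<gamma> s \<in> A"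
  using bij_betw_mid_param[of \<gamma>] assms by (auto simp: parameterizes_iff_arc bij_betw_def)

lemma mid_param_inj:
  fixes \<gamma> :: "real \<Rightarrow> 'a::euclidean_space"
  assumes "parameterizes \<gamma> A" "s \<in> {0..1}" "s' \<in> {0..1}" "mid_param \<gamma> s = mid_param \<gamma> s'" shows "s = s'"
  using bij_betw_mid_param[of \<gamma>] assms by (auto simp: parameterizes_iff_arc bij_betw_def inj_on_def)

lemma mid_param_surj:
  fixes \<gamma> :: "real \<Rightarrow> 'a::euclidean_space"
  assumes "parameterizes \<gamma> A" "x \<in> A" obtains s where "s \<in> {0..1}" "x = mid_param \<gamma> s"
proof -
  have "x \<in> mid_param \<gamma> ` {0..1}"
    using bij_betw_mid_param[of \<gamma>] assms by (auto simp: parameterizes_iff_arc bij_betw_def)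
  then show ?thesis using that by blast
qed

lemma mid_param_tendsto_reparam:
  fixes \<beta> :: "real \<Rightarrow> 'a::euclidean_space"
  assumes \<gamma>: "\<And>n. arc (\<gamma> n)" and \<beta>: "arc \<beta>"
    and h: "\<And>n. homeomorphism {0..1} {0..1} (\<phi> n) (\<psi> n)" "\<And>n. mono_on {0..1} (\<phi> n)"
    and u: "uniform_limit {0..1} (\<lambda>n t. \<gamma> n (\<phi> n t)) \<beta> sequentially"
    and s: "\<And>n. s n \<in> {0..1}" "s \<longlonglongrightarrow> s'"
  shows "(\<lambda>n. mid_param (\<gamma> n) (s n)) \<longlonglongrightarrow> mid_param \<beta> s'"
proof -
  have "arc (\<lambda>t. \<gamma> n (\<phi> n t))" for n by (rule arc_compose_homeomorphism(1)[OF \<gamma> h(1)]) simp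
  from mid_param_tendsto[OF this \<beta> u s]
  have "(\<lambda>n. mid_param (\<lambda>t. \<gamma> n (\<phi> n t)) (s n)) \<longlonglongrightarrow> mid_param \<beta> s'" .
  moreover have "mid_param (\<lambda>t. \<gamma> n (\<phi> n t)) (s n) = mid_param (\<gamma> n) (s n)" for n
    by (rule mid_param_compose_mono[OF \<gamma> h _ s(1)]) simp
  ultimately show ?thesis by simp
qed

lemma uniform_limit_reparam_ends:
  fixes \<beta> :: "real \<Rightarrow> 'a::metric_space" and \<gamma> :: "nat \<Rightarrow> real \<Rightarrow> 'a"
  assumes h: "\<And>n. homeomorphism {0..1} {0..1} (\<phi> n) (\<psi> n)" "\<And>n. mono_on {0..1} (\<phi> n)"
    and u: "uniform_limit {0..1} (\<lambda>n t. \<gamma> n (\<phi> n t)) \<beta> sequentially"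
  shows "(\<lambda>n. \<gamma> n 0) \<longlonglongrightarrow> \<beta> 0" "(\<lambda>n. \<gamma> n 1) \<longlonglongrightarrow> \<beta> 1"
  using tendsto_uniform_limitI[OF u, of 0] tendsto_uniform_limitI[OF u, of 1] mono_homeomorphism_01(1,2)[OF h] by auto

lemma convergent_subseq_01:
  fixes s :: "nat \<Rightarrow> real"
  assumes "\<And>n. s n \<in> {0..1}"
  obtains r l where "strict_mono (r :: nat \<Rightarrow> nat)" "l \<in> {0..1}" "(\<lambda>n. s (r n)) \<longlonglongrightarrow> l"
  using compact_Icc[of 0 "1::real", unfolded compact_def, rule_format, of s] assms by (auto simp: o_def)

section \<open>The canonical extension\<close>

lemma corresponding_arc_in:
  fixes LX :: "'a::metric_space set set"
  assumes M: "(Y, LY, f) \<in> lam_maps LX" and A: "A \<in> LX"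
  shows "corresponding_arc LY f A \<in> LY" "f ` arc_ends A = arc_ends (corresponding_arc LY f A)"
proof -
  obtain B where B: "B \<in> LY" "f ` arc_ends A = arc_ends B" using M A by (auto simp: lam_maps_def)
  have LY: "lamination Y LY" using M by (simp add: lam_maps_def)
  have "corresponding_arc LY f A \<in> LY \<and> f ` arc_ends A = arc_ends (corresponding_arc LY f A)"
    unfolding corresponding_arc_def
    by (rule theI[of _ B]) (use B lamination_unique_arc[OF LY] in auto)
  then show "corresponding_arc LY f A \<in> LY" "f ` arc_ends A = arc_ends (corresponding_arc LY f A)" by auto
qed

lemma corresponding_arc_eqI:
  fixes LX :: "'a::metric_space set set"
  assumes M: "(Y, LY, f) \<in> lam_maps LX" and A: "A \<in> LX" and B: "B \<in> LY" "f ` arc_ends A = arc_ends B"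
  shows "corresponding_arc LY f A = B"
  using corresponding_arc_in[OF M A] lamination_unique_arc[of Y LY] M B by (auto simp: lam_maps_def)

lemma corresponding_param_exists:
  fixes LX :: "'a::metric_space set set"
  assumes M: "(Y, LY, f) \<in> lam_maps LX" and A: "A \<in> LX" and \<gamma>: "parameterizes \<gamma> A"
  obtains \<eta> where "corresponding_param LY f A \<gamma> \<eta>"
proof -
  note B = corresponding_arc_in[OF M A]
  have LY: "lamination Y LY" using M by (simp add: lam_maps_def)
  obtain \<beta> where \<beta>: "parameterizes \<beta> (corresponding_arc LY f A)" using lamination_parameterization[OF LY B(1)] .
  have "{f (\<gamma> 0), f (\<gamma> 1)} = {\<beta> 0, \<beta> 1}" using B(2) arc_ends_eq[OF \<gamma>] arc_ends_eq[OF \<beta>] by simp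
  then consider "\<beta> 0 = f (\<gamma> 0)" "\<beta> 1 = f (\<gamma> 1)" | "\<beta> 0 = f (\<gamma> 1)" "\<beta> 1 = f (\<gamma> 0)" by (auto simp: doubleton_eq_iff)
  then show ?thesis
  proof cases
    case 1
    then show ?thesis using that \<beta> by (auto simp: corresponding_param_def)
  next
    case 2
    then show ?thesis using that[of "\<lambda>t. \<beta> (1 - t)"] parameterizes_reverse[OF \<beta>] by (auto simp: corresponding_param_def)
  qed
qed

context
  fixes X :: "'a::euclidean_space set" and LX Y LY f
  assumes LX: "lamination X LX" and M: "(Y, LY, f) \<in> lam_maps LX"
begin

lemma codomain_lamination: "lamination Y LY" using M by (simp add: lam_maps_def)

lemma domain_point:
  assumes "x \<in> X"
  shows "\<exists>A \<gamma> \<eta> s. A \<in> LX \<and> parameterizes \<gamma> A \<and> corresponding_param LY f A \<gamma> \<eta> \<and> s \<in> {0..1} \<and> x = mid_param \<gamma> s"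
proof -
  have "X = \<Union>LX" using LX by (simp add: lamination_def)
  then obtain A where A: "A \<in> LX" "x \<in> A" using assms by auto
  obtain \<gamma> where \<gamma>: "parameterizes \<gamma> A" using lamination_parameterization[OF LX A(1)] .
  obtain \<eta> where \<eta>: "corresponding_param LY f A \<gamma> \<eta>" using corresponding_param_exists[OF M A(1) \<gamma>] .
  obtain s where "s \<in> {0..1}" "x = mid_param \<gamma> s" using mid_param_surj[OF \<gamma> A(2)] .
  then show ?thesis using A \<gamma> \<eta> by blast
qed

lemma mid_param_corresponding_end:
  assumes A: "A \<in> LX" and \<gamma>: "parameterizes \<gamma> A" and \<eta>: "corresponding_param LY f A \<gamma> \<eta>"
    and s: "s \<in> {0..1}" and e: "mid_param \<gamma> s \<in> arc_ends A"
  shows "mid_param \<eta> s = f (mid_param \<gamma> s)"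
proof -
  have a: "arc \<gamma>" "arc \<eta>" using \<gamma> \<eta> by (auto simp: parameterizes_iff_arc corresponding_param_def)
  note ends = mid_param_ends[OF a(1)] mid_param_ends[OF a(2)]
  have "mid_param \<gamma> s = mid_param \<gamma> 0 \<or> mid_param \<gamma> s = mid_param \<gamma> 1"
    using e arc_ends_eq[OF \<gamma>] ends by simp
  then have "s = 0 \<or> s = 1" using mid_param_inj[OF \<gamma> s] by auto
  then show ?thesis using ends \<eta> by (auto simp: corresponding_param_def)
qed

text \<open>On a single arc a change of direction affects \<gamma> and \<eta> alike. Distinct arcs
  meet only in a common end, where both values are given by \<open>f\<close>.\<close>

lemma mid_param_corresponding_unique:
  assumes A: "A \<in> LX" "parameterizes \<gamma> A" "corresponding_param LY f A \<gamma> \<eta>" "s \<in> {0..1}"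
    and A': "A' \<in> LX" "parameterizes \<gamma>' A'" "corresponding_param LY f A' \<gamma>' \<eta>'" "s' \<in> {0..1}"
    and eq: "mid_param \<gamma> s = mid_param \<gamma>' s'"
  shows "mid_param \<eta> s = mid_param \<eta>' s'"
proof (cases "A = A'")
  case True
  have \<gamma>': "parameterizes \<gamma>' A" using A' True by simp
  have \<eta>: "parameterizes \<eta> (corresponding_arc LY f A)" "\<eta> 0 = f (\<gamma> 0)" "\<eta> 1 = f (\<gamma> 1)"
    using A by (auto simp: corresponding_param_def)
  have \<eta>': "parameterizes \<eta>' (corresponding_arc LY f A)" "\<eta>' 0 = f (\<gamma>' 0)" "\<eta>' 1 = f (\<gamma>' 1)"
    using A' True by (auto simp: corresponding_param_def)
  have "{\<gamma> 0, \<gamma> 1} = {\<gamma>' 0, \<gamma>' 1}" using arc_ends_eq[OF A(2)] arc_ends_eq[OF \<gamma>'] by simp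
  then consider "\<gamma>' 0 = \<gamma> 0" | "\<gamma>' 0 = \<gamma> 1" by (auto simp: doubleton_eq_iff)
  then show ?thesis
  proof cases
    case 1
    then have "mid_param \<gamma>' s' = mid_param \<gamma> s'" using mid_param_same_start[OF A(2) \<gamma>' _ A'(4)] by simp
    then have "s = s'" using eq mid_param_inj[OF A(2,4) A'(4)] by simp
    then show ?thesis using mid_param_same_start[OF \<eta>(1) \<eta>'(1) _ A'(4)] 1 \<eta> \<eta>' by simp
  next
    case 2
    then have "mid_param \<gamma>' s' = mid_param \<gamma> (1 - s')" using mid_param_opposite_start[OF A(2) \<gamma>' _ A'(4)] by simp
    then have "s = 1 - s'" using eq mid_param_inj[OF A(2,4), of "1 - s'"] A'(4) by simp
    then show ?thesis using mid_param_opposite_start[OF \<eta>(1) \<eta>'(1) _ A'(4)] 2 \<eta> \<eta>' by simp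
  qed
next
  case False
  let ?x = "mid_param \<gamma> s"
  have x: "?x \<in> A" "?x \<in> A'" using mid_param_in_arc[OF A(2,4)] mid_param_in_arc[OF A'(2,4)] eq by auto
  have "\<forall>A\<in>LX. \<forall>B\<in>LX. A \<noteq> B \<longrightarrow> A \<inter> B = {} \<or> (\<exists>p. A \<inter> B = {p} \<and> p \<in> arc_ends A \<and> p \<in> arc_ends B)"
    using LX unfolding lamination_def by (elim conjE)
  then have "A \<inter> A' = {} \<or> (\<exists>p. A \<inter> A' = {p} \<and> p \<in> arc_ends A \<and> p \<in> arc_ends A')" using A(1) A'(1) False by blast
  then have "?x \<in> arc_ends A" "?x \<in> arc_ends A'" using x by (metis IntI empty_iff singletonD)+
  then show ?thesis
    using mid_param_corresponding_end[OF A] mid_param_corresponding_end[OF A'] eq by simp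
qed

text \<open>By uniqueness the choice in \<open>canonical_extension\<close> is forced, and the value
  may be computed with any arc through the point and any parameterizations.\<close>

lemma canonical_extension_mid_param:
  assumes A: "A \<in> LX" "parameterizes \<gamma> A" "corresponding_param LY f A \<gamma> \<eta>" "s \<in> {0..1}"
  shows "canonical_extension X LX (Y, LY, f) (mid_param \<gamma> s) = mid_param \<eta> s"
proof -
  let ?x = "mid_param \<gamma> s"
  let ?P = "\<lambda>y. \<exists>A\<in>LX. \<exists>\<gamma> \<eta>. ?x \<in> A \<and> parameterizes \<gamma> A \<and> corresponding_param LY f A \<gamma> \<eta> \<and>
       y = mid_param \<eta> (inv_into {0..1} (mid_param \<gamma>) ?x)"
  have inA: "?x \<in> A" by (rule mid_param_in_arc[OF A(2,4)])
  then have "?x \<in> X" using LX A(1) by (auto simp: lamination_def)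
  have "inj_on (mid_param \<gamma>) {0..1}"
    using bij_betw_mid_param[of \<gamma>] A(2) by (simp add: parameterizes_iff_arc bij_betw_def)
  then have "inv_into {0..1} (mid_param \<gamma>) ?x = s" using A(4) by (rule inv_into_f_f)
  then have ex: "?P (mid_param \<eta> s)" using A inA by metis
  have uniq: "y = mid_param \<eta> s" if "?P y" for y
  proof -
    from that obtain A' \<gamma>' \<eta>' where A': "A' \<in> LX" "?x \<in> A'" "parameterizes \<gamma>' A'" "corresponding_param LY f A' \<gamma>' \<eta>'"
      and y: "y = mid_param \<eta>' (inv_into {0..1} (mid_param \<gamma>') ?x)" by blast
    have "?x \<in> mid_param \<gamma>' ` {0..1}" using mid_param_surj[OF A'(3,2)] by blast
    then have s': "inv_into {0..1} (mid_param \<gamma>') ?x \<in> {0..1}" "mid_param \<gamma>' (inv_into {0..1} (mid_param \<gamma>') ?x) = ?x"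
      by (rule inv_into_into, rule f_inv_into_f)
    show ?thesis unfolding y
      by (rule mid_param_corresponding_unique[OF A'(1,3,4) s'(1) A s'(2)])
  qed
  have "(SOME y. ?P y) = mid_param \<eta> s" by (rule some_equality[of ?P, OF ex uniq])
  then show ?thesis using \<open>?x \<in> X\<close> by (simp add: canonical_extension_def)
qed

lemma canonical_extension_in: "canonical_extension X LX (Y, LY, f) \<in> X \<rightarrow> Y"
proof
  fix x assume "x \<in> X"
  from domain_point[OF this] obtain A \<gamma> \<eta> s where A: "A \<in> LX" "parameterizes \<gamma> A" "corresponding_param LY f A \<gamma> \<eta>" "s \<in> {0..1}" and x: "x = mid_param \<gamma> s"
    by (elim exE conjE)
  have "mid_param \<eta> s \<in> corresponding_arc LY f A"
    using A by (intro mid_param_in_arc) (auto simp: corresponding_param_def)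
  moreover have "Y = \<Union>LY" using codomain_lamination by (simp add: lamination_def)
  ultimately have "mid_param \<eta> s \<in> Y" using corresponding_arc_in(1)[OF M A(1)] by blast
  then show "canonical_extension X LX (Y, LY, f) x \<in> Y" unfolding x canonical_extension_mid_param[OF A] .
qed

lemma canonical_extension_ends:
  assumes "p \<in> lam_ends LX" shows "canonical_extension X LX (Y, LY, f) p = f p"
proof -
  obtain A where A: "A \<in> LX" "p \<in> arc_ends A" using assms by (auto simp: lam_ends_def)
  obtain \<gamma> where \<gamma>: "parameterizes \<gamma> A" using lamination_parameterization[OF LX A(1)] .
  obtain \<eta> where \<eta>: "corresponding_param LY f A \<gamma> \<eta>" using corresponding_param_exists[OF M A(1) \<gamma>] .
  have "p \<in> A" using A(2) arc_ends_eq[OF \<gamma>] parameterizes_ends[OF \<gamma>] by auto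
  then obtain s where s: "s \<in> {0..1}" "p = mid_param \<gamma> s" using mid_param_surj[OF \<gamma>] by blast
  show ?thesis
    using canonical_extension_mid_param[OF A(1) \<gamma> \<eta> s(1)] mid_param_corresponding_end[OF A(1) \<gamma> \<eta> s(1)] A(2) s(2) by simp
qed

text \<open>If the domain arcs shrink, condition (3a) makes the limit an end, because it lies in
  \<open>X\<close>, and the image arcs shrink to its image. Otherwise domain arcs and image arcs
  subconverge to corresponding arcs, and the limit theorem for \<open>mid_param\<close> applies to
  both.\<close>

lemma canonical_extension_subseq_tendsto:
  assumes x: "\<And>i. x i \<in> X" "x \<longlonglongrightarrow> l" "l \<in> X"
  shows "\<exists>r. strict_mono (r :: nat \<Rightarrow> nat) \<and>
    (\<lambda>i. canonical_extension X LX (Y, LY, f) (x (r i))) \<longlonglongrightarrow> canonical_extension X LX (Y, LY, f) l"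
proof -
  let ?F = "canonical_extension X LX (Y, LY, f)"
  have "\<forall>i. \<exists>A \<gamma> \<eta> s. A \<in> LX \<and> parameterizes \<gamma> A \<and> corresponding_param LY f A \<gamma> \<eta> \<and> s \<in> {0..1} \<and> x i = mid_param \<gamma> s"
    using domain_point x(1) by blast
  then have "\<exists>A \<gamma> \<eta> s. \<forall>i. A i \<in> LX \<and> parameterizes (\<gamma> i) (A i) \<and> corresponding_param LY f (A i) (\<gamma> i) (\<eta> i) \<and>
      s i \<in> {0..1} \<and> x i = mid_param (\<gamma> i) (s i)"
    unfolding choice_iff .
  then obtain A \<gamma> \<eta> s where A: "\<And>i. A i \<in> LX" and \<gamma>: "\<And>i. parameterizes (\<gamma> i) (A i)"
    and \<eta>c: "\<And>i. corresponding_param LY f (A i) (\<gamma> i) (\<eta> i)" and s: "\<And>i. s i \<in> {0..1}" and xs: "\<And>i. x i = mid_param (\<gamma> i) (s i)"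
    by blast
  define B where "B = (\<lambda>i. corresponding_arc LY f (A i))"
  have B: "B i \<in> LY" for i unfolding B_def by (rule corresponding_arc_in(1)[OF M A])
  have \<eta>: "parameterizes (\<eta> i) (B i)" "\<eta> i 0 = f (\<gamma> i 0)" "\<eta> i 1 = f (\<gamma> i 1)" for i
    using \<eta>c[of i] by (auto simp: corresponding_param_def B_def)
  have Fx: "?F (x i) = mid_param (\<eta> i) (s i)" for i
    unfolding xs by (rule canonical_extension_mid_param[OF A \<gamma> \<eta>c s])
  have arcs: "arc (\<gamma> i)" "arc (\<eta> i)" for i using \<gamma> \<eta>(1) by (auto simp: parameterizes_iff_arc)
  have ends: "\<gamma> i 0 \<in> lam_ends LX" "\<gamma> i 1 \<in> lam_ends LX" for i
    using A arc_ends_eq[OF \<gamma>] by (auto simp: lam_ends_def)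
  have f: "continuous_on (lam_ends LX) f" using M by (simp add: lam_maps_def)
  show ?thesis
  proof (cases "(\<lambda>i. diameter (A i)) \<longlonglongrightarrow> 0")
    case True
    have xA: "x i \<in> A i" for i unfolding xs by (rule mid_param_in_arc[OF \<gamma> s])
    have "infinite {i. A i \<inter> U \<noteq> {}}" if U: "open U" "l \<in> U" for U
    proof -
      have "\<forall>\<^sub>F i in sequentially. x i \<in> U" using x(2) U by (rule topological_tendstoD)
      then have "finite {i. x i \<notin> U}" by (simp add: eventually_cofinite[symmetric] cofinite_eq_sequentially)
      then have "infinite {i. x i \<in> U}"
        using finite_UnI[of "{i. x i \<notin> U}" "{i. x i \<in> U}"] infinite_UNIV_nat by (auto simp: Un_def)
      then show ?thesis by (rule contrapos_nn) (erule finite_subset[rotated], use xA in blast)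
    qed
    moreover have "\<forall>A :: nat \<Rightarrow> 'a set. range A \<subseteq> LX \<longrightarrow>
        (if (\<lambda>i. diameter (A i)) \<longlonglongrightarrow> 0
         then \<forall>p. (\<forall>U. open U \<and> p \<in> U \<longrightarrow> infinite {i. A i \<inter> U \<noteq> {}}) \<longrightarrow> p \<in> lam_ends LX \<or> p \<notin> X
         else \<exists>B\<in>LX. \<exists>r :: nat \<Rightarrow> nat. \<exists>h h'. strict_mono r \<and>
                (\<forall>j. homeomorphism B (A (r j)) (h j) (h' j)) \<and>
                (\<lambda>j. SUP p\<in>B. dist (h j p) p) \<longlonglongrightarrow> 0)"
      using LX unfolding lamination_def by (elim conjE)
    from spec[OF this, of A] have "\<forall>p. (\<forall>U. open U \<and> p \<in> U \<longrightarrow> infinite {i. A i \<inter> U \<noteq> {}}) \<longrightarrow> p \<in> lam_ends LX \<or> p \<notin> X"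
      using A True by (simp only: image_subset_iff if_True simp_thms ball_UNIV)
    note this[THEN spec, of l]
    ultimately have l: "l \<in> lam_ends LX" using x(3) by blast
    have close: "p \<longlonglongrightarrow> l" if p: "\<And>i. p i \<in> A i" for p
    proof -
      have "(\<lambda>i. dist (p i) (x i)) \<longlonglongrightarrow> 0"
        by (rule Lim_null_comparison[OF _ True]) (simp add: dist_le_diameter_arc[OF \<gamma> p xA])
      then show ?thesis using x(2) by (rule tendsto_dist_zero_trans)
    qed
    have e: "(\<lambda>i. f (\<gamma> i 0)) \<longlonglongrightarrow> f l" "(\<lambda>i. f (\<gamma> i 1)) \<longlonglongrightarrow> f l"
      by (rule continuous_on_tendsto_compose[OF f close l], use parameterizes_ends[OF \<gamma>] ends in auto)+
    \<comment> \<open>Otherwise some image arcs would converge to an arc both of whose ends are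
      \<open>f l\<close>.\<close>
    have dB: "(\<lambda>i. diameter (B i)) \<longlonglongrightarrow> 0"
    proof (rule ccontr)
      assume "\<not> ?thesis"
      then obtain r C \<beta> \<phi> \<psi> where r: "strict_mono (r :: nat \<Rightarrow> nat)" and \<beta>: "parameterizes \<beta> C"
        and h: "\<And>n. homeomorphism {0..1} {0..1} (\<phi> n) (\<psi> n)" "\<And>n. mono_on {0..1} (\<phi> n)"
        and u: "uniform_limit {0..1} (\<lambda>n t. \<eta> (r n) (\<phi> n t)) \<beta> sequentially"
        by (rule lamination_convergent_subseq[OF codomain_lamination B \<eta>(1)]) (rule that)
      have 1: "(\<lambda>n. f (\<gamma> (r n) 0)) \<longlonglongrightarrow> \<beta> 0" "(\<lambda>n. f (\<gamma> (r n) 1)) \<longlonglongrightarrow> \<beta> 1"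
        using uniform_limit_reparam_ends[of \<phi> \<psi> "\<lambda>n. \<eta> (r n)", OF h u] by (simp_all add: \<eta>)
      have 2: "(\<lambda>n. f (\<gamma> (r n) 0)) \<longlonglongrightarrow> f l" "(\<lambda>n. f (\<gamma> (r n) 1)) \<longlonglongrightarrow> f l"
        using LIMSEQ_subseq_LIMSEQ[OF e(1) r] LIMSEQ_subseq_LIMSEQ[OF e(2) r] by (simp_all add: o_def)
      have "\<beta> 0 = \<beta> 1" using LIMSEQ_unique[OF 1(1) 2(1)] LIMSEQ_unique[OF 1(2) 2(2)] by simp
      then show False using parameterizes_ends(1)[OF \<beta>] by simp
    qed
    have "(\<lambda>i. dist (?F (x i)) (f (\<gamma> i 0))) \<longlonglongrightarrow> 0"
    proof (rule Lim_null_comparison[OF _ dB], rule always_eventually, rule allI)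
      fix i
      have "mid_param (\<eta> i) (s i) \<in> B i" by (rule mid_param_in_arc[OF \<eta>(1) s])
      then show "norm (dist (?F (x i)) (f (\<gamma> i 0))) \<le> diameter (B i)"
        using dist_le_diameter_arc[OF \<eta>(1)] parameterizes_ends(2)[OF \<eta>(1), of i] by (simp add: Fx \<eta>(2))
    qed
    then have "(\<lambda>i. ?F (x i)) \<longlonglongrightarrow> ?F l"
      unfolding canonical_extension_ends[OF l] using e(1) by (rule tendsto_dist_zero_trans)
    then show ?thesis by (intro exI[of _ "\<lambda>n. n"]) (simp add: strict_mono_def)
  next
    case False
    obtain r C \<beta> \<phi> \<psi> where r: "strict_mono (r :: nat \<Rightarrow> nat)" and C: "C \<in> LX" and \<beta>: "parameterizes \<beta> C"
      and h: "\<And>n. homeomorphism {0..1} {0..1} (\<phi> n) (\<psi> n)" "\<And>n. mono_on {0..1} (\<phi> n)"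
      and u: "uniform_limit {0..1} (\<lambda>n t. \<gamma> (r n) (\<phi> n t)) \<beta> sequentially"
      by (rule lamination_convergent_subseq[OF LX A \<gamma> False]) (rule that)
    have \<beta>a: "arc \<beta>" using \<beta> by (simp add: parameterizes_iff_arc)
    obtain r1 s' where r1: "strict_mono (r1 :: nat \<Rightarrow> nat)" and s': "s' \<in> {0..1}" "(\<lambda>n. s (r (r1 n))) \<longlonglongrightarrow> s'"
      using convergent_subseq_01[of "\<lambda>n. s (r n)"] s by blast
    define R where "R = (\<lambda>n. r (r1 n))"
    have R: "strict_mono R" unfolding R_def using strict_mono_o[OF r r1] by (simp add: o_def)
    have sR: "(\<lambda>n. s (R n)) \<longlonglongrightarrow> s'" using s'(2) by (simp add: R_def)
    have uR: "uniform_limit {0..1} (\<lambda>n t. \<gamma> (R n) (\<phi> (r1 n) t)) \<beta> sequentially"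
      using uniform_limit_subseq[OF u r1] by (simp add: R_def)
    have "(\<lambda>n. mid_param (\<gamma> (R n)) (s (R n))) \<longlonglongrightarrow> mid_param \<beta> s'"
      by (rule mid_param_tendsto_reparam[where \<gamma> = "\<lambda>n. \<gamma> (R n)", OF arcs(1) \<beta>a h uR s sR])
    then have "(\<lambda>n. x (R n)) \<longlonglongrightarrow> mid_param \<beta> s'" by (simp add: xs)
    moreover have "(\<lambda>n. x (R n)) \<longlonglongrightarrow> l" using LIMSEQ_subseq_LIMSEQ[OF x(2) R] by (simp add: o_def)
    ultimately have l: "l = mid_param \<beta> s'" using LIMSEQ_unique by blast
    obtain \<eta>' where \<eta>c': "corresponding_param LY f C \<beta> \<eta>'" using corresponding_param_exists[OF M C \<beta>] .
    then have \<eta>': "parameterizes \<eta>' (corresponding_arc LY f C)" "\<eta>' 0 = f (\<beta> 0)" "\<eta>' 1 = f (\<beta> 1)"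
      by (auto simp: corresponding_param_def)
    have \<beta>e: "\<beta> 0 \<in> lam_ends LX" "\<beta> 1 \<in> lam_ends LX" using C arc_ends_eq[OF \<beta>] by (auto simp: lam_ends_def)
    note \<gamma>e = uniform_limit_reparam_ends[where \<gamma> = "\<lambda>n. \<gamma> (R n)", OF h uR]
    have e: "(\<lambda>n. \<eta> (R n) 0) \<longlonglongrightarrow> \<eta>' 0" "(\<lambda>n. \<eta> (R n) 1) \<longlonglongrightarrow> \<eta>' 1"
      unfolding \<eta> \<eta>'
      by (rule continuous_on_tendsto_compose[OF f \<gamma>e(1) \<beta>e(1)], simp add: ends,
          rule continuous_on_tendsto_compose[OF f \<gamma>e(2) \<beta>e(2)], simp add: ends)
    \<comment> \<open>The ends of the image arcs converge to two distinct points, so condition (3b)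
      applies to these arcs.\<close>
    have "\<not> (\<lambda>n. diameter (B (R n))) \<longlonglongrightarrow> 0"
    proof
      assume "(\<lambda>n. diameter (B (R n))) \<longlonglongrightarrow> 0"
      then have "(\<lambda>n. dist (\<eta> (R n) 0) (\<eta> (R n) 1)) \<longlonglongrightarrow> 0"
        by (rule Lim_null_comparison[rotated])
          (simp add: dist_le_diameter_arc[OF \<eta>(1)] parameterizes_ends[OF \<eta>(1)])
      moreover have "(\<lambda>n. dist (\<eta> (R n) 0) (\<eta> (R n) 1)) \<longlonglongrightarrow> dist (\<eta>' 0) (\<eta>' 1)"
        by (intro tendsto_intros e)
      ultimately have "dist (\<eta>' 0) (\<eta>' 1) = 0" using LIMSEQ_unique by blast
      then show False using parameterizes_ends(1)[OF \<eta>'(1)] by simp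
    qed
    then obtain r2 C' \<beta>' \<phi>' \<psi>' where r2: "strict_mono (r2 :: nat \<Rightarrow> nat)" and C': "C' \<in> LY" and \<beta>': "parameterizes \<beta>' C'"
      and h': "\<And>n. homeomorphism {0..1} {0..1} (\<phi>' n) (\<psi>' n)" "\<And>n. mono_on {0..1} (\<phi>' n)"
      and u': "uniform_limit {0..1} (\<lambda>n t. \<eta> (R (r2 n)) (\<phi>' n t)) \<beta>' sequentially"
      by (rule lamination_convergent_subseq[OF codomain_lamination B \<eta>(1)]) (rule that)
    have \<beta>a': "arc \<beta>'" using \<beta>' by (simp add: parameterizes_iff_arc)
    note e' = uniform_limit_reparam_ends[where \<gamma> = "\<lambda>n. \<eta> (R (r2 n))", OF h' u']
    have "(\<lambda>n. \<eta> (R (r2 n)) 0) \<longlonglongrightarrow> \<eta>' 0" "(\<lambda>n. \<eta> (R (r2 n)) 1) \<longlonglongrightarrow> \<eta>' 1"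
      using LIMSEQ_subseq_LIMSEQ[OF e(1) r2] LIMSEQ_subseq_LIMSEQ[OF e(2) r2] by (simp_all add: o_def)
    then have be: "\<beta>' 0 = \<eta>' 0" "\<beta>' 1 = \<eta>' 1" using LIMSEQ_unique e' by blast+
    \<comment> \<open>The limit of the image arcs has the ends prescribed by \<open>f\<close>, which
      identifies it as the arc corresponding to \<open>C\<close>.\<close>
    then have "f ` arc_ends C = arc_ends C'" using arc_ends_eq[OF \<beta>] arc_ends_eq[OF \<beta>'] \<eta>' by simp
    then have CC: "corresponding_arc LY f C = C'" by (rule corresponding_arc_eqI[OF M C C'])
    have sR2: "(\<lambda>n. s (R (r2 n))) \<longlonglongrightarrow> s'" using LIMSEQ_subseq_LIMSEQ[OF sR r2] by (simp add: o_def)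
    have "(\<lambda>n. mid_param (\<eta> (R (r2 n))) (s (R (r2 n)))) \<longlonglongrightarrow> mid_param \<beta>' s'"
      by (rule mid_param_tendsto_reparam[where \<gamma> = "\<lambda>n. \<eta> (R (r2 n))", OF arcs(2) \<beta>a' h' u' s sR2])
    moreover have "mid_param \<beta>' s' = mid_param \<eta>' s'"
      by (rule mid_param_same_start[OF \<eta>'(1)]) (use \<beta>' CC be s' in auto)
    moreover have "?F l = mid_param \<eta>' s'" unfolding l by (rule canonical_extension_mid_param[OF C \<beta> \<eta>c' s'(1)])
    ultimately have "(\<lambda>n. ?F (x (R (r2 n)))) \<longlonglongrightarrow> ?F l" by (simp add: Fx)
    moreover have "strict_mono (\<lambda>n. R (r2 n))" using strict_mono_o[OF R r2] by (simp add: o_def)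
    ultimately show ?thesis by blast
  qed
qed

lemma continuous_on_canonical_extension: "continuous_on X (canonical_extension X LX (Y, LY, f))"
  unfolding continuous_on_sequentially
proof (intro allI ballI impI, elim conjE)
  fix x l assume x: "\<forall>n. x n \<in> X" "x \<longlonglongrightarrow> l" and l: "l \<in> X"
  show "(canonical_extension X LX (Y, LY, f) \<circ> x) \<longlonglongrightarrow> canonical_extension X LX (Y, LY, f) l"
  proof (rule tendsto_via_subseq)
    fix r :: "nat \<Rightarrow> nat" assume "strict_mono r"
    then have "(\<lambda>n. x (r n)) \<longlonglongrightarrow> l" using LIMSEQ_subseq_LIMSEQ[OF x(2)] by (simp add: o_def)
    then show "\<exists>r'. strict_mono (r' :: nat \<Rightarrow> nat) \<and>
        (\<lambda>n. (canonical_extension X LX (Y, LY, f) \<circ> x) (r (r' n))) \<longlonglongrightarrow> canonical_extension X LX (Y, LY, f) l"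
      using canonical_extension_subseq_tendsto[of "\<lambda>n. x (r n)" l] x(1) l by simp
  qed
qed

end

section \<open>Continuity of the extension operator\<close>

lemma lam_dist_less_rho:
  assumes "lam_dist LX (Y1, L1, f1) (Y2, L2, f2) < ennreal \<delta>"
    and "A \<in> LX" "parameterizes \<gamma> A" "corresponding_param L1 f1 A \<gamma> \<eta>1" "corresponding_param L2 f2 A \<gamma> \<eta>2"
  shows "rho (reparam_class \<eta>1) (reparam_class \<eta>2) < \<delta>"
proof (rule ccontr)
  assume "\<not> ?thesis"
  then have "ennreal \<delta> \<le> ennreal (rho (reparam_class \<eta>1) (reparam_class \<eta>2))" by (intro ennreal_leI) simp
  also have "\<dots> \<le> lam_dist LX (Y1, L1, f1) (Y2, L2, f2)"
    unfolding lam_dist_def prod.case by (rule Sup_upper) (use assms in blast)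
  finally show False using assms(1) by simp
qed

text \<open>The points \<open>x n\<close> need not converge, so the subsequence is chosen for the
  arcs in \<open>LY\<close>. The nearby arcs, reparameterized as \<zeta>, follow \<eta> uniformly,
  so the two values have the same limit; if the arcs in \<open>LY\<close> shrink, the two values
  differ by at most \<open>diameter (B n) + \<delta> n\<close>.\<close>

lemma canonical_extension_close_subseq:
  fixes X :: "'a::euclidean_space set"
  assumes LX: "lamination X LX" and M: "(Y, LY, f) \<in> lam_maps LX"
    and M': "\<And>n. (Y' n, LY' n, f' n) \<in> lam_maps LX" and d: "\<And>n. lam_dist LX (Y, LY, f) (Y' n, LY' n, f' n) < ennreal (\<delta> n)"
    and \<delta>: "\<delta> \<longlonglongrightarrow> 0" and x: "\<And>n. x n \<in> X"
  shows "\<exists>r. strict_mono (r :: nat \<Rightarrow> nat) \<and>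
    (\<lambda>n. dist (canonical_extension X LX (Y, LY, f) (x (r n))) (canonical_extension X LX (Y' (r n), LY' (r n), f' (r n)) (x (r n)))) \<longlonglongrightarrow> 0"
proof -
  let ?F = "canonical_extension X LX (Y, LY, f)" and ?F' = "\<lambda>n. canonical_extension X LX (Y' n, LY' n, f' n)"
  have "\<forall>n. \<exists>A \<gamma> \<eta> s. A \<in> LX \<and> parameterizes \<gamma> A \<and> corresponding_param LY f A \<gamma> \<eta> \<and> s \<in> {0..1} \<and> x n = mid_param \<gamma> s"
    using domain_point[OF LX M] x by blast
  then have "\<exists>A \<gamma> \<eta> s. \<forall>n. A n \<in> LX \<and> parameterizes (\<gamma> n) (A n) \<and> corresponding_param LY f (A n) (\<gamma> n) (\<eta> n) \<and>
      s n \<in> {0..1} \<and> x n = mid_param (\<gamma> n) (s n)"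
    unfolding choice_iff .
  then obtain A \<gamma> \<eta> s where A: "\<And>n. A n \<in> LX" and \<gamma>: "\<And>n. parameterizes (\<gamma> n) (A n)"
    and \<eta>c: "\<And>n. corresponding_param LY f (A n) (\<gamma> n) (\<eta> n)" and s: "\<And>n. s n \<in> {0..1}" and xs: "\<And>n. x n = mid_param (\<gamma> n) (s n)"
    by blast
  have "\<forall>n. \<exists>\<eta>'. corresponding_param (LY' n) (f' n) (A n) (\<gamma> n) \<eta>'"
    using corresponding_param_exists[OF M' A \<gamma>] by blast
  then have "\<exists>\<eta>'. \<forall>n. corresponding_param (LY' n) (f' n) (A n) (\<gamma> n) (\<eta>' n)" unfolding choice_iff .
  then obtain \<eta>' where \<eta>c': "\<And>n. corresponding_param (LY' n) (f' n) (A n) (\<gamma> n) (\<eta>' n)" by blast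
  have arcs: "arc (\<eta> n)" "arc (\<eta>' n)" for n
    using \<eta>c[of n] \<eta>c'[of n] by (auto simp: corresponding_param_def parameterizes_iff_arc)
  have "\<forall>n. \<exists>\<phi> \<psi>. homeomorphism {0..1} {0..1} \<phi> \<psi> \<and> mono_on {0..1} \<phi> \<and> (\<forall>t\<in>{0..1}. dist (\<eta> n t) (\<eta>' n (\<phi> t)) < \<delta> n)"
  proof
    fix n
    show "\<exists>\<phi> \<psi>. homeomorphism {0..1} {0..1} \<phi> \<psi> \<and> mono_on {0..1} \<phi> \<and> (\<forall>t\<in>{0..1}. dist (\<eta> n t) (\<eta>' n (\<phi> t)) < \<delta> n)"
      by (rule rho_less_imp_reparam[OF arcs(1)[of n] arcs(2)[of n] lam_dist_less_rho[OF d A \<gamma> \<eta>c \<eta>c']]) blast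
  qed
  then have "\<exists>\<phi> \<psi>. \<forall>n. homeomorphism {0..1} {0..1} (\<phi> n) (\<psi> n) \<and> mono_on {0..1} (\<phi> n) \<and> (\<forall>t\<in>{0..1}. dist (\<eta> n t) (\<eta>' n (\<phi> n t)) < \<delta> n)"
    unfolding choice_iff .
  then obtain \<phi> \<psi> where h: "\<And>n. homeomorphism {0..1} {0..1} (\<phi> n) (\<psi> n)" "\<And>n. mono_on {0..1} (\<phi> n)"
    and c: "\<And>n t. t \<in> {0..1} \<Longrightarrow> dist (\<eta> n t) (\<eta>' n (\<phi> n t)) < \<delta> n" by blast
  define \<zeta> where "\<zeta> = (\<lambda>n t. \<eta>' n (\<phi> n t))"
  have \<zeta>: "arc (\<zeta> n)" for n unfolding \<zeta>_def by (rule arc_compose_homeomorphism(1)[OF arcs(2) h(1)]) simp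
  have Fx: "?F (x n) = mid_param (\<eta> n) (s n)" for n
    unfolding xs by (rule canonical_extension_mid_param[OF LX M A \<gamma> \<eta>c s])
  have F'x: "?F' n (x n) = mid_param (\<zeta> n) (s n)" for n
  proof -
    have "?F' n (x n) = mid_param (\<eta>' n) (s n)"
      unfolding xs by (rule canonical_extension_mid_param[OF LX M' A \<gamma> \<eta>c' s])
    also have "\<dots> = mid_param (\<zeta> n) (s n)"
      by (rule mid_param_compose_mono[OF arcs(2) h _ s, symmetric]) (simp add: \<zeta>_def)
    finally show ?thesis .
  qed
  define B where "B = (\<lambda>n. corresponding_arc LY f (A n))"
  have B: "B n \<in> LY" for n unfolding B_def by (rule corresponding_arc_in(1)[OF M A])
  have \<eta>: "parameterizes (\<eta> n) (B n)" for n using \<eta>c[of n] by (simp add: corresponding_param_def B_def)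
  have LY: "lamination Y LY" using M by (simp add: lam_maps_def)
  show ?thesis
  proof (cases "(\<lambda>n. diameter (B n)) \<longlonglongrightarrow> 0")
    case True
    have le: "dist (?F (x n)) (?F' n (x n)) \<le> diameter (B n) + \<delta> n" for n
    proof -
      have "mid_param (\<zeta> n) (s n) \<in> \<zeta> n ` {0..1}"
        using bij_betw_mid_param[OF \<zeta>, of n] s[of n] by (auto simp: bij_betw_def)
      \<comment> \<open>The value on the nearby arc is \<open>\<zeta> n v\<close>, within
        \<open>\<delta> n\<close> of the point \<open>\<eta> n v\<close> of
        \<open>B n\<close>.\<close>
      then obtain v where v: "v \<in> {0..1}" "mid_param (\<zeta> n) (s n) = \<zeta> n v" by auto
      have "\<eta> n v \<in> B n" using \<eta>[of n] v by (auto simp: parameterizes_iff_arc)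
      then have "dist (mid_param (\<eta> n) (s n)) (\<eta> n v) \<le> diameter (B n)"
        by (rule dist_le_diameter_arc[OF \<eta> mid_param_in_arc[OF \<eta> s]])
      moreover have "dist (\<eta> n v) (\<zeta> n v) < \<delta> n" unfolding \<zeta>_def by (rule c[OF v(1)])
      ultimately show ?thesis
        unfolding Fx F'x v(2) using dist_triangle[of "mid_param (\<eta> n) (s n)" "\<zeta> n v" "\<eta> n v"] by linarith
    qed
    have "(\<lambda>n. diameter (B n) + \<delta> n) \<longlonglongrightarrow> 0" using tendsto_add[OF True \<delta>] by simp
    then have "(\<lambda>n. dist (?F (x n)) (?F' n (x n))) \<longlonglongrightarrow> 0"
      by (rule Lim_null_comparison[rotated]) (simp add: le)
    then show ?thesis by (intro exI[of _ "\<lambda>n. n"]) (simp add: strict_mono_def)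
  next
    case False
    obtain r C \<beta> \<phi>1 \<psi>1 where r: "strict_mono (r :: nat \<Rightarrow> nat)" and \<beta>: "parameterizes \<beta> C"
      and h1: "\<And>n. homeomorphism {0..1} {0..1} (\<phi>1 n) (\<psi>1 n)" "\<And>n. mono_on {0..1} (\<phi>1 n)"
      and u: "uniform_limit {0..1} (\<lambda>n t. \<eta> (r n) (\<phi>1 n t)) \<beta> sequentially"
      by (rule lamination_convergent_subseq[OF LY B \<eta> False]) (rule that)
    have \<beta>a: "arc \<beta>" using \<beta> by (simp add: parameterizes_iff_arc)
    obtain r1 s' where r1: "strict_mono (r1 :: nat \<Rightarrow> nat)" and s': "s' \<in> {0..1}" "(\<lambda>n. s (r (r1 n))) \<longlonglongrightarrow> s'"
      using convergent_subseq_01[of "\<lambda>n. s (r n)"] s by blast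
    define R where "R = (\<lambda>n. r (r1 n))"
    have R: "strict_mono R" unfolding R_def using strict_mono_o[OF r r1] by (simp add: o_def)
    have sR: "(\<lambda>n. s (R n)) \<longlonglongrightarrow> s'" using s'(2) by (simp add: R_def)
    have uR: "uniform_limit {0..1} (\<lambda>n t. \<eta> (R n) (\<phi>1 (r1 n) t)) \<beta> sequentially"
      using uniform_limit_subseq[OF u r1] by (simp add: R_def)
    have u\<zeta>: "uniform_limit {0..1} (\<lambda>n t. \<zeta> (R n) (\<phi>1 (r1 n) t)) \<beta> sequentially"
      unfolding uniform_limit_iff
    proof (intro allI impI)
      fix e :: real assume e: "0 < e"
      have "\<forall>\<^sub>F n in sequentially. \<forall>t\<in>{0..1}. dist (\<eta> (R n) (\<phi>1 (r1 n) t)) (\<beta> t) < e / 2"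
        using uR[unfolded uniform_limit_iff, rule_format, of "e / 2"] e by simp
      moreover have "(\<lambda>n. \<delta> (R n)) \<longlonglongrightarrow> 0" using LIMSEQ_subseq_LIMSEQ[OF \<delta> R] by (simp add: o_def)
      then have "\<forall>\<^sub>F n in sequentially. \<delta> (R n) < e / 2" by (rule order_tendstoD(2)) (use e in simp)
      ultimately show "\<forall>\<^sub>F n in sequentially. \<forall>t\<in>{0..1}. dist (\<zeta> (R n) (\<phi>1 (r1 n) t)) (\<beta> t) < e"
      proof eventually_elim
        case (elim n)
        show ?case
        proof
          fix t :: real assume t: "t \<in> {0..1}"
          have "\<phi>1 (r1 n) t \<in> {0..1}" using mono_homeomorphism_01(4)[OF h1 t] .
          then have "dist (\<eta> (R n) (\<phi>1 (r1 n) t)) (\<zeta> (R n) (\<phi>1 (r1 n) t)) < \<delta> (R n)" unfolding \<zeta>_def by (rule c)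
          moreover have "dist (\<eta> (R n) (\<phi>1 (r1 n) t)) (\<beta> t) < e / 2" using elim(1) t by blast
          ultimately show "dist (\<zeta> (R n) (\<phi>1 (r1 n) t)) (\<beta> t) < e"
            using elim(2) dist_triangle3[of "\<zeta> (R n) (\<phi>1 (r1 n) t)" "\<beta> t" "\<eta> (R n) (\<phi>1 (r1 n) t)"] by linarith
        qed
      qed
    qed
    have 1: "(\<lambda>n. mid_param (\<eta> (R n)) (s (R n))) \<longlonglongrightarrow> mid_param \<beta> s'"
      by (rule mid_param_tendsto_reparam[where \<gamma> = "\<lambda>n. \<eta> (R n)", OF arcs(1) \<beta>a h1 uR s sR])
    have 2: "(\<lambda>n. mid_param (\<zeta> (R n)) (s (R n))) \<longlonglongrightarrow> mid_param \<beta> s'"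
      by (rule mid_param_tendsto_reparam[where \<gamma> = "\<lambda>n. \<zeta> (R n)", OF \<zeta> \<beta>a h1 u\<zeta> s sR])
    have "(\<lambda>n. dist (?F (x (R n))) (?F' (R n) (x (R n)))) \<longlonglongrightarrow> 0"
      unfolding Fx F'x using tendsto_dist[OF 1 2] by simp
    then show ?thesis using R by blast
  qed
qed

lemma canonical_extension_in_cfunspace:
  fixes X :: "'a::euclidean_space set"
  assumes LX: "lamination X LX" and p: "p \<in> lam_maps LX"
  shows "canonical_extension X LX p \<in> mspace (cfunspace (top_of_set X) (euclidean_metric :: 'a metric))"
proof -
  obtain Y LY f where p_eq: "p = (Y, LY, f)" by (cases p)
  have M: "(Y, LY, f) \<in> lam_maps LX" using p p_eq by simp
  have "bounded Y" using M by (simp add: lam_maps_def)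
  moreover have "canonical_extension X LX p ` X \<subseteq> Y" using canonical_extension_in[OF LX M] p_eq by auto
  ultimately have "bounded (canonical_extension X LX p ` X)" using bounded_subset by blast
  moreover have "canonical_extension X LX p \<in> extensional X" by (simp add: canonical_extension_def p_eq)
  moreover have "continuous_on X (canonical_extension X LX p)"
    using continuous_on_canonical_extension[OF LX M] p_eq by simp
  ultimately show ?thesis by simp
qed

lemma canonical_extension_continuous_at:
  fixes X :: "'a::euclidean_space set"
  assumes LX: "lamination X LX" and p: "p \<in> lam_maps LX" and e: "0 < \<epsilon>"
  shows "\<exists>\<delta>>0. \<forall>q\<in>lam_maps LX. lam_dist LX p q < ennreal \<delta> \<longrightarrow>
    mdist (cfunspace (top_of_set X) (euclidean_metric :: 'a metric)) (canonical_extension X LX p) (canonical_extension X LX q) < \<epsilon>"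
proof (rule ccontr)
  let ?d = "mdist (cfunspace (top_of_set X) (euclidean_metric :: 'a metric))"
  assume no: "\<not> ?thesis"
  have "\<forall>n. \<exists>q. q \<in> lam_maps LX \<and> lam_dist LX p q < ennreal (1 / real (Suc n)) \<and>
      \<epsilon> \<le> ?d (canonical_extension X LX p) (canonical_extension X LX q)"
  proof
    fix n
    have "0 < 1 / real (Suc n)" by simp
    then show "\<exists>q. q \<in> lam_maps LX \<and> lam_dist LX p q < ennreal (1 / real (Suc n)) \<and>
        \<epsilon> \<le> ?d (canonical_extension X LX p) (canonical_extension X LX q)"
      using no by (meson not_le)
  qed
  then obtain q where q: "\<And>n. q n \<in> lam_maps LX" "\<And>n. lam_dist LX p (q n) < ennreal (1 / real (Suc n))"
    "\<And>n. \<epsilon> \<le> ?d (canonical_extension X LX p) (canonical_extension X LX (q n))" by metis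
  \<comment> \<open>The supremum need not be attained; passing to \<epsilon> / 2 yields an actual
    point.\<close>
  have "\<exists>x\<in>X. \<epsilon> / 2 < dist (canonical_extension X LX p x) (canonical_extension X LX (q n) x)" for n
  proof (rule ccontr)
    assume "\<not> ?thesis"
    then have "?d (canonical_extension X LX p) (canonical_extension X LX (q n)) \<le> \<epsilon> / 2"
      using e by (intro mdist_cfunspace_le) (auto simp: not_less)
    then show False using q(3)[of n] e by linarith
  qed
  then obtain x where x: "\<And>n. x n \<in> X" "\<And>n. \<epsilon> / 2 < dist (canonical_extension X LX p (x n)) (canonical_extension X LX (q n) (x n))"
    by metis
  obtain Y LY f where p_eq: "p = (Y, LY, f)" by (cases p)
  define Y' LY' f' where "Y' = (\<lambda>n. fst (q n))" and "LY' = (\<lambda>n. fst (snd (q n)))" and "f' = (\<lambda>n. snd (snd (q n)))"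
  have q_eq: "q n = (Y' n, LY' n, f' n)" for n by (simp add: Y'_def LY'_def f'_def)
  have M: "(Y, LY, f) \<in> lam_maps LX" using p p_eq by simp
  have lim: "(\<lambda>n. 1 / real (Suc n)) \<longlonglongrightarrow> 0" using LIMSEQ_inverse_real_of_nat by (simp add: inverse_eq_divide)
  have "\<exists>r. strict_mono (r :: nat \<Rightarrow> nat) \<and>
    (\<lambda>n. dist (canonical_extension X LX p (x (r n))) (canonical_extension X LX (q (r n)) (x (r n)))) \<longlonglongrightarrow> 0"
    unfolding q_eq p_eq
    by (rule canonical_extension_close_subseq[OF LX M q(1)[unfolded q_eq] q(2)[unfolded q_eq p_eq] lim x(1)])
  then obtain r where r: "strict_mono (r :: nat \<Rightarrow> nat)"
    "(\<lambda>n. dist (canonical_extension X LX p (x (r n))) (canonical_extension X LX (q (r n)) (x (r n)))) \<longlonglongrightarrow> 0"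
    by (elim exE conjE)
  have "\<epsilon> / 2 \<le> 0"
    by (rule LIMSEQ_le_const[OF r(2)]) (use x(2) in \<open>auto intro: less_imp_le\<close>)
  then show False using e by simp
qed

lemma identity_in_lam_maps:
  fixes X :: "'a::metric_space set"
  assumes LX: "lamination X LX" and "bounded X"
  shows "(X, LX, id) \<in> lam_maps LX"
  using assms by (auto simp: lam_maps_def continuous_on_id id_def)

text \<open>Every arc corresponds to itself, so \<gamma> can take the role of \<eta>.\<close>

lemma canonical_extension_id:
  fixes X :: "'a::euclidean_space set"
  assumes LX: "lamination X LX" and b: "bounded X"
  shows "canonical_extension X LX (X, LX, id) = (\<lambda>x\<in>X. x)"
proof
  fix x
  note M = identity_in_lam_maps[OF assms]
  show "canonical_extension X LX (X, LX, id) x = (\<lambda>x\<in>X. x) x"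
  proof (cases "x \<in> X")
    case True
    from domain_point[OF LX M this] obtain A \<gamma> \<eta> s where A: "A \<in> LX" "parameterizes \<gamma> A" "corresponding_param LX id A \<gamma> \<eta>" "s \<in> {0..1}" and x: "x = mid_param \<gamma> s"
      by (elim exE conjE)
    have "corresponding_arc LX id A = A" by (rule corresponding_arc_eqI[OF M A(1) A(1)]) simp
    then have "corresponding_param LX id A \<gamma> \<gamma>" using A(2) by (simp add: corresponding_param_def)
    from canonical_extension_mid_param[OF LX M A(1,2) this A(4)] show ?thesis using True x by simp
  qed (simp add: canonical_extension_def)
qed

text \<open>Continuity is written with \<epsilon> and \<delta> because \<open>lam_dist\<close> is an
  extended-valued pseudometric. Members of \<open>cfunspace\<close> are extensional, hence the
  identity appears restricted to \<open>X\<close>.\<close>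

theorem theorem17:
  fixes X :: "(real ^ 'n) set" and LX :: "(real ^ 'n) set set"
  assumes "2 \<le> CARD('n)"
    and "lamination X LX"
  defines "M \<equiv> lam_maps LX"
    and "Cb \<equiv> cfunspace (top_of_set X) (euclidean_metric :: (real ^ 'n) metric)"
    and "\<Theta> \<equiv> canonical_extension X LX"
  shows "\<Theta> \<in> M \<rightarrow> mspace Cb
    \<and> (\<forall>(Y, LY, f) \<in> M. \<Theta> (Y, LY, f) \<in> X \<rightarrow> Y \<and> (\<forall>p\<in>lam_ends LX. \<Theta> (Y, LY, f) p = f p))
    \<and> (\<forall>p\<in>M. \<forall>\<epsilon>>0. \<exists>\<delta>>0. \<forall>q\<in>M. lam_dist LX p q < ennreal \<delta> \<longrightarrow> mdist Cb (\<Theta> p) (\<Theta> q) < \<epsilon>)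
    \<and> (bounded X \<longrightarrow> (X, LX, id) \<in> M \<and> \<Theta> (X, LX, id) = (\<lambda>x\<in>X. x))"
proof (intro conjI impI ballI allI)
  note LX = assms(2)
  show "\<Theta> \<in> M \<rightarrow> mspace Cb"
    unfolding \<Theta>_def M_def Cb_def by (rule Pi_I) (rule canonical_extension_in_cfunspace[OF LX])
  show "case z of (Y, LY, f) \<Rightarrow> \<Theta> (Y, LY, f) \<in> X \<rightarrow> Y \<and> (\<forall>p\<in>lam_ends LX. \<Theta> (Y, LY, f) p = f p)"
    if "z \<in> M" for z
  proof (cases z)
    case (fields Y LY f)
    then have "(Y, LY, f) \<in> lam_maps LX" using that by (simp add: M_def)
    from canonical_extension_in[OF LX this] canonical_extension_ends[OF LX this]
    show ?thesis unfolding fields prod.case \<Theta>_def by blast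
  qed
  show "\<exists>\<delta>>0. \<forall>q\<in>M. lam_dist LX p q < ennreal \<delta> \<longrightarrow> mdist Cb (\<Theta> p) (\<Theta> q) < \<epsilon>"
    if "p \<in> M" "0 < \<epsilon>" for p \<epsilon>
    using canonical_extension_continuous_at[OF LX] that unfolding M_def Cb_def \<Theta>_def by blast
  show "(X, LX, id) \<in> M" if "bounded X"
    unfolding M_def by (rule identity_in_lam_maps[OF LX that])
  show "\<Theta> (X, LX, id) = (\<lambda>x\<in>X. x)" if "bounded X"
    unfolding \<Theta>_def by (rule canonical_extension_id[OF LX that])
qed

end
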